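(* A metric $f$-manifold $(M^{2n+s},\phi,\xi_i,\eta_j,g)$ which is normal admits a unique almost metric $\phi$-connection $\nabla$ with skew-torsion if and only if each $\xi_i$ is a Killing vector field. In this case the torsion 3-form $T$ of $\nabla$ is given by $$T=\sum_{i=1}^{s}\eta_i\wedge d\eta_i+d^{\phi}F.$$
   Context: Manifolds are smooth and connected. A metric $f$-manifold $(M^{2n+s},\phi,\xi_i,\eta_j,g)$ is a $(2n+s)$-dimensional manifold $M$ with a $(1,1)$-tensor field $\phi$ of constant rank $2n$ satisfying $\phi^3+\phi=0$, global vector fields $\xi_1,\dots,\xi_s$ and 1-forms $\eta_1,\dots,\eta_s$ with $\ker\phi=\langle\xi_1,\dots,\xi_s\rangle$, $\eta_i(\xi_j)=\delta_{ij}$, $\eta_i\circ\phi=0$, $\phi^2=-\mathrm{Id}+\sum_i\eta_i\otimes\xi_i$, and a Riemannian metric $g$ with $g(\phi X,\phi Y)=g(X,Y)-\sum_i\eta_i(X)\eta_i(Y)$. (For $s=0$ terms and conditions involving $\xi_i,\eta_i$ are omitted.) The fundamental 2-form is $F(X,Y)=g(X,\phi Y)$, and $d^{\phi}F(X,Y,Z):=-dF(\phi X,\phi Y,\phi Z)$. Convention: $d\eta(X,Y)=X\eta(Y)-Y\eta(X)-\eta([X,Y])$, and correspondingly (no numerical factors) for 2-forms; for a 1-form $\eta$ and a 2-form $\omega$, $(\eta\wedge\omega)(X,Y,Z)=\eta(X)\omega(Y,Z)-\eta(Y)\omega(X,Z)+\eta(Z)\omega(X,Y)$. The Nijenhuis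 tensor is $N^{(1)}=N_\phi+\sum_i d\eta_i\otimes\xi_i$ with $N_\phi(X,Y)=[\phi X,\phi Y]+\phi^2[X,Y]-\phi[X,\phi Y]-\phi[\phi X,Y]$; the structure is normal if $N^{(1)}=0$. An affine connection $\nabla$ is an almost metric $\phi$-connection if $\nabla g=0$, $\nabla\phi=0$, $\nabla\xi_i=0$, $\nabla\eta_i=0$ for all $i$. It has skew-torsion if $T(X,Y,Z):=g(T(X,Y),Z)$ is a 3-form, where $T(X,Y)=\nabla_XY-\nabla_YX-[X,Y]$. *)

theory Defs
  imports "HOL-Analysis.Analysis"
begin

section \<open>Smooth maps between Euclidean spaces\<close>

text \<open>Only meant for open sets \<open>U\<close>: the derivatives are the two-sided ones.\<close>

primrec Ck_on :: "nat \<Rightarrow> 'a::euclidean_space set \<Rightarrow> ('a \<Rightarrow> 'b::real_normed_vector) \<Rightarrow> bool" where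
  "Ck_on 0 U f \<longleftrightarrow> continuous_on U f"
| "Ck_on (Suc k) U f \<longleftrightarrow>
     (\<forall>x\<in>U. f differentiable (at x)) \<and>
     (\<forall>v. Ck_on k U (\<lambda>x. frechet_derivative f (at x) v))"

definition smooth_on :: "'a::euclidean_space set \<Rightarrow> ('a \<Rightarrow> 'b::real_normed_vector) \<Rightarrow> bool" where
  "smooth_on U f \<longleftrightarrow> (\<forall>k. Ck_on k U f)"


section \<open>Smooth manifolds\<close>

text \<open>
  The manifold is the whole type \<open>'m\<close>, the model space is \<open>'e\<close>, so its dimension
  is \<open>DIM('e)\<close>. Values of \<open>chart_map c\<close> outside \<open>chart_dom c\<close> are irrelevant.
\<close>

datatype ('m, 'e) chart = Chart (chart_dom: "'m set") (chart_map: "'m \<Rightarrow> 'e")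

definition chart_im :: "('m, 'e) chart \<Rightarrow> 'e set" where
  "chart_im c = chart_map c ` chart_dom c"

definition chart_inv :: "('m, 'e) chart \<Rightarrow> 'e \<Rightarrow> 'm" where
  "chart_inv c = inv_into (chart_dom c) (chart_map c)"

locale smooth_manifold =
  fixes A :: "('m::{t2_space,second_countable_topology}, 'e::euclidean_space) chart set"
  assumes connected_space: "connected (UNIV :: 'm set)"
    and charts_cover: "(\<Union>c\<in>A. chart_dom c) = UNIV"
    and open_dom: "c \<in> A \<Longrightarrow> open (chart_dom c)"
    and open_im: "c \<in> A \<Longrightarrow> open (chart_im c)"
    and homeo: "c \<in> A \<Longrightarrow>
      homeomorphism (chart_dom c) (chart_im c) (chart_map c) (chart_inv c)"
    and compat: "c \<in> A \<Longrightarrow> d \<in> A \<Longrightarrow>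
      smooth_on (chart_map c ` (chart_dom c \<inter> chart_dom d)) (chart_map d \<circ> chart_inv c)"

text \<open>
  A tangent vector at \<open>p\<close> is given by its component vector in a preferred chart
  \<open>chart_at A p\<close> of the atlas around \<open>p\<close>; so every tangent space is the type \<open>'e\<close>, and
  fields of vectors, covectors etc. are functions on \<open>'m\<close>. The preferred chart may jump
  from point to point. Smoothness is therefore always expressed in the charts of the
  atlas, using the change of components \<open>chart_diff\<close> (the differential at \<open>p\<close> of
  \<open>chart_map c\<close>) and its inverse \<open>chart_frame\<close> (at \<open>p\<close>, the coordinate vector of the
  chart \<open>c\<close> with components \<open>v\<close>).
\<close>

definition chart_at :: "('m, 'e) chart set \<Rightarrow> 'm \<Rightarrow> ('m, 'e) chart" where
  "chart_at A p = (SOME c. c \<in> A \<and> p \<in> chart_dom c)"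

definition chart_diff ::
    "('m, 'e::euclidean_space) chart set \<Rightarrow> ('m, 'e) chart \<Rightarrow> 'm \<Rightarrow> 'e \<Rightarrow> 'e" where
  "chart_diff A c p =
     frechet_derivative (chart_map c \<circ> chart_inv (chart_at A p)) (at (chart_map (chart_at A p) p))"

definition chart_frame ::
    "('m, 'e::euclidean_space) chart set \<Rightarrow> ('m, 'e) chart \<Rightarrow> 'm \<Rightarrow> 'e \<Rightarrow> 'e" where
  "chart_frame A c p =
     frechet_derivative (chart_map (chart_at A p) \<circ> chart_inv c) (at (chart_map c p))"

definition smooth_functions :: "('m, 'e::euclidean_space) chart set \<Rightarrow> ('m \<Rightarrow> real) set" where
  "smooth_functions A = {f. \<forall>c\<in>A. smooth_on (chart_im c) (f \<circ> chart_inv c)}"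

text \<open>The components of the vector field \<open>X\<close> in the chart \<open>c\<close>, as a function of the coordinates.\<close>

definition vf_rep ::
    "('m, 'e::euclidean_space) chart set \<Rightarrow> ('m, 'e) chart \<Rightarrow> ('m \<Rightarrow> 'e) \<Rightarrow> 'e \<Rightarrow> 'e" where
  "vf_rep A c X x = chart_diff A c (chart_inv c x) (X (chart_inv c x))"

definition vector_fields :: "('m, 'e::euclidean_space) chart set \<Rightarrow> ('m \<Rightarrow> 'e) set" where
  "vector_fields A = {X. \<forall>c\<in>A. smooth_on (chart_im c) (vf_rep A c X)}"

definition one_forms :: "('m, 'e::euclidean_space) chart set \<Rightarrow> ('m \<Rightarrow> 'e \<Rightarrow> real) set" where
  "one_forms A = {\<eta>. (\<forall>p. linear (\<eta> p)) \<and>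
     (\<forall>c\<in>A. \<forall>v. smooth_on (chart_im c)
        ((\<lambda>p. \<eta> p (chart_frame A c p v)) \<circ> chart_inv c))}"

definition endo_fields :: "('m, 'e::euclidean_space) chart set \<Rightarrow> ('m \<Rightarrow> 'e \<Rightarrow> 'e) set" where
  "endo_fields A = {\<phi>. (\<forall>p. linear (\<phi> p)) \<and>
     (\<forall>c\<in>A. \<forall>v. smooth_on (chart_im c)
        ((\<lambda>p. chart_diff A c p (\<phi> p (chart_frame A c p v))) \<circ> chart_inv c))}"

definition riemannian_metrics ::
    "('m, 'e::euclidean_space) chart set \<Rightarrow> ('m \<Rightarrow> 'e \<Rightarrow> 'e \<Rightarrow> real) set" where
  "riemannian_metrics A = {g.
     (\<forall>p. bilinear (g p) \<and> (\<forall>u v. g p u v = g p v u) \<and> (\<forall>v. v \<noteq> 0 \<longrightarrow> g p v v > 0)) \<and>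
     (\<forall>c\<in>A. \<forall>u v. smooth_on (chart_im c)
        ((\<lambda>p. g p (chart_frame A c p u) (chart_frame A c p v)) \<circ> chart_inv c))}"

text \<open>
  The function \<open>X f\<close>, and the Lie bracket of vector fields by its coordinate formula
  \<open>[X,Y] = DY(X) - DX(Y)\<close>. Both are computed at \<open>p\<close> in the preferred chart at \<open>p\<close>, in
  which the components of a tangent vector at \<open>p\<close> are that vector itself.
\<close>

definition vf_deriv ::
    "('m, 'e::euclidean_space) chart set \<Rightarrow> ('m \<Rightarrow> 'e) \<Rightarrow> ('m \<Rightarrow> real) \<Rightarrow> 'm \<Rightarrow> real" where
  "vf_deriv A X f p = (let c = chart_at A p in
     frechet_derivative (f \<circ> chart_inv c) (at (chart_map c p)) (X p))"

definition lie_bracket ::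
    "('m, 'e::euclidean_space) chart set \<Rightarrow> ('m \<Rightarrow> 'e) \<Rightarrow> ('m \<Rightarrow> 'e) \<Rightarrow> 'm \<Rightarrow> 'e" where
  "lie_bracket A X Y p = (let c = chart_at A p; x = chart_map c p in
     frechet_derivative (vf_rep A c Y) (at x) (X p) -
     frechet_derivative (vf_rep A c X) (at x) (Y p))"


section \<open>Differential forms\<close>

text \<open>
  \<open>d_one\<close> and \<open>d_two\<close> are the exterior derivatives of a 1-form and of a 2-form, with no
  numerical factors; their results are given by their values on vector fields.
\<close>

definition d_one ::
    "('m, 'e::euclidean_space) chart set \<Rightarrow> ('m \<Rightarrow> 'e \<Rightarrow> real) \<Rightarrow>
     ('m \<Rightarrow> 'e) \<Rightarrow> ('m \<Rightarrow> 'e) \<Rightarrow> 'm \<Rightarrow> real" where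
  "d_one A \<eta> X Y p =
     vf_deriv A X (\<lambda>q. \<eta> q (Y q)) p - vf_deriv A Y (\<lambda>q. \<eta> q (X q)) p
     - \<eta> p (lie_bracket A X Y p)"

definition d_two ::
    "('m, 'e::euclidean_space) chart set \<Rightarrow> ('m \<Rightarrow> 'e \<Rightarrow> 'e \<Rightarrow> real) \<Rightarrow>
     ('m \<Rightarrow> 'e) \<Rightarrow> ('m \<Rightarrow> 'e) \<Rightarrow> ('m \<Rightarrow> 'e) \<Rightarrow> 'm \<Rightarrow> real" where
  "d_two A \<omega> X Y Z p =
     vf_deriv A X (\<lambda>q. \<omega> q (Y q) (Z q)) p
     - vf_deriv A Y (\<lambda>q. \<omega> q (X q) (Z q)) p
     + vf_deriv A Z (\<lambda>q. \<omega> q (X q) (Y q)) p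
     - \<omega> p (lie_bracket A X Y p) (Z p)
     + \<omega> p (lie_bracket A X Z p) (Y p)
     - \<omega> p (lie_bracket A Y Z p) (X p)"

definition wedge_one_two ::
    "('m \<Rightarrow> 'e \<Rightarrow> real) \<Rightarrow> (('m \<Rightarrow> 'e) \<Rightarrow> ('m \<Rightarrow> 'e) \<Rightarrow> 'm \<Rightarrow> real) \<Rightarrow>
     ('m \<Rightarrow> 'e) \<Rightarrow> ('m \<Rightarrow> 'e) \<Rightarrow> ('m \<Rightarrow> 'e) \<Rightarrow> 'm \<Rightarrow> real" where
  "wedge_one_two \<eta> \<omega> X Y Z p =
     \<eta> p (X p) * \<omega> Y Z p - \<eta> p (Y p) * \<omega> X Z p + \<eta> p (Z p) * \<omega> X Y p"

definition tensorial ::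
    "('m, 'e::euclidean_space) chart set \<Rightarrow> (('m \<Rightarrow> 'e) \<Rightarrow> 'm \<Rightarrow> real) \<Rightarrow> bool" where
  "tensorial A L \<longleftrightarrow>
     (\<forall>X\<in>vector_fields A. L X \<in> smooth_functions A) \<and>
     (\<forall>X\<in>vector_fields A. \<forall>Y\<in>vector_fields A. \<forall>p. L (\<lambda>q. X q + Y q) p = L X p + L Y p) \<and>
     (\<forall>f\<in>smooth_functions A. \<forall>X\<in>vector_fields A. \<forall>p. L (\<lambda>q. f q *\<^sub>R X q) p = f p * L X p)"

text \<open>3-forms as alternating maps on vector fields, multilinear over the smooth functions.\<close>

definition is_three_form ::
    "('m, 'e::euclidean_space) chart set \<Rightarrow>
     (('m \<Rightarrow> 'e) \<Rightarrow> ('m \<Rightarrow> 'e) \<Rightarrow> ('m \<Rightarrow> 'e) \<Rightarrow> 'm \<Rightarrow> real) \<Rightarrow> bool" where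
  "is_three_form A T \<longleftrightarrow>
     (\<forall>X\<in>vector_fields A. \<forall>Y\<in>vector_fields A.
        tensorial A (\<lambda>Z. T Z X Y) \<and> tensorial A (\<lambda>Z. T X Z Y) \<and> tensorial A (\<lambda>Z. T X Y Z)) \<and>
     (\<forall>X\<in>vector_fields A. \<forall>Y\<in>vector_fields A. \<forall>Z\<in>vector_fields A. \<forall>p.
        T X Y Z p = - T Y X Z p \<and> T X Y Z p = - T X Z Y p)"


section \<open>Metric f-manifolds\<close>

locale metric_f_manifold = smooth_manifold A
  for A :: "('m::{t2_space,second_countable_topology}, 'e::euclidean_space) chart set" +
  fixes n s :: nat
    and \<phi> :: "'m \<Rightarrow> 'e \<Rightarrow> 'e"
    and \<xi> :: "nat \<Rightarrow> 'm \<Rightarrow> 'e"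
    and \<eta> :: "nat \<Rightarrow> 'm \<Rightarrow> 'e \<Rightarrow> real"
    and g :: "'m \<Rightarrow> 'e \<Rightarrow> 'e \<Rightarrow> real"
  assumes dimension: "DIM('e) = 2 * n + s"
    and phi_field: "\<phi> \<in> endo_fields A"
    and phi_rank: "dim (range (\<phi> p)) = 2 * n"
    and phi_cube: "\<phi> p (\<phi> p (\<phi> p v)) + \<phi> p v = 0"
    and xi_field: "i \<in> {1..s} \<Longrightarrow> \<xi> i \<in> vector_fields A"
    and eta_form: "i \<in> {1..s} \<Longrightarrow> \<eta> i \<in> one_forms A"
    and ker_phi: "{v. \<phi> p v = 0} = span ((\<lambda>i. \<xi> i p) ` {1..s})"
    and eta_xi: "i \<in> {1..s} \<Longrightarrow> j \<in> {1..s} \<Longrightarrow> \<eta> i p (\<xi> j p) = (if i = j then 1 else 0)"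
    and eta_phi: "i \<in> {1..s} \<Longrightarrow> \<eta> i p (\<phi> p v) = 0"
    and phi_square: "\<phi> p (\<phi> p v) = - v + (\<Sum>i\<in>{1..s}. \<eta> i p v *\<^sub>R \<xi> i p)"
    and metric: "g \<in> riemannian_metrics A"
    and metric_compat:
      "g p (\<phi> p u) (\<phi> p v) = g p u v - (\<Sum>i\<in>{1..s}. \<eta> i p u * \<eta> i p v)"

definition fundamental_form ::
    "('m \<Rightarrow> 'e \<Rightarrow> 'e) \<Rightarrow> ('m \<Rightarrow> 'e \<Rightarrow> 'e \<Rightarrow> real) \<Rightarrow> 'm \<Rightarrow> 'e \<Rightarrow> 'e \<Rightarrow> real" where
  "fundamental_form \<phi> g p u v = g p u (\<phi> p v)"

definition d_phi_F ::
    "('m, 'e::euclidean_space) chart set \<Rightarrow> ('m \<Rightarrow> 'e \<Rightarrow> 'e) \<Rightarrow> ('m \<Rightarrow> 'e \<Rightarrow> 'e \<Rightarrow> real) \<Rightarrow>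
     ('m \<Rightarrow> 'e) \<Rightarrow> ('m \<Rightarrow> 'e) \<Rightarrow> ('m \<Rightarrow> 'e) \<Rightarrow> 'm \<Rightarrow> real" where
  "d_phi_F A \<phi> g X Y Z p =
     - d_two A (fundamental_form \<phi> g) (\<lambda>q. \<phi> q (X q)) (\<lambda>q. \<phi> q (Y q)) (\<lambda>q. \<phi> q (Z q)) p"

definition nijenhuis_phi ::
    "('m, 'e::euclidean_space) chart set \<Rightarrow> ('m \<Rightarrow> 'e \<Rightarrow> 'e) \<Rightarrow>
     ('m \<Rightarrow> 'e) \<Rightarrow> ('m \<Rightarrow> 'e) \<Rightarrow> 'm \<Rightarrow> 'e" where
  "nijenhuis_phi A \<phi> X Y p =
     lie_bracket A (\<lambda>q. \<phi> q (X q)) (\<lambda>q. \<phi> q (Y q)) p + \<phi> p (\<phi> p (lie_bracket A X Y p))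
     - \<phi> p (lie_bracket A X (\<lambda>q. \<phi> q (Y q)) p) - \<phi> p (lie_bracket A (\<lambda>q. \<phi> q (X q)) Y p)"

definition nijenhuis_one ::
    "('m, 'e::euclidean_space) chart set \<Rightarrow> nat \<Rightarrow> ('m \<Rightarrow> 'e \<Rightarrow> 'e) \<Rightarrow> (nat \<Rightarrow> 'm \<Rightarrow> 'e) \<Rightarrow>
     (nat \<Rightarrow> 'm \<Rightarrow> 'e \<Rightarrow> real) \<Rightarrow> ('m \<Rightarrow> 'e) \<Rightarrow> ('m \<Rightarrow> 'e) \<Rightarrow> 'm \<Rightarrow> 'e" where
  "nijenhuis_one A s \<phi> \<xi> \<eta> X Y p =
     nijenhuis_phi A \<phi> X Y p + (\<Sum>i\<in>{1..s}. d_one A (\<eta> i) X Y p *\<^sub>R \<xi> i p)"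

definition normal_f_structure ::
    "('m, 'e::euclidean_space) chart set \<Rightarrow> nat \<Rightarrow> ('m \<Rightarrow> 'e \<Rightarrow> 'e) \<Rightarrow> (nat \<Rightarrow> 'm \<Rightarrow> 'e) \<Rightarrow>
     (nat \<Rightarrow> 'm \<Rightarrow> 'e \<Rightarrow> real) \<Rightarrow> bool" where
  "normal_f_structure A s \<phi> \<xi> \<eta> \<longleftrightarrow>
     (\<forall>X\<in>vector_fields A. \<forall>Y\<in>vector_fields A. \<forall>p. nijenhuis_one A s \<phi> \<xi> \<eta> X Y p = 0)"

definition lie_deriv_metric ::
    "('m, 'e::euclidean_space) chart set \<Rightarrow> ('m \<Rightarrow> 'e \<Rightarrow> 'e \<Rightarrow> real) \<Rightarrow>
     ('m \<Rightarrow> 'e) \<Rightarrow> ('m \<Rightarrow> 'e) \<Rightarrow> ('m \<Rightarrow> 'e) \<Rightarrow> 'm \<Rightarrow> real" where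
  "lie_deriv_metric A g V Y Z p =
     vf_deriv A V (\<lambda>q. g q (Y q) (Z q)) p
     - g p (lie_bracket A V Y p) (Z p) - g p (Y p) (lie_bracket A V Z p)"

definition killing ::
    "('m, 'e::euclidean_space) chart set \<Rightarrow> ('m \<Rightarrow> 'e \<Rightarrow> 'e \<Rightarrow> real) \<Rightarrow> ('m \<Rightarrow> 'e) \<Rightarrow> bool" where
  "killing A g V \<longleftrightarrow> V \<in> vector_fields A \<and>
     (\<forall>Y\<in>vector_fields A. \<forall>Z\<in>vector_fields A. \<forall>p. lie_deriv_metric A g V Y Z p = 0)"


section \<open>Connections\<close>

text \<open>
  A connection \<open>D\<close> sends vector fields \<open>X\<close>, \<open>Y\<close> to the covariant derivative \<open>D X Y\<close> of
  \<open>Y\<close> along \<open>X\<close>. The extensional function spaces fix the junk values on arguments that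
  are not vector fields, so that equality of connections is equality in HOL.
\<close>

definition affine_connections ::
    "('m, 'e::euclidean_space) chart set \<Rightarrow> (('m \<Rightarrow> 'e) \<Rightarrow> ('m \<Rightarrow> 'e) \<Rightarrow> ('m \<Rightarrow> 'e)) set" where
  "affine_connections A =
     {D \<in> vector_fields A \<rightarrow>\<^sub>E (vector_fields A \<rightarrow>\<^sub>E vector_fields A).
       (\<forall>X\<in>vector_fields A. \<forall>Y\<in>vector_fields A. \<forall>Z\<in>vector_fields A. \<forall>p.
          D (\<lambda>q. X q + Y q) Z p = D X Z p + D Y Z p \<and>
          D X (\<lambda>q. Y q + Z q) p = D X Y p + D X Z p) \<and>
       (\<forall>f\<in>smooth_functions A. \<forall>X\<in>vector_fields A. \<forall>Y\<in>vector_fields A. \<forall>p.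
          D (\<lambda>q. f q *\<^sub>R X q) Y p = f p *\<^sub>R D X Y p \<and>
          D X (\<lambda>q. f q *\<^sub>R Y q) p = vf_deriv A X f p *\<^sub>R Y p + f p *\<^sub>R D X Y p)}"

definition torsion ::
    "('m, 'e::euclidean_space) chart set \<Rightarrow> (('m \<Rightarrow> 'e) \<Rightarrow> ('m \<Rightarrow> 'e) \<Rightarrow> ('m \<Rightarrow> 'e)) \<Rightarrow>
     ('m \<Rightarrow> 'e) \<Rightarrow> ('m \<Rightarrow> 'e) \<Rightarrow> 'm \<Rightarrow> 'e" where
  "torsion A D X Y p = D X Y p - D Y X p - lie_bracket A X Y p"

definition torsion_form ::
    "('m, 'e::euclidean_space) chart set \<Rightarrow> ('m \<Rightarrow> 'e \<Rightarrow> 'e \<Rightarrow> real) \<Rightarrow>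
     (('m \<Rightarrow> 'e) \<Rightarrow> ('m \<Rightarrow> 'e) \<Rightarrow> ('m \<Rightarrow> 'e)) \<Rightarrow>
     ('m \<Rightarrow> 'e) \<Rightarrow> ('m \<Rightarrow> 'e) \<Rightarrow> ('m \<Rightarrow> 'e) \<Rightarrow> 'm \<Rightarrow> real" where
  "torsion_form A g D X Y Z p = g p (torsion A D X Y p) (Z p)"

definition has_skew_torsion ::
    "('m, 'e::euclidean_space) chart set \<Rightarrow> ('m \<Rightarrow> 'e \<Rightarrow> 'e \<Rightarrow> real) \<Rightarrow>
     (('m \<Rightarrow> 'e) \<Rightarrow> ('m \<Rightarrow> 'e) \<Rightarrow> ('m \<Rightarrow> 'e)) \<Rightarrow> bool" where
  "has_skew_torsion A g D \<longleftrightarrow> is_three_form A (torsion_form A g D)"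

definition almost_metric_phi_connection ::
    "('m, 'e::euclidean_space) chart set \<Rightarrow> nat \<Rightarrow> ('m \<Rightarrow> 'e \<Rightarrow> 'e) \<Rightarrow> (nat \<Rightarrow> 'm \<Rightarrow> 'e) \<Rightarrow>
     (nat \<Rightarrow> 'm \<Rightarrow> 'e \<Rightarrow> real) \<Rightarrow> ('m \<Rightarrow> 'e \<Rightarrow> 'e \<Rightarrow> real) \<Rightarrow>
     (('m \<Rightarrow> 'e) \<Rightarrow> ('m \<Rightarrow> 'e) \<Rightarrow> ('m \<Rightarrow> 'e)) \<Rightarrow> bool" where
  "almost_metric_phi_connection A s \<phi> \<xi> \<eta> g D \<longleftrightarrow>
     D \<in> affine_connections A \<and>
     (\<forall>X\<in>vector_fields A. \<forall>Y\<in>vector_fields A. \<forall>Z\<in>vector_fields A. \<forall>p.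
        vf_deriv A X (\<lambda>q. g q (Y q) (Z q)) p - g p (D X Y p) (Z p) - g p (Y p) (D X Z p) = 0) \<and>
     (\<forall>X\<in>vector_fields A. \<forall>Y\<in>vector_fields A. \<forall>p.
        D X (\<lambda>q. \<phi> q (Y q)) p - \<phi> p (D X Y p) = 0) \<and>
     (\<forall>i\<in>{1..s}. \<forall>X\<in>vector_fields A. \<forall>p. D X (\<xi> i) p = 0) \<and>
     (\<forall>i\<in>{1..s}. \<forall>X\<in>vector_fields A. \<forall>Y\<in>vector_fields A. \<forall>p.
        vf_deriv A X (\<lambda>q. \<eta> i q (Y q)) p - \<eta> i p (D X Y p) = 0)"

end

theory Submission
  imports Defs
begin

text \<open>
  A metric connection with skew torsion is determined by its torsion 3-form through the Koszul
  formula, and every 3-form is the torsion of such a connection (\<open>metric_connection_exists\<close>,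
  \<open>metric_connection_unique\<close>). So the question is which 3-form can occur, and when the
  connection that it defines preserves the remaining structure.

  For an almost metric \<open>\<phi>\<close>-connection the torsion \<open>T\<close> is forced. Since \<open>\<eta> i\<close> is parallel,
  \<open>\<eta> i (T(X, Y)) = d\<eta> i (X, Y)\<close>. Since \<open>\<phi>\<close> is parallel, \<open>N = 0\<close> becomes the algebraic identity
  \<open>T(X, Y, Z) = T(\<phi>X, \<phi>Y, Z) + T(X, \<phi>Y, \<phi>Z) + T(\<phi>X, Y, \<phi>Z)\<close>, and \<open>dF\<close> is the cyclic sum of
  \<open>T(X, Y, \<phi>Z)\<close>. Inserting \<open>\<phi>X\<close>, \<open>\<phi>Y\<close>, \<open>\<phi>Z\<close> into the latter and using the former gives
  \<open>T = \<Sum> \<eta> i \<and> d\<eta> i + d\<^sup>\<phi>F\<close>. This proves uniqueness and the formula. A parallel vector field of a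
  metric connection with skew torsion is a Killing field, which proves one direction.

  Conversely, let \<open>D\<close> be the metric connection with this torsion. If \<open>\<xi> i\<close> is Killing, the Koszul
  formula shows that \<open>\<xi> i\<close> is parallel (\<open>killing_xi_parallel\<close>), hence so is \<open>\<eta> i\<close>. It remains to see
  that \<open>\<phi>\<close> is parallel (\<open>phi_parallel\<close>). The two identities above, now with correction terms in
  \<open>\<nabla>\<phi>\<close> (\<open>nijenhuis_torsion\<close>, \<open>torsion_defect\<close>), combine to a linear relation for \<open>\<nabla>\<phi>\<close> which,
  together with its symmetries, only has the zero solution.

  The analytic part provides what these computations use: the rules for derivatives and brackets
  of vector fields, which rest on the symmetry of second derivatives, and the representation of a
  1-form by a smooth vector field (\<open>riesz_field\<close>), which turns the Koszul formula into a
  definition of the connection.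
\<close>

section \<open>Calculus of smooth maps\<close>

lemma frechet_derivative_cong_open:
  assumes "open U" "x \<in> U" "\<And>y. y \<in> U \<Longrightarrow> f y = h y"
  shows "frechet_derivative f (at x) = frechet_derivative h (at x)"
proof -
  have "(f has_derivative f') (at x) \<longleftrightarrow> (h has_derivative f') (at x)" for f'
    using has_derivative_transform_within_open[of f f' x UNIV U h]
      has_derivative_transform_within_open[of h f' x UNIV U f] assms by auto
  then show ?thesis
    by (simp add: frechet_derivative_def)
qed

lemma differentiable_cong_open:
  assumes "f differentiable (at x)" "open U" "x \<in> U" "\<And>y. y \<in> U \<Longrightarrow> f y = h y"
  shows "h differentiable (at x)"
  using assms has_derivative_transform_within_open[of f _ x UNIV U h]
  unfolding differentiable_def by blast

lemma frechet_derivative_eqI: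
  "(f has_derivative f') (at x) \<Longrightarrow> frechet_derivative f (at x) v = f' v"
  using frechet_derivative_at by metis

lemma has_derivative_frechet:
  "f differentiable (at x) \<Longrightarrow> (f has_derivative frechet_derivative f (at x)) (at x)"
  using frechet_derivative_works by blast

lemma linear_expand_basis:
  assumes "linear L"
  shows "L v = (\<Sum>b\<in>Basis. (v \<bullet> b) *\<^sub>R L (b::'a::euclidean_space))"
proof -
  have "L v = L (\<Sum>b\<in>Basis. (v \<bullet> b) *\<^sub>R b)"
    by (simp add: euclidean_representation)
  also have "\<dots> = (\<Sum>b\<in>Basis. (v \<bullet> b) *\<^sub>R L b)"
    using assms by (simp add: linear_sum linear_scale)
  finally show ?thesis .
qed

lemma Ck_on_subset: "Ck_on k U f \<Longrightarrow> V \<subseteq> U \<Longrightarrow> Ck_on k V f"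
  by (induction k arbitrary: f) (auto intro: continuous_on_subset)

lemma Ck_on_cong:
  assumes "open U" "\<And>x. x \<in> U \<Longrightarrow> f x = h x" "Ck_on k U f"
  shows "Ck_on k U h"
  using assms(2,3)
proof (induction k arbitrary: f h)
  case 0
  then show ?case using continuous_on_cong[of U U f h] by simp
next
  case (Suc k)
  have "h differentiable (at x)" if "x \<in> U" for x
    using Suc.prems that assms(1) differentiable_cong_open[of f x U h] by simp
  moreover have "Ck_on k U (\<lambda>x. frechet_derivative h (at x) v)" for v
    using Suc.IH[of "\<lambda>x. frechet_derivative f (at x) v" "\<lambda>x. frechet_derivative h (at x) v"]
      Suc.prems frechet_derivative_cong_open[OF assms(1), of _ f h] by simp
  ultimately show ?case by simp
qed

lemma Ck_on_imp_continuous_on: "Ck_on k U f \<Longrightarrow> continuous_on U f"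
  by (cases k) (auto intro!: differentiable_imp_continuous_on
      simp: differentiable_on_def differentiable_at_withinI)

lemma Ck_on_Suc_imp: "Ck_on (Suc k) U f \<Longrightarrow> Ck_on k U f"
proof (induction k arbitrary: f)
  case 0
  then show ?case using Ck_on_imp_continuous_on[of "Suc 0" U f] by simp
next
  case (Suc k)
  then show ?case by (metis Ck_on.simps(2))
qed

lemma Ck_on_const: "Ck_on k U (\<lambda>x. c)"
  by (induction k arbitrary: c) simp_all

lemma Ck_on_bounded_linear:
  assumes "bounded_linear L" "open U" "Ck_on k U f"
  shows "Ck_on k U (\<lambda>x. L (f x))"
  using assms(3)
proof (induction k arbitrary: f)
  case 0
  then show ?case
    using assms(1) by (simp add: bounded_linear.continuous_on)
next
  case (Suc k)
  have d: "((\<lambda>x. L (f x)) has_derivative (\<lambda>v. L (frechet_derivative f (at x) v))) (at x)"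
    if "x \<in> U" for x
    by (intro bounded_linear.has_derivative[OF assms(1)] has_derivative_frechet)
      (use Suc.prems that in auto)
  have "Ck_on k U (\<lambda>x. frechet_derivative (\<lambda>x. L (f x)) (at x) v)" for v
    by (rule Ck_on_cong[OF assms(2) _ Suc.IH[of "\<lambda>x. frechet_derivative f (at x) v"]])
      (use Suc.prems frechet_derivative_eqI[OF d] in auto)
  then show ?case using d by (auto simp: differentiable_def)
qed

lemma Ck_on_add:
  assumes "open U" "Ck_on k U f" "Ck_on k U h"
  shows "Ck_on k U (\<lambda>x. f x + h x)"
  using assms(2,3)
proof (induction k arbitrary: f h)
  case 0
  then show ?case by (simp add: continuous_on_add)
next
  case (Suc k)
  have d: "((\<lambda>x. f x + h x) has_derivative
      (\<lambda>v. frechet_derivative f (at x) v + frechet_derivative h (at x) v)) (at x)"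
    if "x \<in> U" for x
    by (intro has_derivative_add has_derivative_frechet) (use Suc.prems that in auto)
  have "Ck_on k U (\<lambda>x. frechet_derivative (\<lambda>x. f x + h x) (at x) v)" for v
    by (rule Ck_on_cong[OF assms(1) _ Suc.IH[of "\<lambda>x. frechet_derivative f (at x) v"
            "\<lambda>x. frechet_derivative h (at x) v"]])
      (use Suc.prems frechet_derivative_eqI[OF d] in auto)
  then show ?case using d by (auto simp: differentiable_def)
qed

lemma Ck_on_sum:
  assumes "open U" "\<And>i. i \<in> I \<Longrightarrow> Ck_on k U (f i)"
  shows "Ck_on k U (\<lambda>x. \<Sum>i\<in>I. f i x)"
  using assms(2)
  by (induction I rule: infinite_finite_induct) (auto intro: Ck_on_add assms(1) Ck_on_const)

text \<open>The product rule expresses a derivative of \<open>B(f, h)\<close> by \<open>B\<close> applied to \<open>f\<close>, \<open>h\<close> and their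
  derivatives, so the induction on \<open>k\<close> must let \<open>f\<close> and \<open>h\<close> vary.\<close>

lemma Ck_on_bounded_bilinear:
  assumes "bounded_bilinear B" "open U" "Ck_on k U f" "Ck_on k U h"
  shows "Ck_on k U (\<lambda>x. B (f x) (h x))"
  using assms(3,4)
proof (induction k arbitrary: f h)
  case 0
  then show ?case using bounded_bilinear.continuous_on[OF assms(1)] by simp
next
  case (Suc k)
  have d: "((\<lambda>x. B (f x) (h x)) has_derivative
      (\<lambda>v. B (f x) (frechet_derivative h (at x) v) + B (frechet_derivative f (at x) v) (h x))) (at x)"
    if "x \<in> U" for x
    by (intro bounded_bilinear.FDERIV[OF assms(1)] has_derivative_frechet)
      (use Suc.prems that in auto)
  have "Ck_on k U (\<lambda>x. B (f x) (frechet_derivative h (at x) v) + B (frechet_derivative f (at x) v) (h x))"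
    for v
    by (intro Ck_on_add assms Suc.IH) (use Suc.prems Ck_on_Suc_imp in auto)
  then have "Ck_on k U (\<lambda>x. frechet_derivative (\<lambda>x. B (f x) (h x)) (at x) v)" for v
    by (rule Ck_on_cong[OF assms(2), rotated]) (use frechet_derivative_eqI[OF d] in auto)
  then show ?case using d by (auto simp: differentiable_def)
qed

text \<open>The derivative of \<open>1/f\<close> is a product of factors \<open>1/f\<close>, smooth to the lower order by
  induction, and the derivative of \<open>f\<close>.\<close>

lemma Ck_on_inverse:
  fixes f :: "'a::euclidean_space \<Rightarrow> real"
  assumes "open U" "Ck_on k U f" "\<And>x. x \<in> U \<Longrightarrow> f x \<noteq> 0"
  shows "Ck_on k U (\<lambda>x. inverse (f x))"
  using assms(2)
proof (induction k)
  case 0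
  then show ?case using assms(3) by (simp add: continuous_on_inverse)
next
  case (Suc k)
  have d: "((\<lambda>x. inverse (f x)) has_derivative
      (\<lambda>v. - (inverse (f x) * frechet_derivative f (at x) v * inverse (f x)))) (at x)"
    if "x \<in> U" for x
    by (intro Deriv.has_derivative_inverse has_derivative_frechet) (use assms(3) Suc.prems that in auto)
  have inv: "Ck_on k U (\<lambda>x. inverse (f x))"
    using Suc.IH Ck_on_Suc_imp[OF Suc.prems] .
  have "Ck_on k U (\<lambda>x. - (inverse (f x) * frechet_derivative f (at x) v * inverse (f x)))" for v
    by (intro Ck_on_bounded_linear[OF bounded_linear_minus[OF bounded_linear_ident]]
        Ck_on_bounded_bilinear[OF bounded_bilinear_mult] assms(1) inv) (use Suc.prems in auto)
  then have "Ck_on k U (\<lambda>x. frechet_derivative (\<lambda>x. inverse (f x)) (at x) v)" for v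
    by (rule Ck_on_cong[OF assms(1), rotated]) (use frechet_derivative_eqI[OF d] in auto)
  then show ?case using d by (auto simp: differentiable_def)
qed

text \<open>Since \<open>Ck_on\<close> only speaks about derivatives in constant directions, the chain rule is
  expanded in the standard basis: the direction \<open>Df(x)v\<close> varies with \<open>x\<close>.\<close>

lemma Ck_on_compose:
  fixes f :: "'a::euclidean_space \<Rightarrow> 'b::euclidean_space" and h :: "'b \<Rightarrow> 'c::real_normed_vector"
  assumes "open U" "f ` U \<subseteq> V" "Ck_on k U f" "Ck_on k V h"
  shows "Ck_on k U (\<lambda>x. h (f x))"
  using assms(3,4)
proof (induction k arbitrary: h)
  case 0
  then show ?case using continuous_on_compose2 assms(2) by auto
next
  case (Suc k)
  have d: "((\<lambda>x. h (f x)) has_derivative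
      (\<lambda>v. frechet_derivative h (at (f x)) (frechet_derivative f (at x) v))) (at x)"
    if "x \<in> U" for x
    by (intro has_derivative_compose[OF has_derivative_frechet has_derivative_frechet])
      (use Suc.prems that assms(2) in auto)
  have lin: "linear (frechet_derivative h (at (f x)))" if "x \<in> U" for x
    by (rule linear_frechet_derivative) (use Suc.prems that assms(2) in auto)
  have "Ck_on k U (\<lambda>x. \<Sum>b\<in>Basis. (frechet_derivative f (at x) v \<bullet> b) *\<^sub>R
      frechet_derivative h (at (f x)) b)" for v
    by (intro Ck_on_sum assms(1) Ck_on_bounded_bilinear[OF bounded_bilinear_scaleR]
        Ck_on_bounded_linear[OF bounded_linear_inner_left] Suc.IH)
      (use Suc.prems Ck_on_Suc_imp in auto)
  then have "Ck_on k U (\<lambda>x. frechet_derivative (\<lambda>x. h (f x)) (at x) v)" for v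
    by (rule Ck_on_cong[OF assms(1), rotated])
      (use frechet_derivative_eqI[OF d] linear_expand_basis[OF lin] in auto)
  then show ?case using d by (auto simp: differentiable_def)
qed

lemma smooth_on_subset: "smooth_on U f \<Longrightarrow> V \<subseteq> U \<Longrightarrow> smooth_on V f"
  by (auto simp: smooth_on_def intro: Ck_on_subset)

lemma smooth_on_cong:
  "smooth_on U f \<Longrightarrow> open U \<Longrightarrow> (\<And>x. x \<in> U \<Longrightarrow> f x = h x) \<Longrightarrow> smooth_on U h"
  by (auto simp: smooth_on_def intro: Ck_on_cong)

lemma smooth_on_const: "smooth_on U (\<lambda>x. c)"
  by (simp add: smooth_on_def Ck_on_const)

lemma smooth_on_bounded_linear:
  "bounded_linear L \<Longrightarrow> open U \<Longrightarrow> smooth_on U f \<Longrightarrow> smooth_on U (\<lambda>x. L (f x))"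
  by (simp add: smooth_on_def Ck_on_bounded_linear)

lemma smooth_on_add:
  "open U \<Longrightarrow> smooth_on U f \<Longrightarrow> smooth_on U h \<Longrightarrow> smooth_on U (\<lambda>x. f x + h x)"
  by (simp add: smooth_on_def Ck_on_add)

lemma smooth_on_uminus: "open U \<Longrightarrow> smooth_on U f \<Longrightarrow> smooth_on U (\<lambda>x. - f x)"
  by (rule smooth_on_bounded_linear[OF bounded_linear_minus[OF bounded_linear_ident]])

lemma smooth_on_diff:
  "open U \<Longrightarrow> smooth_on U f \<Longrightarrow> smooth_on U h \<Longrightarrow> smooth_on U (\<lambda>x. f x - h x)"
  using smooth_on_add[OF _ _ smooth_on_uminus] by fastforce

lemma smooth_on_sum:
  "open U \<Longrightarrow> (\<And>i. i \<in> I \<Longrightarrow> smooth_on U (f i)) \<Longrightarrow> smooth_on U (\<lambda>x. \<Sum>i\<in>I. f i x)"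
  by (simp add: smooth_on_def Ck_on_sum)

lemma smooth_on_scaleR:
  "open U \<Longrightarrow> smooth_on U f \<Longrightarrow> smooth_on U h \<Longrightarrow> smooth_on U (\<lambda>x. f x *\<^sub>R h x)"
  by (simp add: smooth_on_def Ck_on_bounded_bilinear[OF bounded_bilinear_scaleR])

lemma smooth_on_mult:
  "open U \<Longrightarrow> smooth_on U f \<Longrightarrow> smooth_on U h \<Longrightarrow> smooth_on U (\<lambda>x. f x * h x :: real)"
  by (simp add: smooth_on_def Ck_on_bounded_bilinear[OF bounded_bilinear_mult])

lemma smooth_on_inner_const: "open U \<Longrightarrow> smooth_on U f \<Longrightarrow> smooth_on U (\<lambda>x. f x \<bullet> b)"
  by (rule smooth_on_bounded_linear[OF bounded_linear_inner_left])

lemma smooth_on_divide: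
  fixes f h :: "'a::euclidean_space \<Rightarrow> real"
  shows "open U \<Longrightarrow> smooth_on U f \<Longrightarrow> smooth_on U h \<Longrightarrow> (\<And>x. x \<in> U \<Longrightarrow> h x \<noteq> 0) \<Longrightarrow>
    smooth_on U (\<lambda>x. f x / h x)"
  unfolding divide_inverse by (intro smooth_on_mult) (simp_all add: smooth_on_def Ck_on_inverse)

lemma smooth_on_compose:
  fixes f :: "'a::euclidean_space \<Rightarrow> 'b::euclidean_space"
  shows "open U \<Longrightarrow> f ` U \<subseteq> V \<Longrightarrow> smooth_on U f \<Longrightarrow> smooth_on V h \<Longrightarrow> smooth_on U (\<lambda>x. h (f x))"
  by (simp add: smooth_on_def Ck_on_compose)

lemma smooth_on_differentiable: "smooth_on U f \<Longrightarrow> x \<in> U \<Longrightarrow> f differentiable (at x)"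
  unfolding smooth_on_def by (metis Ck_on.simps(2))

lemma smooth_on_frechet_const: "smooth_on U f \<Longrightarrow> smooth_on U (\<lambda>x. frechet_derivative f (at x) v)"
  unfolding smooth_on_def by (metis Ck_on.simps(2))

lemma smooth_on_frechet:
  fixes f :: "'a::euclidean_space \<Rightarrow> 'b::real_normed_vector"
  assumes "open U" "smooth_on U f" "smooth_on U w"
  shows "smooth_on U (\<lambda>x. frechet_derivative f (at x) (w x))"
proof -
  have "smooth_on U (\<lambda>x. \<Sum>b\<in>Basis. (w x \<bullet> b) *\<^sub>R frechet_derivative f (at x) b)"
    by (intro smooth_on_sum smooth_on_scaleR smooth_on_inner_const smooth_on_frechet_const assms)
  then show ?thesis
    by (rule smooth_on_cong) (use assms in \<open>auto intro!: linear_expand_basis[symmetric]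
      linear_frechet_derivative smooth_on_differentiable\<close>)
qed

subsection \<open>Symmetry of second derivatives\<close>

lemma has_real_derivative_along_line:
  fixes f :: "'a::euclidean_space \<Rightarrow> real"
  assumes "f differentiable (at (y + s *\<^sub>R u))"
  shows "((\<lambda>s. f (y + s *\<^sub>R u)) has_real_derivative frechet_derivative f (at (y + s *\<^sub>R u)) u) (at s)"
proof -
  have "((\<lambda>s. y + s *\<^sub>R u) has_derivative (\<lambda>t. t *\<^sub>R u)) (at s)"
    by (auto intro!: derivative_eq_intros)
  from has_derivative_compose[OF this has_derivative_frechet[OF assms]]
  have "((\<lambda>s. f (y + s *\<^sub>R u)) has_derivative (\<lambda>t. frechet_derivative f (at (y + s *\<^sub>R u)) (t *\<^sub>R u))) (at s)" .
  moreover have "(\<lambda>t. frechet_derivative f (at (y + s *\<^sub>R u)) (t *\<^sub>R u)) =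
      (*) (frechet_derivative f (at (y + s *\<^sub>R u)) u)"
    using linear_scale[OF linear_frechet_derivative[OF assms]] by auto
  ultimately show ?thesis
    by (simp add: has_field_derivative_def)
qed

text \<open>The mean value theorem applied twice, first in the direction \<open>u\<close> and then in the direction
  \<open>v\<close>. The second difference on the left is symmetric in \<open>u\<close> and \<open>v\<close>; this is what forces the
  symmetry of second derivatives.\<close>

lemma second_difference_mean_value:
  fixes f :: "'a::euclidean_space \<Rightarrow> real"
  assumes h: "h > 0" and U: "\<And>s t. s \<in> {0..h} \<Longrightarrow> t \<in> {0..h} \<Longrightarrow> x + s *\<^sub>R u + t *\<^sub>R v \<in> U"
    and f: "Ck_on 2 U f"
  shows "\<exists>s\<in>{0..h}. \<exists>t\<in>{0..h}.
    f (x + h *\<^sub>R u + h *\<^sub>R v) - f (x + h *\<^sub>R u) - f (x + h *\<^sub>R v) + f x =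
    h * h * frechet_derivative (\<lambda>y. frechet_derivative f (at y) u) (at (x + s *\<^sub>R u + t *\<^sub>R v)) v"
proof -
  define f1 where "f1 y = frechet_derivative f (at y) u" for y
  have d0: "f differentiable (at y)" and d1: "f1 differentiable (at y)" if "y \<in> U" for y
    using f that by (auto simp: numeral_2_eq_2 f1_def[abs_def])
  define G where "G s = f ((x + h *\<^sub>R v) + s *\<^sub>R u) - f (x + s *\<^sub>R u)" for s
  have "(G has_real_derivative f1 ((x + h *\<^sub>R v) + s *\<^sub>R u) - f1 (x + s *\<^sub>R u)) (at s)"
    if "0 \<le> s" "s \<le> h" for s
    unfolding G_def f1_def
    using U[of s 0] U[of s h] h that
    by (intro DERIV_diff has_real_derivative_along_line d0) (auto simp: algebra_simps)
  from MVT2[OF h this] obtain s where s: "0 < s" "s < h"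
    "G h - G 0 = (h - 0) * (f1 ((x + h *\<^sub>R v) + s *\<^sub>R u) - f1 (x + s *\<^sub>R u))" by blast
  have "((\<lambda>t. f1 ((x + s *\<^sub>R u) + t *\<^sub>R v)) has_real_derivative
      frechet_derivative f1 (at ((x + s *\<^sub>R u) + t *\<^sub>R v)) v) (at t)"
    if "0 \<le> t" "t \<le> h" for t
    using U[of s t] s that by (intro has_real_derivative_along_line d1) auto
  from MVT2[OF h this] obtain t where t: "0 < t" "t < h"
    "f1 ((x + s *\<^sub>R u) + h *\<^sub>R v) - f1 ((x + s *\<^sub>R u) + 0 *\<^sub>R v) =
      (h - 0) * frechet_derivative f1 (at ((x + s *\<^sub>R u) + t *\<^sub>R v)) v" by blast
  have "f (x + h *\<^sub>R u + h *\<^sub>R v) - f (x + h *\<^sub>R u) - f (x + h *\<^sub>R v) + f x = G h - G 0"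
    by (simp add: G_def algebra_simps)
  also have "\<dots> = h * (f1 ((x + s *\<^sub>R u) + h *\<^sub>R v) - f1 ((x + s *\<^sub>R u) + 0 *\<^sub>R v))"
    using s by (simp add: algebra_simps)
  also have "\<dots> = h * h * frechet_derivative f1 (at (x + s *\<^sub>R u + t *\<^sub>R v)) v"
    unfolding t(3) by simp
  finally have "f (x + h *\<^sub>R u + h *\<^sub>R v) - f (x + h *\<^sub>R u) - f (x + h *\<^sub>R v) + f x =
      h * h * frechet_derivative f1 (at (x + s *\<^sub>R u + t *\<^sub>R v)) v" .
  then show ?thesis using s t unfolding f1_def by (intro bexI[of _ s] bexI[of _ t]) auto
qed

text \<open>Both mixed derivatives, taken at suitable points near \<open>x\<close>, equal the same second difference
  divided by \<open>h\<^sup>2\<close>; by continuity their values at \<open>x\<close> cannot differ.\<close>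

lemma frechet_derivative_symmetric_real:
  fixes f :: "'a::euclidean_space \<Rightarrow> real"
  assumes "open U" "x \<in> U" "Ck_on 2 U f"
  shows "frechet_derivative (\<lambda>y. frechet_derivative f (at y) u) (at x) v =
    frechet_derivative (\<lambda>y. frechet_derivative f (at y) v) (at x) u"
proof (rule ccontr)
  define P where "P y = frechet_derivative (\<lambda>y. frechet_derivative f (at y) u) (at y) v" for y
  define Q where "Q y = frechet_derivative (\<lambda>y. frechet_derivative f (at y) v) (at y) u" for y
  assume "\<not> ?thesis"
  then have e: "\<bar>P x - Q x\<bar> / 2 > 0" by (simp add: P_def Q_def)
  have "continuous_on U P" "continuous_on U Q"
    using assms(3) by (simp_all add: P_def[abs_def] Q_def[abs_def] numeral_2_eq_2)
  then have c: "isCont P x" "isCont Q x"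
    using assms continuous_on_eq_continuous_at by blast+
  obtain d1 where d1: "d1 > 0" "\<And>y. dist y x < d1 \<Longrightarrow> dist (P y) (P x) < \<bar>P x - Q x\<bar> / 2"
    using c(1) e unfolding continuous_at_eps_delta by blast
  obtain d2 where d2: "d2 > 0" "\<And>y. dist y x < d2 \<Longrightarrow> dist (Q y) (Q x) < \<bar>P x - Q x\<bar> / 2"
    using c(2) e unfolding continuous_at_eps_delta by blast
  obtain d3 where d3: "d3 > 0" "ball x d3 \<subseteq> U"
    using assms(1,2) open_contains_ball by blast
  define d where "d = min d1 (min d2 d3)"
  \<comment> \<open>the parallelogram spanned by \<open>h u\<close> and \<open>h v\<close> at \<open>x\<close> stays within distance \<open>d\<close>\<close>
  define h where "h = d / (2 * (norm u + norm v + 1))"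
  have dpos: "d > 0" using d1 d2 d3 by (simp add: d_def)
  have npos: "norm u + norm v + 1 > 0" by (smt (verit) norm_ge_zero)
  have h: "h > 0" using dpos npos by (simp add: h_def)
  have near: "dist (x + s *\<^sub>R u + t *\<^sub>R v) x < d" if "s \<in> {0..h}" "t \<in> {0..h}" for s t
  proof -
    have "norm (s *\<^sub>R u + t *\<^sub>R v) \<le> s * norm u + t * norm v"
      using that norm_triangle_ineq[of "s *\<^sub>R u" "t *\<^sub>R v"] by simp
    also have "\<dots> \<le> h * norm u + h * norm v"
      using that by (intro add_mono mult_right_mono) auto
    also have "\<dots> \<le> h * (norm u + norm v + 1)" using h by (simp add: algebra_simps)
    also have "\<dots> = d / 2" using npos by (simp add: h_def field_simps)
    also have "\<dots> < d" using dpos by simp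
    finally show ?thesis by (simp add: dist_norm algebra_simps)
  qed
  have inU: "x + s *\<^sub>R u + t *\<^sub>R v \<in> U" if "s \<in> {0..h}" "t \<in> {0..h}" for s t
    using near[OF that] d3 by (auto simp: d_def dist_commute)
  obtain s t where st: "s \<in> {0..h}" "t \<in> {0..h}"
    "f (x + h *\<^sub>R u + h *\<^sub>R v) - f (x + h *\<^sub>R u) - f (x + h *\<^sub>R v) + f x =
      h * h * P (x + s *\<^sub>R u + t *\<^sub>R v)"
    using second_difference_mean_value[OF h inU assms(3)] unfolding P_def by blast
  have inU': "x + s *\<^sub>R v + t *\<^sub>R u \<in> U" if "s \<in> {0..h}" "t \<in> {0..h}" for s t
    using inU[of t s] that by (simp add: algebra_simps)
  obtain s' t' where st': "s' \<in> {0..h}" "t' \<in> {0..h}"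
    "f (x + h *\<^sub>R v + h *\<^sub>R u) - f (x + h *\<^sub>R v) - f (x + h *\<^sub>R u) + f x =
      h * h * Q (x + s' *\<^sub>R v + t' *\<^sub>R u)"
    using second_difference_mean_value[OF h inU' assms(3)] unfolding Q_def by blast
  have comm: "x + s' *\<^sub>R v + t' *\<^sub>R u = x + t' *\<^sub>R u + s' *\<^sub>R v"
    "x + h *\<^sub>R v + h *\<^sub>R u = x + h *\<^sub>R u + h *\<^sub>R v"
    by (simp_all add: algebra_simps)
  have "h * h * P (x + s *\<^sub>R u + t *\<^sub>R v) = h * h * Q (x + t' *\<^sub>R u + s' *\<^sub>R v)"
    using st(3) st'(3) unfolding comm by linarith
  then have eq: "P (x + s *\<^sub>R u + t *\<^sub>R v) = Q (x + t' *\<^sub>R u + s' *\<^sub>R v)"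
    using h by simp
  have "\<bar>P (x + s *\<^sub>R u + t *\<^sub>R v) - P x\<bar> < \<bar>P x - Q x\<bar> / 2"
    using d1(2)[of "x + s *\<^sub>R u + t *\<^sub>R v"] near[OF st(1,2)] by (simp add: d_def dist_real_def)
  moreover have "\<bar>Q (x + t' *\<^sub>R u + s' *\<^sub>R v) - Q x\<bar> < \<bar>P x - Q x\<bar> / 2"
    using d2(2)[of "x + t' *\<^sub>R u + s' *\<^sub>R v"] near[OF st'(2,1)] by (simp add: d_def dist_real_def)
  moreover have "\<bar>P x - Q x\<bar> \<le> \<bar>c - P x\<bar> + \<bar>c - Q x\<bar>" for c
    by linarith
  ultimately show False
    unfolding eq by (smt (verit) field_sum_of_halves)
qed

lemma frechet_derivative_inner:
  assumes "f differentiable (at x)"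
  shows "frechet_derivative (\<lambda>x. f x \<bullet> b) (at x) v = frechet_derivative f (at x) v \<bullet> b"
  by (rule frechet_derivative_eqI)
    (rule bounded_linear.has_derivative[OF bounded_linear_inner_left has_derivative_frechet[OF assms]])

lemma frechet_derivative_symmetric:
  fixes f :: "'a::euclidean_space \<Rightarrow> 'b::euclidean_space"
  assumes "open U" "x \<in> U" "smooth_on U f"
  shows "frechet_derivative (\<lambda>y. frechet_derivative f (at y) u) (at x) v =
    frechet_derivative (\<lambda>y. frechet_derivative f (at y) v) (at x) u"
proof (rule euclidean_eqI)
  fix b :: 'b assume "b \<in> Basis"
  have s: "frechet_derivative (\<lambda>y. frechet_derivative f (at y) u) (at x) v \<bullet> b =
      frechet_derivative (\<lambda>y. frechet_derivative (\<lambda>z. f z \<bullet> b) (at y) u) (at x) v" for u v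
  proof -
    have "frechet_derivative (\<lambda>y. frechet_derivative f (at y) u) (at x) v \<bullet> b =
        frechet_derivative (\<lambda>y. frechet_derivative f (at y) u \<bullet> b) (at x) v"
      using frechet_derivative_inner smooth_on_differentiable smooth_on_frechet_const assms by metis
    also have "frechet_derivative (\<lambda>y. frechet_derivative f (at y) u \<bullet> b) (at x) =
        frechet_derivative (\<lambda>y. frechet_derivative (\<lambda>z. f z \<bullet> b) (at y) u) (at x)"
      by (rule frechet_derivative_cong_open[OF assms(1,2)])
        (use frechet_derivative_inner smooth_on_differentiable assms in metis)
    finally show ?thesis .
  qed
  have "Ck_on 2 U (\<lambda>z. f z \<bullet> b)"
    using smooth_on_inner_const[OF assms(1,3)] by (auto simp: smooth_on_def)
  from frechet_derivative_symmetric_real[OF assms(1,2) this]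
  show "frechet_derivative (\<lambda>y. frechet_derivative f (at y) u) (at x) v \<bullet> b =
      frechet_derivative (\<lambda>y. frechet_derivative f (at y) v) (at x) u \<bullet> b"
    unfolding s by blast
qed

section \<open>Vector fields and functions on open subsets\<close>

text \<open>Smoothness on an open set, so that the fields form a sheaf. Identities between the
  constructions below hold at a point as soon as the fields are smooth near it; hence one may
  insert the coordinate frame of a chart directly and never has to extend it to the whole
  manifold by cut-off functions.\<close>

definition funs_on :: "('m, 'e::euclidean_space) chart set \<Rightarrow> 'm set \<Rightarrow> ('m \<Rightarrow> real) set" where
  "funs_on A U = {f. \<forall>c\<in>A. smooth_on (chart_map c ` (U \<inter> chart_dom c)) (f \<circ> chart_inv c)}"

definition fields_on :: "('m, 'e::euclidean_space) chart set \<Rightarrow> 'm set \<Rightarrow> ('m \<Rightarrow> 'e) set" where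
  "fields_on A U = {X. \<forall>c\<in>A. smooth_on (chart_map c ` (U \<inter> chart_dom c)) (vf_rep A c X)}"

lemma funs_on_UNIV: "funs_on A UNIV = smooth_functions A"
  by (simp add: funs_on_def smooth_functions_def chart_im_def)

lemma fields_on_UNIV: "fields_on A UNIV = vector_fields A"
  by (simp add: fields_on_def vector_fields_def chart_im_def)

lemma fields_on_mono: "X \<in> fields_on A U \<Longrightarrow> V \<subseteq> U \<Longrightarrow> X \<in> fields_on A V"
  unfolding fields_on_def by (auto elim!: smooth_on_subset ballE)

text \<open>The differential of the change of coordinates from \<open>c\<close> to \<open>d\<close> at \<open>p\<close>. Both \<open>chart_diff\<close> and
  \<open>chart_frame\<close> are instances, with the preferred chart on one side; their rules become
  instances of the cocycle law \<open>transition_diff_compose\<close>.\<close>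

definition transition_diff ::
    "('m, 'e::euclidean_space) chart \<Rightarrow> ('m, 'e) chart \<Rightarrow> 'm \<Rightarrow> 'e \<Rightarrow> 'e" where
  "transition_diff c d p = frechet_derivative (chart_map d \<circ> chart_inv c) (at (chart_map c p))"

lemma chart_diff_transition: "chart_diff A c p = transition_diff (chart_at A p) c p"
  by (simp add: chart_diff_def transition_diff_def)

lemma chart_frame_transition: "chart_frame A c p = transition_diff c (chart_at A p) p"
  by (simp add: chart_frame_def transition_diff_def)

context smooth_manifold
begin

lemma chart_at_atlas: "chart_at A p \<in> A" and chart_at_dom: "p \<in> chart_dom (chart_at A p)"
proof -
  have "\<exists>c. c \<in> A \<and> p \<in> chart_dom c" using charts_cover by auto
  from someI_ex[OF this] show "chart_at A p \<in> A" "p \<in> chart_dom (chart_at A p)"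
    unfolding chart_at_def by auto
qed

lemma chart_inv_map: "c \<in> A \<Longrightarrow> p \<in> chart_dom c \<Longrightarrow> chart_inv c (chart_map c p) = p"
  using homeo by (auto simp: homeomorphism_def)

lemma open_chart_image:
  assumes "c \<in> A" "open U"
  shows "open (chart_map c ` (U \<inter> chart_dom c))"
proof -
  have "open (chart_im c \<inter> chart_inv c -` U)"
    using continuous_on_open_vimage[OF open_im[OF assms(1)], of "chart_inv c"] homeo[OF assms(1)] assms(2)
    by (auto simp: homeomorphism_def Int_commute)
  moreover have "chart_im c \<inter> chart_inv c -` U = chart_map c ` (U \<inter> chart_dom c)"
    using chart_inv_map[OF assms(1)] by (auto simp: chart_im_def)
  ultimately show ?thesis by simp
qed

lemma transition_smooth:
  assumes "c \<in> A" "d \<in> A"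
  shows "smooth_on (chart_map c ` (chart_dom d \<inter> chart_dom c)) (chart_map d \<circ> chart_inv c)"
  using compat[OF assms] by (simp add: Int_commute)

lemma transition_has_derivative:
  assumes "c \<in> A" "d \<in> A" "p \<in> chart_dom c" "p \<in> chart_dom d"
  shows "((chart_map d \<circ> chart_inv c) has_derivative transition_diff c d p) (at (chart_map c p))"
  unfolding transition_diff_def
  by (rule has_derivative_frechet, rule smooth_on_differentiable[OF transition_smooth])
    (use assms in auto)

lemma transition_diff_linear:
  assumes "c \<in> A" "d \<in> A" "p \<in> chart_dom c" "p \<in> chart_dom d"
  shows "linear (transition_diff c d p)"
  using transition_has_derivative[OF assms] has_derivative_linear by blast

lemma transition_diff_compose:
  assumes "c \<in> A" "d \<in> A" "e \<in> A" "p \<in> chart_dom c" "p \<in> chart_dom d" "p \<in> chart_dom e"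
  shows "transition_diff d e p (transition_diff c d p v) = transition_diff c e p v"
proof -
  have e: "((chart_map e \<circ> chart_inv d) has_derivative transition_diff d e p)
      (at ((chart_map d \<circ> chart_inv c) (chart_map c p)))"
    using transition_has_derivative[of d e p] assms chart_inv_map by simp
  have "((\<lambda>x. (chart_map e \<circ> chart_inv d) ((chart_map d \<circ> chart_inv c) x)) has_derivative
      (\<lambda>v. transition_diff d e p (transition_diff c d p v))) (at (chart_map c p))"
    by (rule has_derivative_compose[OF transition_has_derivative e]) (use assms in auto)
  then have "((chart_map e \<circ> chart_inv c) has_derivative
      (\<lambda>v. transition_diff d e p (transition_diff c d p v))) (at (chart_map c p))"
    by (rule has_derivative_transform_within_open[OF _
          open_chart_image[OF assms(1) open_dom[OF assms(2)]]])
      (use assms chart_inv_map in auto)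
  from frechet_derivative_eqI[OF this] show ?thesis
    by (simp add: transition_diff_def)
qed

lemma transition_diff_self:
  assumes "c \<in> A" "p \<in> chart_dom c"
  shows "transition_diff c c p v = v"
proof -
  have "((\<lambda>x. x) has_derivative (\<lambda>v. v)) (at (chart_map c p))" by simp
  then have "((chart_map c \<circ> chart_inv c) has_derivative (\<lambda>v. v)) (at (chart_map c p))"
    by (rule has_derivative_transform_within_open[OF _ open_im[OF assms(1)]])
      (use assms chart_inv_map in \<open>auto simp: chart_im_def\<close>)
  from frechet_derivative_eqI[OF this] show ?thesis
    by (simp add: transition_diff_def)
qed

lemma chart_diff_linear: "c \<in> A \<Longrightarrow> p \<in> chart_dom c \<Longrightarrow> linear (chart_diff A c p)"
  by (simp add: chart_diff_transition transition_diff_linear chart_at_atlas chart_at_dom)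

lemma chart_frame_linear: "c \<in> A \<Longrightarrow> p \<in> chart_dom c \<Longrightarrow> linear (chart_frame A c p)"
  by (simp add: chart_frame_transition transition_diff_linear chart_at_atlas chart_at_dom)

lemma chart_diff_frame: "c \<in> A \<Longrightarrow> p \<in> chart_dom c \<Longrightarrow> chart_diff A c p (chart_frame A c p v) = v"
  by (simp add: chart_diff_transition chart_frame_transition transition_diff_compose
      transition_diff_self chart_at_atlas chart_at_dom)

lemma chart_frame_diff: "c \<in> A \<Longrightarrow> p \<in> chart_dom c \<Longrightarrow> chart_frame A c p (chart_diff A c p v) = v"
  by (simp add: chart_diff_transition chart_frame_transition transition_diff_compose
      transition_diff_self chart_at_atlas chart_at_dom)

lemma chart_diff_at: "chart_diff A (chart_at A p) p v = v"
  by (simp add: chart_diff_transition transition_diff_self chart_at_atlas chart_at_dom)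

lemma chart_diff_change:
  "c \<in> A \<Longrightarrow> d \<in> A \<Longrightarrow> p \<in> chart_dom c \<Longrightarrow> p \<in> chart_dom d \<Longrightarrow>
    chart_diff A d p v = transition_diff c d p (chart_diff A c p v)"
  by (simp add: chart_diff_transition transition_diff_compose chart_at_atlas chart_at_dom)

lemma vf_rep_map:
  "c \<in> A \<Longrightarrow> p \<in> chart_dom c \<Longrightarrow> vf_rep A c X (chart_map c p) = chart_diff A c p (X p)"
  by (simp add: vf_rep_def chart_inv_map)

lemma fun_differentiable:
  assumes "open U" "p \<in> U" "f \<in> funs_on A U" "c \<in> A" "p \<in> chart_dom c"
  shows "(f \<circ> chart_inv c) differentiable (at (chart_map c p))"
  by (rule smooth_on_differentiable[of "chart_map c ` (U \<inter> chart_dom c)"])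
    (use assms in \<open>auto simp: funs_on_def\<close>)

lemma field_differentiable:
  assumes "open U" "p \<in> U" "X \<in> fields_on A U" "c \<in> A" "p \<in> chart_dom c"
  shows "vf_rep A c X differentiable (at (chart_map c p))"
  by (rule smooth_on_differentiable[of "chart_map c ` (U \<inter> chart_dom c)"])
    (use assms in \<open>auto simp: fields_on_def\<close>)

lemma funs_on_chartsI:
  assumes "open U" "\<And>c. c \<in> A \<Longrightarrow> smooth_on (chart_map c ` (U \<inter> chart_dom c)) (h c)"
    and "\<And>c p. c \<in> A \<Longrightarrow> p \<in> U \<Longrightarrow> p \<in> chart_dom c \<Longrightarrow> h c (chart_map c p) = f p"
  shows "f \<in> funs_on A U"
  unfolding funs_on_def
proof safe
  fix c assume c: "c \<in> A"
  show "smooth_on (chart_map c ` (U \<inter> chart_dom c)) (f \<circ> chart_inv c)"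
    by (rule smooth_on_cong[OF assms(2)[OF c] open_chart_image[OF c assms(1)]])
      (use c assms(3) chart_inv_map in auto)
qed

lemma fields_on_chartsI:
  assumes "open U" "\<And>c. c \<in> A \<Longrightarrow> smooth_on (chart_map c ` (U \<inter> chart_dom c)) (h c)"
    and "\<And>c p. c \<in> A \<Longrightarrow> p \<in> U \<Longrightarrow> p \<in> chart_dom c \<Longrightarrow> h c (chart_map c p) = chart_diff A c p (X p)"
  shows "X \<in> fields_on A U"
  unfolding fields_on_def
proof safe
  fix c assume c: "c \<in> A"
  show "smooth_on (chart_map c ` (U \<inter> chart_dom c)) (vf_rep A c X)"
    by (rule smooth_on_cong[OF assms(2)[OF c] open_chart_image[OF c assms(1)]])
      (use c assms(3) vf_rep_map in auto)
qed

lemma field_cong: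
  assumes "open U" "X \<in> fields_on A U" "\<And>p. p \<in> U \<Longrightarrow> X p = Y p"
  shows "Y \<in> fields_on A U"
  by (rule fields_on_chartsI[OF assms(1), of "\<lambda>c. vf_rep A c X"])
    (use assms vf_rep_map in \<open>auto simp: fields_on_def\<close>)

text \<open>Smoothness in the chart \<open>c\<close> only involves the points of \<open>chart_dom c\<close>; this glues a field
  from its restrictions to the chart domains.\<close>

lemma field_from_charts:
  assumes "\<And>c. c \<in> A \<Longrightarrow> X \<in> fields_on A (chart_dom c)"
  shows "X \<in> vector_fields A"
  using assms by (fastforce simp: vector_fields_def fields_on_def chart_im_def)

lemma fun_add: "open U \<Longrightarrow> f \<in> funs_on A U \<Longrightarrow> h \<in> funs_on A U \<Longrightarrow> (\<lambda>q. f q + h q) \<in> funs_on A U"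
  unfolding funs_on_def o_def by (auto intro!: smooth_on_add open_chart_image)

lemma fun_diff: "open U \<Longrightarrow> f \<in> funs_on A U \<Longrightarrow> h \<in> funs_on A U \<Longrightarrow> (\<lambda>q. f q - h q) \<in> funs_on A U"
  unfolding funs_on_def o_def by (auto intro!: smooth_on_diff open_chart_image)

lemma fun_mult: "open U \<Longrightarrow> f \<in> funs_on A U \<Longrightarrow> h \<in> funs_on A U \<Longrightarrow> (\<lambda>q. f q * h q) \<in> funs_on A U"
  unfolding funs_on_def o_def by (auto intro!: smooth_on_mult open_chart_image)

lemma fun_const: "(\<lambda>q. r) \<in> funs_on A U"
  by (simp add: funs_on_def o_def smooth_on_const)

lemma fun_divide:
  assumes "open U" "f \<in> funs_on A U" "h \<in> funs_on A U" "\<And>q. q \<in> U \<Longrightarrow> h q \<noteq> 0"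
  shows "(\<lambda>q. f q / h q) \<in> funs_on A U"
proof (rule funs_on_chartsI[OF assms(1)])
  fix c assume c: "c \<in> A"
  show "smooth_on (chart_map c ` (U \<inter> chart_dom c)) (\<lambda>x. (f \<circ> chart_inv c) x / (h \<circ> chart_inv c) x)"
    by (intro smooth_on_divide open_chart_image c assms(1))
      (use assms c chart_inv_map in \<open>auto simp: funs_on_def o_def\<close>)
qed (use chart_inv_map in auto)

lemma field_add:
  assumes "open U" "X \<in> fields_on A U" "Y \<in> fields_on A U"
  shows "(\<lambda>q. X q + Y q) \<in> fields_on A U"
proof (rule fields_on_chartsI[OF assms(1)])
  fix c assume c: "c \<in> A"
  show "smooth_on (chart_map c ` (U \<inter> chart_dom c)) (\<lambda>x. vf_rep A c X x + vf_rep A c Y x)"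
    using assms c by (intro smooth_on_add open_chart_image) (auto simp: fields_on_def)
qed (simp add: vf_rep_map linear_add[OF chart_diff_linear])

lemma field_scale:
  assumes "open U" "f \<in> funs_on A U" "X \<in> fields_on A U"
  shows "(\<lambda>q. f q *\<^sub>R X q) \<in> fields_on A U"
proof (rule fields_on_chartsI[OF assms(1)])
  fix c assume c: "c \<in> A"
  show "smooth_on (chart_map c ` (U \<inter> chart_dom c)) (\<lambda>x. (f \<circ> chart_inv c) x *\<^sub>R vf_rep A c X x)"
    using assms c by (intro smooth_on_scaleR open_chart_image) (auto simp: fields_on_def funs_on_def o_def)
qed (simp add: vf_rep_map linear_scale[OF chart_diff_linear] chart_inv_map)

lemma field_zero: "(\<lambda>q. 0) \<in> fields_on A U"
proof -
  have "(\<lambda>q. 0) \<in> fields_on A UNIV"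
    by (rule fields_on_chartsI[of _ "\<lambda>c x. 0"])
      (simp_all add: smooth_on_const linear_0[OF chart_diff_linear])
  then show ?thesis by (rule fields_on_mono) simp
qed

lemma field_diff:
  assumes "open U" "X \<in> fields_on A U" "Y \<in> fields_on A U"
  shows "(\<lambda>q. X q - Y q) \<in> fields_on A U"
  using field_add[OF assms(1,2) field_scale[OF assms(1) fun_const[of "-1"] assms(3)]] by simp

lemma field_sum:
  "open U \<Longrightarrow> (\<And>i. i \<in> I \<Longrightarrow> X i \<in> fields_on A U) \<Longrightarrow> (\<lambda>q. \<Sum>i\<in>I. X i q) \<in> fields_on A U"
  by (induction I rule: infinite_finite_induct) (auto intro: field_add field_zero)

text \<open>In another chart \<open>d\<close> the coordinate field of \<open>c\<close> is a directional derivative of the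
  transition map, composed with the inverse transition.\<close>

lemma field_frame:
  assumes c: "c \<in> A"
  shows "(\<lambda>q. chart_frame A c q v) \<in> fields_on A (chart_dom c)"
  unfolding fields_on_def
proof safe
  fix d assume d: "d \<in> A"
  let ?S = "chart_map d ` (chart_dom c \<inter> chart_dom d)"
  let ?\<sigma> = "chart_map d \<circ> chart_inv c" and ?\<tau> = "chart_map c \<circ> chart_inv d"
  have "smooth_on ?S (\<lambda>x. frechet_derivative ?\<sigma> (at (?\<tau> x)) v)"
  proof (rule smooth_on_compose[where V = "chart_map c ` (chart_dom d \<inter> chart_dom c)"
        and f = ?\<tau> and h = "\<lambda>x. frechet_derivative ?\<sigma> (at x) v"])
    show "open ?S" by (rule open_chart_image[OF d open_dom[OF c]])
    show "?\<tau> ` ?S \<subseteq> chart_map c ` (chart_dom d \<inter> chart_dom c)"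
      using chart_inv_map[OF d] by auto
    show "smooth_on ?S ?\<tau>" by (rule transition_smooth[OF d c])
    show "smooth_on (chart_map c ` (chart_dom d \<inter> chart_dom c)) (\<lambda>x. frechet_derivative ?\<sigma> (at x) v)"
      by (rule smooth_on_frechet_const[OF transition_smooth[OF c d]])
  qed
  then show "smooth_on ?S (vf_rep A d (\<lambda>q. chart_frame A c q v))"
  proof (rule smooth_on_cong[OF _ open_chart_image[OF d open_dom[OF c]]])
    fix x assume "x \<in> ?S"
    then obtain p where p: "p \<in> chart_dom c" "p \<in> chart_dom d" "x = chart_map d p" by auto
    have "vf_rep A d (\<lambda>q. chart_frame A c q v) x = transition_diff c d p v"
      using p c d by (simp add: vf_rep_map chart_diff_transition chart_frame_transition
          transition_diff_compose chart_at_atlas chart_at_dom)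
    then show "frechet_derivative ?\<sigma> (at (?\<tau> x)) v = vf_rep A d (\<lambda>q. chart_frame A c q v) x"
      using p d by (simp add: transition_diff_def chart_inv_map)
  qed
qed

subsection \<open>Derivatives and brackets in an arbitrary chart\<close>

text \<open>\<open>vf_deriv\<close> is evaluated in the preferred chart of each point, which may jump. Only a formula
  in one fixed chart shows that the result depends smoothly on the point.\<close>

lemma vf_deriv_chart:
  assumes "open U" "p \<in> U" "f \<in> funs_on A U" "c \<in> A" "p \<in> chart_dom c"
  shows "vf_deriv A X f p =
    frechet_derivative (f \<circ> chart_inv c) (at (chart_map c p)) (chart_diff A c p (X p))"
proof -
  let ?d = "chart_at A p"
  have d: "?d \<in> A" "p \<in> chart_dom ?d" by (rule chart_at_atlas chart_at_dom)+
  have 1: "((f \<circ> chart_inv c) has_derivative frechet_derivative (f \<circ> chart_inv c) (at (chart_map c p)))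
      (at ((chart_map c \<circ> chart_inv ?d) (chart_map ?d p)))"
    using has_derivative_frechet[OF fun_differentiable[OF assms]] d by (simp add: chart_inv_map)
  have "((\<lambda>x. (f \<circ> chart_inv c) ((chart_map c \<circ> chart_inv ?d) x)) has_derivative
      (\<lambda>v. frechet_derivative (f \<circ> chart_inv c) (at (chart_map c p)) (transition_diff ?d c p v)))
      (at (chart_map ?d p))"
    by (rule has_derivative_compose[OF transition_has_derivative 1]) (use assms d in auto)
  then have "((f \<circ> chart_inv ?d) has_derivative
      (\<lambda>v. frechet_derivative (f \<circ> chart_inv c) (at (chart_map c p)) (transition_diff ?d c p v)))
      (at (chart_map ?d p))"
    by (rule has_derivative_transform_within_open[OF _
          open_chart_image[OF d(1) open_dom[OF assms(4)]]])
      (use assms d chart_inv_map in auto)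
  from frechet_derivative_eqI[OF this] show ?thesis
    by (simp add: vf_deriv_def Let_def chart_diff_transition)
qed

text \<open>Under a change of charts \<open>\<sigma>\<close> the components of a vector field obey
  \<open>Y(\<sigma> x) = D\<sigma>(x)(y(x))\<close>. The product rule gives, besides the expected term, a second
  derivative of \<open>\<sigma>\<close>.\<close>

lemma frechet_derivative_pushforward:
  fixes \<sigma> :: "'e::euclidean_space \<Rightarrow> 'e"
  assumes "open V" "x \<in> V" "smooth_on V \<sigma>" "y differentiable (at x)" "Y differentiable (at (\<sigma> x))"
    and eq: "\<And>z. z \<in> V \<Longrightarrow> Y (\<sigma> z) = frechet_derivative \<sigma> (at z) (y z)"
  shows "frechet_derivative Y (at (\<sigma> x)) (frechet_derivative \<sigma> (at x) u) =
    frechet_derivative (\<lambda>z. frechet_derivative \<sigma> (at z) (y x)) (at x) u +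
    frechet_derivative \<sigma> (at x) (frechet_derivative y (at x) u)"
proof -
  have lin: "linear (frechet_derivative \<sigma> (at z))" if "z \<in> V" for z
    using smooth_on_differentiable[OF assms(3) that] linear_frechet_derivative by blast
  have L: "((\<lambda>z. Y (\<sigma> z)) has_derivative
      (\<lambda>u. frechet_derivative Y (at (\<sigma> x)) (frechet_derivative \<sigma> (at x) u))) (at x)"
    by (rule has_derivative_compose[OF has_derivative_frechet has_derivative_frechet])
      (use assms smooth_on_differentiable in auto)
  have D: "((\<lambda>z. frechet_derivative \<sigma> (at z) w) has_derivative
      frechet_derivative (\<lambda>z. frechet_derivative \<sigma> (at z) w) (at x)) (at x)" for w
    by (rule has_derivative_frechet[OF smooth_on_differentiable[OF smooth_on_frechet_const[OF assms(3)] assms(2)]])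
  have "((\<lambda>z. \<Sum>b\<in>Basis. (y z \<bullet> b) *\<^sub>R frechet_derivative \<sigma> (at z) b) has_derivative
      (\<lambda>u. \<Sum>b\<in>Basis. (y x \<bullet> b) *\<^sub>R frechet_derivative (\<lambda>z. frechet_derivative \<sigma> (at z) b) (at x) u
         + (frechet_derivative y (at x) u \<bullet> b) *\<^sub>R frechet_derivative \<sigma> (at x) b)) (at x)"
    by (intro has_derivative_sum has_derivative_scaleR D
        bounded_linear.has_derivative[OF bounded_linear_inner_left] has_derivative_frechet assms(4))
  then have "((\<lambda>z. Y (\<sigma> z)) has_derivative
      (\<lambda>u. \<Sum>b\<in>Basis. (y x \<bullet> b) *\<^sub>R frechet_derivative (\<lambda>z. frechet_derivative \<sigma> (at z) b) (at x) u
         + (frechet_derivative y (at x) u \<bullet> b) *\<^sub>R frechet_derivative \<sigma> (at x) b)) (at x)"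
    by (rule has_derivative_transform_within_open[OF _ assms(1,2)])
      (use eq linear_expand_basis[OF lin] in auto)
  from has_derivative_unique[OF L this]
  have "frechet_derivative Y (at (\<sigma> x)) (frechet_derivative \<sigma> (at x) u) =
      (\<Sum>b\<in>Basis. (y x \<bullet> b) *\<^sub>R frechet_derivative (\<lambda>z. frechet_derivative \<sigma> (at z) b) (at x) u)
      + (\<Sum>b\<in>Basis. (frechet_derivative y (at x) u \<bullet> b) *\<^sub>R frechet_derivative \<sigma> (at x) b)"
    by (simp add: fun_eq_iff sum.distrib)
  also have "(\<Sum>b\<in>Basis. (frechet_derivative y (at x) u \<bullet> b) *\<^sub>R frechet_derivative \<sigma> (at x) b) =
      frechet_derivative \<sigma> (at x) (frechet_derivative y (at x) u)"
    using linear_expand_basis[OF lin[OF assms(2)]] by metis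
  also have "(\<Sum>b\<in>Basis. (y x \<bullet> b) *\<^sub>R frechet_derivative (\<lambda>z. frechet_derivative \<sigma> (at z) b) (at x) u) =
      frechet_derivative (\<lambda>z. frechet_derivative \<sigma> (at z) (y x)) (at x) u"
  proof -
    have "((\<lambda>z. \<Sum>b\<in>Basis. (y x \<bullet> b) *\<^sub>R frechet_derivative \<sigma> (at z) b) has_derivative
      (\<lambda>u. \<Sum>b\<in>Basis. (y x \<bullet> b) *\<^sub>R frechet_derivative (\<lambda>z. frechet_derivative \<sigma> (at z) b) (at x) u)) (at x)"
      by (intro has_derivative_sum bounded_linear.has_derivative[OF bounded_linear_scaleR_right] D)
    then have "((\<lambda>z. frechet_derivative \<sigma> (at z) (y x)) has_derivative
      (\<lambda>u. \<Sum>b\<in>Basis. (y x \<bullet> b) *\<^sub>R frechet_derivative (\<lambda>z. frechet_derivative \<sigma> (at z) b) (at x) u)) (at x)"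
      by (rule has_derivative_transform_within_open[OF _ assms(1,2)])
        (use linear_expand_basis[OF lin] in metis)
    from frechet_derivative_eqI[OF this] show ?thesis by simp
  qed
  finally show ?thesis .
qed

text \<open>The coordinate formula for the bracket is the same in every chart, because the second
  derivatives of the transition map that appear for \<open>X\<close> and for \<open>Y\<close> cancel by symmetry.\<close>

lemma lie_bracket_chart:
  assumes U: "open U" "p \<in> U" and X: "X \<in> fields_on A U" and Y: "Y \<in> fields_on A U"
    and c: "c \<in> A" "p \<in> chart_dom c"
  shows "chart_diff A c p (lie_bracket A X Y p) =
    frechet_derivative (vf_rep A c Y) (at (chart_map c p)) (chart_diff A c p (X p)) -
    frechet_derivative (vf_rep A c X) (at (chart_map c p)) (chart_diff A c p (Y p))"
proof -
  let ?d = "chart_at A p" and ?x = "chart_map c p"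
  let ?\<sigma> = "chart_map ?d \<circ> chart_inv c"
  let ?V = "chart_map c ` (chart_dom ?d \<inter> chart_dom c)"
  let ?T = "frechet_derivative ?\<sigma> (at ?x)"
  have d: "?d \<in> A" "p \<in> chart_dom ?d" by (rule chart_at_atlas chart_at_dom)+
  have oV: "open ?V" by (rule open_chart_image[OF c(1) open_dom[OF d(1)]])
  have xV: "?x \<in> ?V" using c d by auto
  have s: "smooth_on ?V ?\<sigma>" by (rule transition_smooth[OF c(1) d(1)])
  have sx: "?\<sigma> ?x = chart_map ?d p" using c by (simp add: chart_inv_map)
  have tr: "vf_rep A ?d Z (?\<sigma> z) = frechet_derivative ?\<sigma> (at z) (vf_rep A c Z z)" if "z \<in> ?V" for Z z
    using that c d chart_diff_change[OF c(1) d(1)]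
    by (auto simp: vf_rep_map chart_inv_map transition_diff_def)
  have ZT: "Z p = ?T (chart_diff A c p (Z p))" for Z
    using tr[OF xV, of Z] c d by (simp only: sx vf_rep_map chart_diff_at)
  have push: "frechet_derivative (vf_rep A ?d Z) (at (chart_map ?d p)) (?T u) =
      frechet_derivative (\<lambda>z. frechet_derivative ?\<sigma> (at z) (chart_diff A c p (Z p))) (at ?x) u +
      ?T (frechet_derivative (vf_rep A c Z) (at ?x) u)" if "Z \<in> fields_on A U" for Z u
    using frechet_derivative_pushforward[OF oV xV s field_differentiable[OF U that c] _ tr]
      field_differentiable[OF U that d] sx vf_rep_map[OF c] by metis
  have lin: "linear ?T"
    using smooth_on_differentiable[OF s xV] linear_frechet_derivative by blast
  have "lie_bracket A X Y p =
      frechet_derivative (vf_rep A ?d Y) (at (chart_map ?d p)) (?T (chart_diff A c p (X p))) -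
      frechet_derivative (vf_rep A ?d X) (at (chart_map ?d p)) (?T (chart_diff A c p (Y p)))"
    using ZT[of X] ZT[of Y] by (simp add: lie_bracket_def Let_def)
  also have "\<dots> = ?T (frechet_derivative (vf_rep A c Y) (at ?x) (chart_diff A c p (X p)) -
      frechet_derivative (vf_rep A c X) (at ?x) (chart_diff A c p (Y p)))"
    unfolding push[OF X] push[OF Y] linear_diff[OF lin]
    using frechet_derivative_symmetric[OF oV xV s] by simp
  also have "chart_diff A c p \<dots> = frechet_derivative (vf_rep A c Y) (at ?x) (chart_diff A c p (X p)) -
      frechet_derivative (vf_rep A c X) (at ?x) (chart_diff A c p (Y p))"
    using chart_diff_frame[OF c] by (simp add: chart_frame_def)
  finally show ?thesis .
qed

lemma vf_deriv_fun:
  assumes "open U" "X \<in> fields_on A U" "f \<in> funs_on A U"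
  shows "vf_deriv A X f \<in> funs_on A U"
proof (rule funs_on_chartsI[OF assms(1)])
  fix c assume c: "c \<in> A"
  show "smooth_on (chart_map c ` (U \<inter> chart_dom c))
      (\<lambda>x. frechet_derivative (f \<circ> chart_inv c) (at x) (vf_rep A c X x))"
    by (intro smooth_on_frechet open_chart_image c assms(1))
      (use assms c in \<open>auto simp: funs_on_def fields_on_def\<close>)
qed (use assms vf_deriv_chart vf_rep_map in auto)

lemma lie_bracket_field:
  assumes "open U" "X \<in> fields_on A U" "Y \<in> fields_on A U"
  shows "lie_bracket A X Y \<in> fields_on A U"
proof (rule fields_on_chartsI[OF assms(1)])
  fix c assume c: "c \<in> A"
  show "smooth_on (chart_map c ` (U \<inter> chart_dom c))
      (\<lambda>x. frechet_derivative (vf_rep A c Y) (at x) (vf_rep A c X x) -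
        frechet_derivative (vf_rep A c X) (at x) (vf_rep A c Y x))"
    by (intro smooth_on_diff smooth_on_frechet open_chart_image c assms(1))
      (use assms c in \<open>auto simp: fields_on_def\<close>)
qed (use assms lie_bracket_chart vf_rep_map in auto)

subsection \<open>Calculation rules\<close>

lemma vf_deriv_at:
  "vf_deriv A X f p =
    frechet_derivative (f \<circ> chart_inv (chart_at A p)) (at (chart_map (chart_at A p) p)) (X p)"
  by (simp add: vf_deriv_def Let_def)

lemma vf_deriv_const: "vf_deriv A X (\<lambda>q. r) p = 0"
  by (simp add: vf_deriv_at o_def)

lemma vf_deriv_add:
  assumes "open U" "p \<in> U" "f \<in> funs_on A U" "h \<in> funs_on A U"
  shows "vf_deriv A X (\<lambda>q. f q + h q) p = vf_deriv A X f p + vf_deriv A X h p"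
  unfolding vf_deriv_at
  using frechet_derivative_eqI[OF has_derivative_add[OF
      has_derivative_frechet[OF fun_differentiable[OF assms(1,2,3) chart_at_atlas chart_at_dom]]
      has_derivative_frechet[OF fun_differentiable[OF assms(1,2,4) chart_at_atlas chart_at_dom]]]]
  by (simp add: o_def)

lemma vf_deriv_mult:
  assumes "open U" "p \<in> U" "f \<in> funs_on A U" "h \<in> funs_on A U"
  shows "vf_deriv A X (\<lambda>q. f q * h q) p = f p * vf_deriv A X h p + vf_deriv A X f p * h p"
  unfolding vf_deriv_at
  using frechet_derivative_eqI[OF has_derivative_mult[OF
      has_derivative_frechet[OF fun_differentiable[OF assms(1,2,3) chart_at_atlas chart_at_dom]]
      has_derivative_frechet[OF fun_differentiable[OF assms(1,2,4) chart_at_atlas chart_at_dom]]]]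
  by (simp add: o_def chart_inv_map chart_at_atlas chart_at_dom)

lemma vf_deriv_field_add:
  assumes "open U" "p \<in> U" "f \<in> funs_on A U"
  shows "vf_deriv A (\<lambda>q. X q + Y q) f p = vf_deriv A X f p + vf_deriv A Y f p"
  unfolding vf_deriv_at
  by (rule linear_add[OF linear_frechet_derivative[OF
        fun_differentiable[OF assms chart_at_atlas chart_at_dom]]])

lemma vf_deriv_field_scale:
  assumes "open U" "p \<in> U" "f \<in> funs_on A U"
  shows "vf_deriv A (\<lambda>q. h q *\<^sub>R X q) f p = h p * vf_deriv A X f p"
  unfolding vf_deriv_at
  by (simp add: linear_scale[OF linear_frechet_derivative[OF
        fun_differentiable[OF assms chart_at_atlas chart_at_dom]]])

lemma lie_bracket_skew: "lie_bracket A X Y p = - lie_bracket A Y X p"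
  by (simp add: lie_bracket_def Let_def)

lemma lie_bracket_add_right:
  assumes U: "open U" "p \<in> U" and F: "X \<in> fields_on A U" "Y \<in> fields_on A U" "Z \<in> fields_on A U"
  shows "lie_bracket A X (\<lambda>q. Y q + Z q) p = lie_bracket A X Y p + lie_bracket A X Z p"
proof -
  let ?d = "chart_at A p"
  have d: "?d \<in> A" "p \<in> chart_dom ?d" by (rule chart_at_atlas chart_at_dom)+
  note diff = has_derivative_frechet[OF field_differentiable[OF U _ d]]
  have e1: "frechet_derivative (vf_rep A ?d (\<lambda>q. Y q + Z q)) (at (chart_map ?d p)) =
      frechet_derivative (\<lambda>x. vf_rep A ?d Y x + vf_rep A ?d Z x) (at (chart_map ?d p))"
    by (rule frechet_derivative_cong_open[OF open_im[OF d(1)]])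
      (use d in \<open>auto simp: chart_im_def vf_rep_map linear_add[OF chart_diff_linear]\<close>)
  have e2: "frechet_derivative (\<lambda>x. vf_rep A ?d Y x + vf_rep A ?d Z x) (at (chart_map ?d p)) v =
      frechet_derivative (vf_rep A ?d Y) (at (chart_map ?d p)) v +
      frechet_derivative (vf_rep A ?d Z) (at (chart_map ?d p)) v" for v
    by (rule frechet_derivative_eqI[OF has_derivative_add[OF diff[OF F(2)] diff[OF F(3)]]])
  show ?thesis
    unfolding lie_bracket_def Let_def e1 e2
    using linear_add[OF linear_frechet_derivative[OF field_differentiable[OF U F(1) d]]]
    by simp
qed

lemma lie_bracket_scale_right:
  assumes U: "open U" "p \<in> U" and F: "X \<in> fields_on A U" "Y \<in> fields_on A U"
    and f: "f \<in> funs_on A U"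
  shows "lie_bracket A X (\<lambda>q. f q *\<^sub>R Y q) p = f p *\<^sub>R lie_bracket A X Y p + vf_deriv A X f p *\<^sub>R Y p"
proof -
  let ?d = "chart_at A p"
  have d: "?d \<in> A" "p \<in> chart_dom ?d" by (rule chart_at_atlas chart_at_dom)+
  have e1: "frechet_derivative (vf_rep A ?d (\<lambda>q. f q *\<^sub>R Y q)) (at (chart_map ?d p)) =
      frechet_derivative (\<lambda>x. (f \<circ> chart_inv ?d) x *\<^sub>R vf_rep A ?d Y x) (at (chart_map ?d p))"
    by (rule frechet_derivative_cong_open[OF open_im[OF d(1)]])
      (use d in \<open>auto simp: chart_im_def vf_rep_map linear_scale[OF chart_diff_linear] chart_inv_map\<close>)
  have e2: "frechet_derivative (\<lambda>x. (f \<circ> chart_inv ?d) x *\<^sub>R vf_rep A ?d Y x) (at (chart_map ?d p)) v =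
      f p *\<^sub>R frechet_derivative (vf_rep A ?d Y) (at (chart_map ?d p)) v +
      frechet_derivative (f \<circ> chart_inv ?d) (at (chart_map ?d p)) v *\<^sub>R Y p" for v
    using frechet_derivative_eqI[OF has_derivative_scaleR[OF
        has_derivative_frechet[OF fun_differentiable[OF U f d]]
        has_derivative_frechet[OF field_differentiable[OF U F(2) d]]], of v] d
    by (simp add: chart_inv_map vf_rep_map chart_diff_at)
  show ?thesis
    unfolding lie_bracket_def Let_def e1 e2
    using linear_scale[OF linear_frechet_derivative[OF field_differentiable[OF U F(1) d]]]
    by (simp add: vf_deriv_at algebra_simps)
qed

subsection \<open>Smooth tensor fields\<close>

lemma vf_expand_frame:
  assumes "c \<in> A" "p \<in> chart_dom c"
  shows "X p = (\<Sum>b\<in>Basis. (vf_rep A c X (chart_map c p) \<bullet> b) *\<^sub>R chart_frame A c p b)"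
  using linear_expand_basis[OF chart_frame_linear[OF assms], of "chart_diff A c p (X p)"]
  by (simp add: vf_rep_map assms chart_frame_diff)

text \<open>Smoothness of a tensor field is given on coordinate frames; expanding the arguments in the
  frame of a chart extends it to arbitrary smooth fields. The same holds for the next two
  lemmas.\<close>

lemma one_form_fun:
  assumes U: "open U" and e: "e \<in> one_forms A" and X: "X \<in> fields_on A U"
  shows "(\<lambda>q. e q (X q)) \<in> funs_on A U"
proof (rule funs_on_chartsI[OF U])
  fix c assume c: "c \<in> A"
  have "smooth_on (chart_im c) ((\<lambda>p. e p (chart_frame A c p b)) \<circ> chart_inv c)" for b
    using e c by (simp add: one_forms_def)
  then have "smooth_on (chart_map c ` (U \<inter> chart_dom c)) ((\<lambda>p. e p (chart_frame A c p b)) \<circ> chart_inv c)" for b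
    by (rule smooth_on_subset) (auto simp: chart_im_def)
  then show "smooth_on (chart_map c ` (U \<inter> chart_dom c))
      (\<lambda>x. \<Sum>b\<in>Basis. (vf_rep A c X x \<bullet> b) * ((\<lambda>p. e p (chart_frame A c p b)) \<circ> chart_inv c) x)"
    by (intro smooth_on_sum smooth_on_mult smooth_on_inner_const open_chart_image c U)
      (use X c in \<open>auto simp: fields_on_def o_def\<close>)
  fix p assume p: "p \<in> U" "p \<in> chart_dom c"
  have lin: "linear (e p)" using e by (simp add: one_forms_def)
  show "(\<Sum>b\<in>Basis. (vf_rep A c X (chart_map c p) \<bullet> b) *
      ((\<lambda>p. e p (chart_frame A c p b)) \<circ> chart_inv c) (chart_map c p)) = e p (X p)"
    by (subst (2) vf_expand_frame[OF c p(2)])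
      (simp add: linear_sum[OF lin] linear_scale[OF lin] chart_inv_map[OF c p(2)])
qed

lemma endo_field:
  assumes U: "open U" and e: "e \<in> endo_fields A" and X: "X \<in> fields_on A U"
  shows "(\<lambda>q. e q (X q)) \<in> fields_on A U"
proof (rule fields_on_chartsI[OF U])
  fix c assume c: "c \<in> A"
  let ?h = "\<lambda>b. (\<lambda>p. chart_diff A c p (e p (chart_frame A c p b))) \<circ> chart_inv c"
  have "smooth_on (chart_im c) (?h b)" for b
    using e c by (simp add: endo_fields_def)
  then have "smooth_on (chart_map c ` (U \<inter> chart_dom c)) (?h b)" for b
    by (rule smooth_on_subset) (auto simp: chart_im_def)
  then show "smooth_on (chart_map c ` (U \<inter> chart_dom c))
      (\<lambda>x. \<Sum>b\<in>Basis. (vf_rep A c X x \<bullet> b) *\<^sub>R ?h b x)"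
    by (intro smooth_on_sum smooth_on_scaleR smooth_on_inner_const open_chart_image c U)
      (use X c in \<open>auto simp: fields_on_def o_def\<close>)
  fix p assume p: "p \<in> U" "p \<in> chart_dom c"
  have lin: "linear (e p)" using e by (simp add: endo_fields_def)
  note lin' = chart_diff_linear[OF c p(2)]
  show "(\<Sum>b\<in>Basis. (vf_rep A c X (chart_map c p) \<bullet> b) *\<^sub>R ?h b (chart_map c p)) =
      chart_diff A c p (e p (X p))"
    by (subst (2) vf_expand_frame[OF c p(2)])
      (simp add: linear_sum[OF lin] linear_scale[OF lin] linear_sum[OF lin'] linear_scale[OF lin']
        chart_inv_map[OF c p(2)])
qed

lemma metric_fun:
  assumes U: "open U" and g: "g \<in> riemannian_metrics A"
    and X: "X \<in> fields_on A U" and Y: "Y \<in> fields_on A U"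
  shows "(\<lambda>q. g q (X q) (Y q)) \<in> funs_on A U"
proof (rule funs_on_chartsI[OF U])
  fix c assume c: "c \<in> A"
  let ?h = "\<lambda>a b. (\<lambda>p. g p (chart_frame A c p a) (chart_frame A c p b)) \<circ> chart_inv c"
  have "smooth_on (chart_im c) (?h a b)" for a b
    using g c by (simp add: riemannian_metrics_def)
  then have "smooth_on (chart_map c ` (U \<inter> chart_dom c)) (?h a b)" for a b
    by (rule smooth_on_subset) (auto simp: chart_im_def)
  then show "smooth_on (chart_map c ` (U \<inter> chart_dom c))
      (\<lambda>x. \<Sum>a\<in>Basis. \<Sum>b\<in>Basis. (vf_rep A c X x \<bullet> a) * ((vf_rep A c Y x \<bullet> b) * ?h a b x))"
    by (intro smooth_on_sum smooth_on_mult smooth_on_inner_const open_chart_image c U)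
      (use X Y c in \<open>auto simp: fields_on_def o_def\<close>)
  fix p assume p: "p \<in> U" "p \<in> chart_dom c"
  have lin: "linear (\<lambda>v. g p u v)" "linear (\<lambda>v. g p v u)" for u
    using g by (auto simp: riemannian_metrics_def bilinear_def)
  have "g p (X p) (Y p) = (\<Sum>a\<in>Basis. (vf_rep A c X (chart_map c p) \<bullet> a) * g p (chart_frame A c p a) (Y p))"
    by (subst vf_expand_frame[OF c p(2), of X]) (simp add: linear_sum[OF lin(2)] linear_scale[OF lin(2)])
  also have "\<dots> = (\<Sum>a\<in>Basis. (vf_rep A c X (chart_map c p) \<bullet> a) *
      (\<Sum>b\<in>Basis. (vf_rep A c Y (chart_map c p) \<bullet> b) * g p (chart_frame A c p a) (chart_frame A c p b)))"
    by (subst vf_expand_frame[OF c p(2), of Y]) (simp add: linear_sum[OF lin(1)] linear_scale[OF lin(1)])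
  finally show "(\<Sum>a\<in>Basis. \<Sum>b\<in>Basis. (vf_rep A c X (chart_map c p) \<bullet> a) *
      ((vf_rep A c Y (chart_map c p) \<bullet> b) * ?h a b (chart_map c p))) = g p (X p) (Y p)"
    by (simp add: sum_distrib_left chart_inv_map[OF c p(2)])
qed

end

section \<open>Orthogonal frames and the Riesz representation of one-forms\<close>

text \<open>The orthogonalisation is not normalised: without square roots, smoothness of the resulting
  frame only needs closure under sums, products and quotients.\<close>

function gram_schmidt :: "('e::real_vector \<Rightarrow> 'e \<Rightarrow> real) \<Rightarrow> (nat \<Rightarrow> 'e) \<Rightarrow> nat \<Rightarrow> 'e" where
  "gram_schmidt b v k = v k - (\<Sum>i<k. (b (v k) (gram_schmidt b v i) /
     b (gram_schmidt b v i) (gram_schmidt b v i)) *\<^sub>R gram_schmidt b v i)"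
  by pat_completeness auto
termination by (relation "Wellfounded.measure (\<lambda>(b, v, k). k)") auto

declare gram_schmidt.simps [simp del]

lemma span_gram_schmidt: "span (gram_schmidt b v ` {..<k}) = span (v ` {..<k})"
proof (induction k)
  case (Suc k)
  let ?e = "gram_schmidt b v"
  have "?e k - v k = - (\<Sum>i<k. (b (v k) (?e i) / b (?e i) (?e i)) *\<^sub>R ?e i)"
    by (subst gram_schmidt.simps) simp
  also have "\<dots> \<in> span (?e ` {..<k})"
    by (intro span_neg span_sum span_scale span_base) auto
  finally have "span (insert (?e k) (?e ` {..<k})) = span (insert (v k) (?e ` {..<k}))"
    by (rule eq_span_insert_eq)
  also have "\<dots> = span (insert (v k) (v ` {..<k}))"
    using Suc.IH by (simp add: span_insert)
  finally show ?case by (simp add: lessThan_Suc)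
qed simp

lemma gram_schmidt_orthogonal:
  assumes b: "bilinear b" "\<And>u v. b u v = b v u" "\<And>v. v \<noteq> 0 \<Longrightarrow> b v v > 0"
  shows "i < k \<Longrightarrow> b (gram_schmidt b v k) (gram_schmidt b v i) = 0"
proof (induction k arbitrary: i rule: less_induct)
  case (less k)
  let ?e = "gram_schmidt b v"
  have orth: "b (?e j) (?e i) = 0" if "j < k" "j \<noteq> i" for j
    using less.IH[of j i] less.IH[of i j] less.prems that b(2) by (cases "i < j") auto
  have cancel: "r / b u u * b u u = r" if "u = 0 \<Longrightarrow> r = 0" for r u
    using that b(3)[of u] by (cases "u = 0") auto
  have "b (?e k) (?e i) = b (v k) (?e i) -
      (\<Sum>j<k. b (v k) (?e j) / b (?e j) (?e j) * b (?e j) (?e i))"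
    by (subst gram_schmidt.simps)
      (simp add: bilinear_lsub[OF b(1)] linear_sum[of "\<lambda>u. b u (?e i)"] b(1)[unfolded bilinear_def]
        bilinear_lmul[OF b(1)])
  also have "(\<Sum>j<k. b (v k) (?e j) / b (?e j) (?e j) * b (?e j) (?e i)) =
      (\<Sum>j<k. if j = i then b (v k) (?e i) else 0)"
  proof (rule sum.cong[OF refl])
    fix j assume "j \<in> {..<k}"
    then show "b (v k) (?e j) / b (?e j) (?e j) * b (?e j) (?e i) = (if j = i then b (v k) (?e i) else 0)"
      using orth[of j] cancel[of "?e i" "b (v k) (?e i)"] bilinear_rzero[OF b(1)] by auto
  qed
  also have "\<dots> = b (v k) (?e i)" using less.prems by simp
  finally show ?case by simp
qed

lemma gram_schmidt_nonzero:
  assumes "v k \<notin> span (v ` {..<k})"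
  shows "gram_schmidt b v k \<noteq> 0"
proof
  let ?e = "gram_schmidt b v"
  assume "?e k = 0"
  then have "v k = (\<Sum>i<k. (b (v k) (?e i) / b (?e i) (?e i)) *\<^sub>R ?e i)"
    by (subst (asm) gram_schmidt.simps) simp
  also have "\<dots> \<in> span (?e ` {..<k})"
    by (intro span_sum span_scale span_base) auto
  finally show False using assms span_gram_schmidt by metis
qed

text \<open>The difference of the two sides is orthogonal to all vectors of the basis, hence to their
  span, hence to itself.\<close>

lemma gram_schmidt_expansion:
  assumes b: "bilinear b" "\<And>u v. b u v = b v u" "\<And>v. v \<noteq> 0 \<Longrightarrow> b v v > 0"
    and v: "span (v ` {..<n}) = UNIV"
  shows "w = (\<Sum>k<n. (b w (gram_schmidt b v k) / b (gram_schmidt b v k) (gram_schmidt b v k)) *\<^sub>R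
    gram_schmidt b v k)"
proof -
  let ?e = "gram_schmidt b v"
  define r where "r = w - (\<Sum>k<n. (b w (?e k) / b (?e k) (?e k)) *\<^sub>R ?e k)"
  note lin = b(1)[unfolded bilinear_def]
  have orth: "b (?e j) (?e i) = 0" if "j \<noteq> i" for i j
    using gram_schmidt_orthogonal[OF b, of i j v] gram_schmidt_orthogonal[OF b, of j i v] that b(2)
    by (cases "i < j") auto
  have cancel: "s / b u u * b u u = s" if "u = 0 \<Longrightarrow> s = 0" for s u
    using that b(3)[of u] by (cases "u = 0") auto
  have re: "b r (?e i) = 0" if i: "i < n" for i
  proof -
    have "b r (?e i) = b w (?e i) - (\<Sum>k<n. b w (?e k) / b (?e k) (?e k) * b (?e k) (?e i))"
      by (simp add: r_def bilinear_lsub[OF b(1)] linear_sum[of "\<lambda>u. b u (?e i)"] lin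
          bilinear_lmul[OF b(1)])
    also have "(\<Sum>k<n. b w (?e k) / b (?e k) (?e k) * b (?e k) (?e i)) =
        (\<Sum>k<n. if k = i then b w (?e i) else 0)"
    proof (rule sum.cong[OF refl])
      fix k assume "k \<in> {..<n}"
      show "b w (?e k) / b (?e k) (?e k) * b (?e k) (?e i) = (if k = i then b w (?e i) else 0)"
        using orth[of k] cancel[of "?e i" "b w (?e i)"] bilinear_rzero[OF b(1)] by auto
    qed
    also have "\<dots> = b w (?e i)" using i by simp
    finally show ?thesis by simp
  qed
  have "r \<in> span (?e ` {..<n})" using v span_gram_schmidt[of b v n] by simp
  moreover have "b r x = 0" if "x \<in> span (?e ` {..<n})" for x
    using that by (induction rule: span_induct) (use re in \<open>auto simp: subspace_def bilinear_rzero[OF b(1)]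
        bilinear_radd[OF b(1)] bilinear_rmul[OF b(1)]\<close>)
  ultimately have "b r r = 0" by blast
  then have "r = 0" using b(3) by force
  then show ?thesis by (simp add: r_def)
qed

locale riemannian_manifold = smooth_manifold A
  for A :: "('m::{t2_space,second_countable_topology}, 'e::euclidean_space) chart set" +
  fixes g :: "'m \<Rightarrow> 'e \<Rightarrow> 'e \<Rightarrow> real"
  assumes riemannian_metric: "g \<in> riemannian_metrics A"
begin

lemma g_bilinear: "bilinear (g p)" and g_sym: "g p u v = g p v u" and g_pos: "v \<noteq> 0 \<Longrightarrow> g p v v > 0"
  using riemannian_metric by (auto simp: riemannian_metrics_def)

lemmas g_simps =
  bilinear_ladd[OF g_bilinear] bilinear_radd[OF g_bilinear]
  bilinear_lmul[OF g_bilinear] bilinear_rmul[OF g_bilinear]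
  bilinear_lneg[OF g_bilinear] bilinear_rneg[OF g_bilinear]
  bilinear_lsub[OF g_bilinear] bilinear_rsub[OF g_bilinear]
  bilinear_lzero[OF g_bilinear] bilinear_rzero[OF g_bilinear]

lemma g_sum_left: "g p (\<Sum>i\<in>I. u i) v = (\<Sum>i\<in>I. g p (u i) v)"
  using linear_sum[of "\<lambda>u. g p u v"] g_bilinear by (auto simp: bilinear_def)

lemma g_sum_right: "g p v (\<Sum>i\<in>I. u i) = (\<Sum>i\<in>I. g p v (u i))"
  using g_sum_left g_sym by simp

lemmas g_fun = metric_fun[OF _ riemannian_metric]

lemma metric_eqI:
  assumes "g p (V p) (V p - W p) = g p (W p) (V p - W p)"
  shows "V p = W p"
proof (rule ccontr)
  assume "V p \<noteq> W p"
  then have "g p (V p - W p) (V p - W p) > 0" by (intro g_pos) simp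
  with assms show False by (simp add: g_simps)
qed

text \<open>The difference of two smooth fields is a smooth field, and pairing it with itself is enough:
  equality at \<open>p\<close> needs no fields with prescribed values at \<open>p\<close>.\<close>

lemma field_eqI:
  assumes "V \<in> vector_fields A" "W \<in> vector_fields A"
    and "\<And>Z. Z \<in> vector_fields A \<Longrightarrow> g p (V p) (Z p) = g p (W p) (Z p)"
  shows "V p = W p"
  using assms(3)[of "\<lambda>q. V q - W q"] field_diff[of UNIV V W] assms(1,2)
  by (intro metric_eqI) (simp add: fields_on_UNIV)

text \<open>The frame comes from the coordinate frame of \<open>c\<close>. Off the chart domain the
  orthogonalised standard basis takes its place, with no continuity at the boundary: then the expansion of a field
  in the frame is an equality of functions on the whole manifold, into which a functional on
  fields can be applied.\<close>

lemma orthogonal_frame: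
  assumes c: "c \<in> A"
  shows "\<exists>E :: nat \<Rightarrow> 'm \<Rightarrow> 'e. (\<forall>k<DIM('e). E k \<in> fields_on A (chart_dom c) \<and> (\<forall>q. E k q \<noteq> 0)) \<and>
    (\<forall>q w. w = (\<Sum>k<DIM('e). (g q w (E k q) / g q (E k q) (E k q)) *\<^sub>R E k q))"
proof -
  let ?n = "DIM('e)"
  obtain \<beta> where \<beta>: "bij_betw \<beta> {..<?n} (Basis :: 'e set)"
    using ex_bij_betw_nat_finite[of "Basis :: 'e set"] by (auto simp: lessThan_atLeast0)
  \<comment> \<open>the coordinate frame of \<open>c\<close>, and the standard basis away from \<open>c\<close>\<close>
  define L where "L q v = (if q \<in> chart_dom c then chart_frame A c q v else v)" for q v
  have lin: "linear (L q)" for q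
    using chart_frame_linear[OF c, of q] linear_id
    by (cases "q \<in> chart_dom c") (simp_all add: L_def[abs_def] id_def)
  have inj: "inj (L q)" for q
    by (rule inj_on_inverseI[of _ "if q \<in> chart_dom c then chart_diff A c q else id"])
      (auto simp: L_def chart_diff_frame c)
  have surj: "surj (L q)" for q
    using linear_injective_imp_surjective[OF lin inj] by simp
  define E where "E k q = gram_schmidt (g q) (\<lambda>i. L q (\<beta> i)) k" for k q
  have sp: "span ((\<lambda>i. L q (\<beta> i)) ` {..<?n}) = UNIV" for q
  proof -
    have "(\<lambda>i. L q (\<beta> i)) ` {..<?n} = L q ` Basis"
      using \<beta> by (auto simp: bij_betw_def image_image[symmetric])
    then show ?thesis
      using span_linear_image[OF lin, of q Basis] surj[of q] by simp
  qed
  have ind: "L q (\<beta> k) \<notin> span ((\<lambda>i. L q (\<beta> i)) ` {..<k})" if k: "k < ?n" for k q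
  proof
    assume "L q (\<beta> k) \<in> span ((\<lambda>i. L q (\<beta> i)) ` {..<k})"
    also have "(\<lambda>i. L q (\<beta> i)) ` {..<k} = L q ` \<beta> ` {..<k}" by auto
    finally have "\<beta> k \<in> span (\<beta> ` {..<k})"
      using span_linear_image[OF lin, of q "\<beta> ` {..<k}"] inj[of q] by (auto simp: inj_def)
    moreover have "\<beta> ` {..<k} \<subseteq> Basis - {\<beta> k}"
    proof -
      have "inj_on \<beta> {..<?n}" "\<beta> ` {..<?n} = Basis" using \<beta> by (auto simp: bij_betw_def)
      then show ?thesis using k by (force simp: inj_on_def)
    qed
    ultimately have "\<beta> k \<in> span (Basis - {\<beta> k})" using span_mono by blast
    moreover have "\<beta> k \<in> Basis" using \<beta> k by (auto simp: bij_betw_def)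
    ultimately show False using independent_Basis by (auto simp: dependent_def)
  qed
  have nz: "E k q \<noteq> 0" if "k < ?n" for k q
    unfolding E_def by (rule gram_schmidt_nonzero[OF ind[OF that]])
  have EF: "E k \<in> fields_on A (chart_dom c)" if "k < ?n" for k
    using that
  proof (induction k rule: less_induct)
    case (less k)
    have F: "(\<lambda>q. L q (\<beta> k)) \<in> fields_on A (chart_dom c)"
      by (rule field_cong[OF open_dom[OF c] field_frame[OF c]]) (auto simp: L_def)
    have "(\<lambda>q. L q (\<beta> k) - (\<Sum>i<k. (g q (L q (\<beta> k)) (E i q) / g q (E i q) (E i q)) *\<^sub>R E i q))
        \<in> fields_on A (chart_dom c)"
      by (intro field_diff field_sum field_scale fun_divide g_fun open_dom[OF c] F less.IH)
        (use less.prems nz g_pos in \<open>auto simp: less_le\<close>)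
    moreover have "E k = (\<lambda>q. L q (\<beta> k) -
        (\<Sum>i<k. (g q (L q (\<beta> k)) (E i q) / g q (E i q) (E i q)) *\<^sub>R E i q))"
      unfolding E_def[abs_def] by (rule ext, subst gram_schmidt.simps) simp
    ultimately show ?case by simp
  qed
  have EX: "w = (\<Sum>k<?n. (g q w (E k q) / g q (E k q) (E k q)) *\<^sub>R E k q)" for q w
    unfolding E_def by (rule gram_schmidt_expansion[OF g_bilinear g_sym g_pos sp])
  show ?thesis
    by (intro exI[of _ E] conjI allI impI EF nz EX)
qed

text \<open>A functional on fields that is linear over the smooth functions on every open set is the
  pairing with a smooth field. In an orthogonal frame \<open>E\<close> over a chart this field is the sum
  of the \<open>L(E k) / g(E k, E k)\<close> times \<open>E k\<close>. Two charts give the same field on their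
  overlap, since it is determined there by \<open>L\<close>.\<close>

lemma riesz_field:
  assumes L_fun: "\<And>U Z. open U \<Longrightarrow> Z \<in> fields_on A U \<Longrightarrow> L Z \<in> funs_on A U"
    and L_add: "\<And>U Z Z' p. open U \<Longrightarrow> p \<in> U \<Longrightarrow> Z \<in> fields_on A U \<Longrightarrow> Z' \<in> fields_on A U \<Longrightarrow>
      L (\<lambda>q. Z q + Z' q) p = L Z p + L Z' p"
    and L_scale: "\<And>U f Z p. open U \<Longrightarrow> p \<in> U \<Longrightarrow> f \<in> funs_on A U \<Longrightarrow> Z \<in> fields_on A U \<Longrightarrow>
      L (\<lambda>q. f q *\<^sub>R Z q) p = f p * L Z p"
  shows "\<exists>W\<in>vector_fields A. \<forall>Z\<in>vector_fields A. \<forall>p. g p (W p) (Z p) = L Z p"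
proof -
  have L_sum: "L (\<lambda>q. \<Sum>k<n. h k q *\<^sub>R E k q) p = (\<Sum>k<n. h k p * L (E k) p)"
    if "open U" "p \<in> U" "\<And>k. k < n \<Longrightarrow> h k \<in> funs_on A U" "\<And>k. k < n \<Longrightarrow> E k \<in> fields_on A U"
    for U p h E and n :: nat
    using that(3,4)
  proof (induction n)
    case 0
    show ?case
      using L_scale[OF that(1,2) fun_const[of 0] field_zero] by simp
  next
    case (Suc n)
    have "L (\<lambda>q. (\<Sum>k<n. h k q *\<^sub>R E k q) + h n q *\<^sub>R E n q) p =
        L (\<lambda>q. \<Sum>k<n. h k q *\<^sub>R E k q) p + L (\<lambda>q. h n q *\<^sub>R E n q) p"
      by (intro L_add[OF that(1,2)] field_sum field_scale that(1)) (use Suc.prems in auto)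
    then show ?case
      using Suc L_scale[OF that(1,2), of "h n" "E n"] by simp
  qed
  have "\<forall>c\<in>A. \<exists>V. V \<in> fields_on A (chart_dom c) \<and> (\<forall>U Z p. open U \<longrightarrow> p \<in> U \<longrightarrow> p \<in> chart_dom c \<longrightarrow>
      Z \<in> fields_on A U \<longrightarrow> g p (V p) (Z p) = L Z p)"
  proof
    fix c assume c: "c \<in> A"
    from orthogonal_frame[OF c] obtain E :: "nat \<Rightarrow> 'm \<Rightarrow> 'e" where
      E: "(\<forall>k<DIM('e). E k \<in> fields_on A (chart_dom c) \<and> (\<forall>q. E k q \<noteq> 0)) \<and>
        (\<forall>q w. w = (\<Sum>k<DIM('e). (g q w (E k q) / g q (E k q) (E k q)) *\<^sub>R E k q))"
      by (rule exE)
    have EF: "E k \<in> fields_on A (chart_dom c)" and E0: "E k q \<noteq> 0" if "k < DIM('e)" for k q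
      using conjunct1[OF E] that by auto
    have nz: "g q (E k q) (E k q) \<noteq> 0" if "k < DIM('e)" for k q
      using g_pos[OF E0[OF that]] by (simp add: less_le)
    define V where "V q = (\<Sum>k<DIM('e). (L (E k) q / g q (E k q) (E k q)) *\<^sub>R E k q)" for q
    have "V \<in> fields_on A (chart_dom c)"
      unfolding V_def[abs_def]
      by (intro field_sum field_scale fun_divide g_fun L_fun open_dom[OF c]) (use EF nz in auto)
    moreover have "g p (V p) (Z p) = L Z p"
      if U: "open U" "p \<in> U" "p \<in> chart_dom c" "Z \<in> fields_on A U" for U Z p
    proof -
      let ?U = "U \<inter> chart_dom c"
      have oU: "open ?U" using U(1) open_dom[OF c] by auto
      have EU: "E k \<in> fields_on A ?U" if "k < DIM('e)" for k
        using fields_on_mono[OF EF[OF that]] by simp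
      have ZU: "Z \<in> fields_on A ?U" using fields_on_mono[OF U(4)] by simp
      have Z: "Z = (\<lambda>q. \<Sum>k<DIM('e). (g q (Z q) (E k q) / g q (E k q) (E k q)) *\<^sub>R E k q)"
        by (rule ext) (rule spec[OF spec[OF conjunct2[OF E]]])
      have h: "(\<lambda>q. g q (Z q) (E k q) / g q (E k q) (E k q)) \<in> funs_on A ?U" if "k < DIM('e)" for k
        by (intro fun_divide g_fun oU ZU EU nz that)
      have "L Z p = L (\<lambda>q. \<Sum>k<DIM('e). (g q (Z q) (E k q) / g q (E k q) (E k q)) *\<^sub>R E k q) p"
        by (rule arg_cong[where f = "\<lambda>Z. L Z p", OF Z])
      also have "\<dots> = (\<Sum>k<DIM('e). (g p (Z p) (E k p) / g p (E k p) (E k p)) * L (E k) p)"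
        by (rule L_sum[OF oU _ h EU]) (use U in auto)
      also have "\<dots> = g p (V p) (Z p)"
        unfolding V_def g_sum_left
        by (rule sum.cong[OF refl]) (simp add: g_simps g_sym[of p "E _ p" "Z p"])
      finally show ?thesis by (rule sym)
    qed
    ultimately show "\<exists>V. V \<in> fields_on A (chart_dom c) \<and> (\<forall>U Z p. open U \<longrightarrow> p \<in> U \<longrightarrow>
      p \<in> chart_dom c \<longrightarrow> Z \<in> fields_on A U \<longrightarrow> g p (V p) (Z p) = L Z p)"
      by (intro exI[of _ V] conjI allI impI)
  qed
  from bchoice[OF this] obtain V where V': "\<forall>c\<in>A. V c \<in> fields_on A (chart_dom c) \<and>
      (\<forall>U Z p. open U \<longrightarrow> p \<in> U \<longrightarrow> p \<in> chart_dom c \<longrightarrow> Z \<in> fields_on A U \<longrightarrow>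
        g p (V c p) (Z p) = L Z p)"
    by (rule exE)
  have V: "V c \<in> fields_on A (chart_dom c)"
    "open U \<Longrightarrow> p \<in> U \<Longrightarrow> p \<in> chart_dom c \<Longrightarrow> Z \<in> fields_on A U \<Longrightarrow>
      g p (V c p) (Z p) = L Z p" if "c \<in> A" for c U Z p
    using bspec[OF V' that] by simp_all
  \<comment> \<open>the difference of the two local fields is a field on the overlap, so it can test itself\<close>
  have agree: "V c p = V d p" if cd: "c \<in> A" "d \<in> A" "p \<in> chart_dom c" "p \<in> chart_dom d" for c d p
  proof -
    let ?U = "chart_dom c \<inter> chart_dom d"
    have oU: "open ?U" using open_dom cd by auto
    have "V c \<in> fields_on A ?U" "V d \<in> fields_on A ?U"
      using fields_on_mono[OF V(1)] cd by auto
    then have W: "(\<lambda>q. V c q - V d q) \<in> fields_on A ?U" by (intro field_diff oU)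
    have "g p (V c p) (V c p - V d p) = g p (V d p) (V c p - V d p)"
      using V(2)[OF cd(1) oU _ cd(3) W] V(2)[OF cd(2) oU _ cd(4) W] cd by simp
    then show ?thesis by (rule metric_eqI)
  qed
  define W where "W p = V (chart_at A p) p" for p
  have "W \<in> vector_fields A"
  proof (rule field_from_charts)
    fix c assume c: "c \<in> A"
    show "W \<in> fields_on A (chart_dom c)"
      by (rule field_cong[OF open_dom[OF c] V(1)[OF c]])
        (simp add: W_def agree[OF c chart_at_atlas _ chart_at_dom])
  qed
  moreover have "g p (W p) (Z p) = L Z p" if "Z \<in> vector_fields A" for Z p
    unfolding W_def by (rule V(2)[OF chart_at_atlas open_UNIV _ chart_at_dom])
      (use that in \<open>auto simp: fields_on_UNIV\<close>)
  ultimately show ?thesis by blast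
qed

end

section \<open>Three-forms\<close>

text \<open>A 3-form in the sense of sheaves: defined for fields on any open set, because it will be
  evaluated on local frames. Skew symmetry transfers linearity from the third argument to the
  other two.\<close>

definition local_three_form ::
    "('m::topological_space, 'e::euclidean_space) chart set \<Rightarrow>
     (('m \<Rightarrow> 'e) \<Rightarrow> ('m \<Rightarrow> 'e) \<Rightarrow> ('m \<Rightarrow> 'e) \<Rightarrow> 'm \<Rightarrow> real) \<Rightarrow> bool" where
  "local_three_form A T \<longleftrightarrow> (\<forall>U. open U \<longrightarrow>
     (\<forall>X\<in>fields_on A U. \<forall>Y\<in>fields_on A U. \<forall>Z\<in>fields_on A U. T X Y Z \<in> funs_on A U \<and>
       (\<forall>p\<in>U. T X Y Z p = - T Y X Z p \<and> T X Y Z p = - T X Z Y p \<and>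
         (\<forall>W\<in>fields_on A U. T X Y (\<lambda>q. Z q + W q) p = T X Y Z p + T X Y W p) \<and>
         (\<forall>f\<in>funs_on A U. T X Y (\<lambda>q. f q *\<^sub>R Z q) p = f p * T X Y Z p))))"

lemma local_three_formI:
  assumes "\<And>U X Y Z. open U \<Longrightarrow> X \<in> fields_on A U \<Longrightarrow> Y \<in> fields_on A U \<Longrightarrow> Z \<in> fields_on A U \<Longrightarrow>
      T X Y Z \<in> funs_on A U"
    and "\<And>U X Y Z p. open U \<Longrightarrow> p \<in> U \<Longrightarrow> X \<in> fields_on A U \<Longrightarrow> Y \<in> fields_on A U \<Longrightarrow> Z \<in> fields_on A U \<Longrightarrow>
      T X Y Z p = - T Y X Z p"
    and "\<And>U X Y Z p. open U \<Longrightarrow> p \<in> U \<Longrightarrow> X \<in> fields_on A U \<Longrightarrow> Y \<in> fields_on A U \<Longrightarrow> Z \<in> fields_on A U \<Longrightarrow>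
      T X Y Z p = - T X Z Y p"
    and "\<And>U X Y Z W p. open U \<Longrightarrow> p \<in> U \<Longrightarrow> X \<in> fields_on A U \<Longrightarrow> Y \<in> fields_on A U \<Longrightarrow> Z \<in> fields_on A U \<Longrightarrow>
      W \<in> fields_on A U \<Longrightarrow> T X Y (\<lambda>q. Z q + W q) p = T X Y Z p + T X Y W p"
    and "\<And>U X Y Z f p. open U \<Longrightarrow> p \<in> U \<Longrightarrow> X \<in> fields_on A U \<Longrightarrow> Y \<in> fields_on A U \<Longrightarrow> Z \<in> fields_on A U \<Longrightarrow>
      f \<in> funs_on A U \<Longrightarrow> T X Y (\<lambda>q. f q *\<^sub>R Z q) p = f p * T X Y Z p"
  shows "local_three_form A T"
  unfolding local_three_form_def by (intro allI impI ballI conjI; (rule assms; assumption))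

lemma local_three_formD:
  assumes "local_three_form A T" "open U" "X \<in> fields_on A U" "Y \<in> fields_on A U" "Z \<in> fields_on A U"
  shows "T X Y Z \<in> funs_on A U"
    and "p \<in> U \<Longrightarrow> T X Y Z p = - T Y X Z p"
    and "p \<in> U \<Longrightarrow> T X Y Z p = - T X Z Y p"
    and "p \<in> U \<Longrightarrow> W \<in> fields_on A U \<Longrightarrow> T X Y (\<lambda>q. Z q + W q) p = T X Y Z p + T X Y W p"
    and "p \<in> U \<Longrightarrow> f \<in> funs_on A U \<Longrightarrow> T X Y (\<lambda>q. f q *\<^sub>R Z q) p = f p * T X Y Z p"
  using assms(1)[unfolded local_three_form_def, THEN spec, THEN mp, OF assms(2), THEN bspec, OF assms(3),
      THEN bspec, OF assms(4), THEN bspec, OF assms(5)] by blast+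

context smooth_manifold
begin

lemma vf_deriv_uminus:
  assumes "open U" "p \<in> U" "f \<in> funs_on A U"
  shows "vf_deriv A X (\<lambda>q. - f q) p = - vf_deriv A X f p"
  using vf_deriv_mult[OF assms(1,2) fun_const[of "-1"] assms(3)] by (simp add: vf_deriv_const)

lemma fun_uminus: "open U \<Longrightarrow> f \<in> funs_on A U \<Longrightarrow> (\<lambda>q. - f q) \<in> funs_on A U"
  using fun_mult[OF _ fun_const[of "-1"]] by simp

lemma lie_bracket_add_left:
  assumes "open U" "p \<in> U" "X \<in> fields_on A U" "Y \<in> fields_on A U" "Z \<in> fields_on A U"
  shows "lie_bracket A (\<lambda>q. X q + Y q) Z p = lie_bracket A X Z p + lie_bracket A Y Z p"
  using lie_bracket_add_right[OF assms(1,2,5,3,4)]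
    lie_bracket_skew[of "\<lambda>q. X q + Y q" Z] lie_bracket_skew[of X Z] lie_bracket_skew[of Y Z] by simp

lemma lie_bracket_scale_left:
  assumes "open U" "p \<in> U" "X \<in> fields_on A U" "Y \<in> fields_on A U" "f \<in> funs_on A U"
  shows "lie_bracket A (\<lambda>q. f q *\<^sub>R X q) Y p = f p *\<^sub>R lie_bracket A X Y p - vf_deriv A Y f p *\<^sub>R X p"
  using lie_bracket_scale_right[OF assms(1,2,4,3,5)]
    lie_bracket_skew[of "\<lambda>q. f q *\<^sub>R X q" Y] lie_bracket_skew[of X Y] by simp

lemma three_form_zero_right:
  assumes "local_three_form A T" "open U" "p \<in> U" "X \<in> fields_on A U" "Y \<in> fields_on A U"
  shows "T X Y (\<lambda>q. 0) p = 0"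
  using local_three_formD(5)[OF assms(1,2,4,5) field_zero assms(3) fun_const[of 0]] by simp

lemma three_form_add:
  assumes S: "local_three_form A S" and T: "local_three_form A T"
  shows "local_three_form A (\<lambda>X Y Z p. S X Y Z p + T X Y Z p)"
proof (rule local_three_formI, goal_cases)
  case (1 U X Y Z)
  then show ?case by (intro fun_add local_three_formD[OF S] local_three_formD[OF T])
next
  case (2 U X Y Z p)
  then show ?case using local_three_formD(2)[OF S 2(1,3,4,5,2)] local_three_formD(2)[OF T 2(1,3,4,5,2)]
    by simp
next
  case (3 U X Y Z p)
  then show ?case using local_three_formD(3)[OF S 3(1,3,4,5,2)] local_three_formD(3)[OF T 3(1,3,4,5,2)]
    by simp
next
  case (4 U X Y Z W p)
  then show ?case
    using local_three_formD(4)[OF S 4(1,3,4,5,2,6)] local_three_formD(4)[OF T 4(1,3,4,5,2,6)] by simp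
next
  case (5 U X Y Z f p)
  then show ?case
    using local_three_formD(5)[OF S 5(1,3,4,5,2,6)] local_three_formD(5)[OF T 5(1,3,4,5,2,6)]
    by (simp add: algebra_simps)
qed

lemma zero_three_form: "local_three_form A (\<lambda>X Y Z p. 0)"
  by (rule local_three_formI) (auto intro: fun_const)

lemma three_form_sum:
  assumes "finite I" "\<And>i. i \<in> I \<Longrightarrow> local_three_form A (T i)"
  shows "local_three_form A (\<lambda>X Y Z p. \<Sum>i\<in>I. T i X Y Z p)"
  using assms by (induction I) (auto intro: three_form_add zero_three_form)

text \<open>How a torsion form is recognised as a 3-form: it only has to agree with a local 3-form on
  global fields.\<close>

lemma local_three_form_is_three_form:
  assumes T: "local_three_form A T"
    and eq: "\<And>X Y Z p. X \<in> vector_fields A \<Longrightarrow> Y \<in> vector_fields A \<Longrightarrow> Z \<in> vector_fields A \<Longrightarrow>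
      S X Y Z p = T X Y Z p"
  shows "is_three_form A S"
proof -
  note D = local_three_formD[OF T open_UNIV, unfolded fields_on_UNIV funs_on_UNIV, simplified]
  have skew: "S X Y Z p = - S Y X Z p" "S X Y Z p = - S X Z Y p"
    if "X \<in> vector_fields A" "Y \<in> vector_fields A" "Z \<in> vector_fields A" for X Y Z p
    using D(2,3)[OF that, of p] eq that by simp_all
  have Seq: "S X Y Z = T X Y Z"
    if "X \<in> vector_fields A" "Y \<in> vector_fields A" "Z \<in> vector_fields A" for X Y Z
    using eq[OF that] by blast
  have add: "(\<lambda>q. Z q + W q) \<in> vector_fields A" if "Z \<in> vector_fields A" "W \<in> vector_fields A" for Z W
    using field_add[of UNIV Z W] that by (simp add: fields_on_UNIV)
  have scale: "(\<lambda>q. f q *\<^sub>R Z q) \<in> vector_fields A" if "f \<in> smooth_functions A" "Z \<in> vector_fields A" for f Z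
    using field_scale[of UNIV f Z] that by (simp add: fields_on_UNIV funs_on_UNIV)
  have t: "tensorial A (\<lambda>Z. S X Y Z)" if XY: "X \<in> vector_fields A" "Y \<in> vector_fields A" for X Y
    unfolding tensorial_def
    using D(1,4,5) XY Seq add scale by simp
  have m: "(\<lambda>p. - f p) \<in> smooth_functions A" if "f \<in> smooth_functions A" for f
    using fun_uminus[of UNIV f] that by (simp add: funs_on_UNIV)
  have neg: "tensorial A L'" if "tensorial A L" "\<And>Z p. Z \<in> vector_fields A \<Longrightarrow> L' Z p = - L Z p" for L L'
  proof -
    have "L' Z = (\<lambda>p. - L Z p)" if "Z \<in> vector_fields A" for Z using that \<open>\<And>Z p. Z \<in> vector_fields A \<Longrightarrow> L' Z p = - L Z p\<close> by blast
    then show ?thesis using that(1) m add scale unfolding tensorial_def by simp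
  qed
  have t2: "tensorial A (\<lambda>Z. S X Z Y)" if XY: "X \<in> vector_fields A" "Y \<in> vector_fields A" for X Y
    by (rule neg[OF t[OF XY]]) (rule skew(2)[OF XY(1) _ XY(2)])
  have t3: "tensorial A (\<lambda>Z. S Z X Y)" if XY: "X \<in> vector_fields A" "Y \<in> vector_fields A" for X Y
    by (rule neg[OF t2[OF XY]]) (rule skew(1)[OF _ XY])
  show ?thesis unfolding is_three_form_def using t t2 t3 skew by blast
qed

subsection \<open>Exterior derivatives\<close>

lemma d_one_fun:
  assumes "open U" "e \<in> one_forms A" "X \<in> fields_on A U" "Y \<in> fields_on A U"
  shows "d_one A e X Y \<in> funs_on A U"
  unfolding d_one_def[abs_def]
  by (intro fun_diff vf_deriv_fun one_form_fun lie_bracket_field assms)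

lemma d_one_skew:
  assumes "e \<in> one_forms A"
  shows "d_one A e X Y p = - d_one A e Y X p"
  using assms lie_bracket_skew[of X Y p] by (simp add: d_one_def one_forms_def linear_neg)

lemma d_one_add_right:
  assumes U: "open U" "p \<in> U" and e: "e \<in> one_forms A"
    and F: "X \<in> fields_on A U" "Y \<in> fields_on A U" "Z \<in> fields_on A U"
  shows "d_one A e X (\<lambda>q. Y q + Z q) p = d_one A e X Y p + d_one A e X Z p"
proof -
  have lin: "linear (e q)" for q using e by (simp add: one_forms_def)
  show ?thesis
    by (simp add: d_one_def linear_add[OF lin] lie_bracket_add_right[OF U F]
      vf_deriv_add[OF U one_form_fun[OF U(1) e F(2)] one_form_fun[OF U(1) e F(3)]]
      vf_deriv_field_add[OF U one_form_fun[OF U(1) e F(1)]])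
qed

text \<open>The derivative of \<open>f\<close> along \<open>X\<close> enters once from the Leibniz rule and once from the bracket,
  with opposite signs. The same cancellation makes \<open>d_two\<close> linear over the functions.\<close>

lemma d_one_scale_right:
  assumes U: "open U" "p \<in> U" and e: "e \<in> one_forms A" and f: "f \<in> funs_on A U"
    and F: "X \<in> fields_on A U" "Y \<in> fields_on A U"
  shows "d_one A e X (\<lambda>q. f q *\<^sub>R Y q) p = f p * d_one A e X Y p"
proof -
  have lin: "linear (e q)" for q using e by (simp add: one_forms_def)
  show ?thesis
    by (simp add: d_one_def linear_add[OF lin] linear_scale[OF lin] lie_bracket_scale_right[OF U F f]
      vf_deriv_mult[OF U f one_form_fun[OF U(1) e F(2)]]
      vf_deriv_field_scale[OF U one_form_fun[OF U(1) e F(1)]] algebra_simps)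
qed

lemma wedge_d_one_three_form:
  assumes e: "e \<in> one_forms A"
  shows "local_three_form A (wedge_one_two e (d_one A e))"
proof -
  have lin: "linear (e q)" for q using e by (simp add: one_forms_def)
  show ?thesis
  proof (rule local_three_formI, goal_cases)
    case (1 U X Y Z)
    then show ?case
      unfolding wedge_one_two_def[abs_def]
      by (intro fun_add fun_diff fun_mult one_form_fun d_one_fun e)
  next
    case (2 U X Y Z p)
    then show ?case using d_one_skew[OF e, of X Y p] by (simp add: wedge_one_two_def algebra_simps)
  next
    case (3 U X Y Z p)
    then show ?case using d_one_skew[OF e, of Y Z p] by (simp add: wedge_one_two_def algebra_simps)
  next
    case (4 U X Y Z W p)
    then show ?case
      using d_one_add_right[OF 4(1,2) e 4(3,5,6)] d_one_add_right[OF 4(1,2) e 4(4,5,6)]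
      by (simp add: wedge_one_two_def linear_add[OF lin] algebra_simps)
  next
    case (5 U X Y Z f p)
    then show ?case
      using d_one_scale_right[OF 5(1,2) e 5(6,3,5)] d_one_scale_right[OF 5(1,2) e 5(6,4,5)]
      by (simp add: wedge_one_two_def linear_scale[OF lin] algebra_simps)
  qed
qed

lemma d_two_three_form:
  assumes bil: "\<And>q. bilinear (\<omega> q)" and skew: "\<And>q u v. \<omega> q u v = - \<omega> q v u"
    and funs: "\<And>U X Y. open U \<Longrightarrow> X \<in> fields_on A U \<Longrightarrow> Y \<in> fields_on A U \<Longrightarrow>
      (\<lambda>q. \<omega> q (X q) (Y q)) \<in> funs_on A U"
  shows "local_three_form A (d_two A \<omega>)"
proof -
  note bs = bilinear_ladd[OF bil] bilinear_radd[OF bil] bilinear_lmul[OF bil] bilinear_rmul[OF bil]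
    bilinear_lsub[OF bil] bilinear_rsub[OF bil] bilinear_lneg[OF bil] bilinear_rneg[OF bil]
  have dskew: "vf_deriv A Z (\<lambda>q. \<omega> q (X q) (Y q)) p = - vf_deriv A Z (\<lambda>q. \<omega> q (Y q) (X q)) p"
    if "open U" "p \<in> U" "X \<in> fields_on A U" "Y \<in> fields_on A U" for U p X Y Z
    using vf_deriv_uminus[OF that(1,2) funs[OF that(1,4,3)]]
    by (subst skew) simp
  show ?thesis
  proof (rule local_three_formI, goal_cases)
    case (1 U X Y Z)
    then show ?case
      unfolding d_two_def[abs_def]
      by (intro fun_add fun_diff vf_deriv_fun funs lie_bracket_field)
  next
    case (2 U X Y Z p)
    then show ?case using dskew[OF 2(1-4), of Z] lie_bracket_skew[of X Y p]
      by (simp add: d_two_def bs)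
  next
    case (3 U X Y Z p)
    then show ?case using dskew[OF 3(1,2,4,5), of X] lie_bracket_skew[of Y Z p]
      by (simp add: d_two_def bs)
  next
    case (4 U X Y Z W p)
    note U = 4(1,2) and F = 4(3-6)
    show ?case
      by (simp add: d_two_def bs lie_bracket_add_right[OF U F(1) F(3,4)] lie_bracket_add_right[OF U F(2) F(3,4)]
          vf_deriv_add[OF U funs[OF U(1) F(1,3)] funs[OF U(1) F(1,4)]]
          vf_deriv_add[OF U funs[OF U(1) F(2,3)] funs[OF U(1) F(2,4)]]
          vf_deriv_field_add[OF U funs[OF U(1) F(1,2)]])
  next
    case (5 U X Y Z f p)
    note U = 5(1,2) and F = 5(3-5) and f = 5(6)
    show ?case
      using skew[of p "Z p" "X p"] skew[of p "Z p" "Y p"]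
      by (simp add: d_two_def bs lie_bracket_scale_right[OF U F(1) F(3) f]
          lie_bracket_scale_right[OF U F(2) F(3) f]
          vf_deriv_mult[OF U f funs[OF U(1) F(1,3)]] vf_deriv_mult[OF U f funs[OF U(1) F(2,3)]]
          vf_deriv_field_scale[OF U funs[OF U(1) F(1,2)]] algebra_simps)
  qed
qed

lemma neg_pullback_three_form:
  assumes T: "local_three_form A T" and e: "e \<in> endo_fields A"
  shows "local_three_form A (\<lambda>X Y Z p. - T (\<lambda>q. e q (X q)) (\<lambda>q. e q (Y q)) (\<lambda>q. e q (Z q)) p)"
proof -
  have lin: "linear (e q)" for q using e by (simp add: endo_fields_def)
  note ef = endo_field[OF _ e]
  show ?thesis
  proof (rule local_three_formI, goal_cases)
    case (1 U X Y Z)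
    then show ?case by (intro fun_uminus local_three_formD(1)[OF T] ef)
  next
    case (2 U X Y Z p)
    then show ?case
      using local_three_formD(2)[OF T 2(1) ef[OF 2(1,3)] ef[OF 2(1,4)] ef[OF 2(1,5)] 2(2)] by simp
  next
    case (3 U X Y Z p)
    then show ?case
      using local_three_formD(3)[OF T 3(1) ef[OF 3(1,3)] ef[OF 3(1,4)] ef[OF 3(1,5)] 3(2)] by simp
  next
    case (4 U X Y Z W p)
    then show ?case
      using local_three_formD(4)[OF T 4(1) ef[OF 4(1,3)] ef[OF 4(1,4)] ef[OF 4(1,5)] 4(2) ef[OF 4(1,6)]]
      by (simp add: linear_add[OF lin])
  next
    case (5 U X Y Z f p)
    then show ?case
      using local_three_formD(5)[OF T 5(1) ef[OF 5(1,3)] ef[OF 5(1,4)] ef[OF 5(1,5)] 5(2) 5(6)]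
      by (simp add: linear_scale[OF lin])
  qed
qed

end

section \<open>Metric connections with prescribed torsion\<close>

context riemannian_manifold
begin

text \<open>The right-hand side of the Koszul formula: for the Levi-Civita connection this is
  \<open>2 g(\<nabla>\<^bsub>X\<^esub> Y, Z)\<close>.\<close>

definition koszul :: "('m \<Rightarrow> 'e) \<Rightarrow> ('m \<Rightarrow> 'e) \<Rightarrow> ('m \<Rightarrow> 'e) \<Rightarrow> 'm \<Rightarrow> real" where
  "koszul X Y Z p =
     vf_deriv A X (\<lambda>q. g q (Y q) (Z q)) p + vf_deriv A Y (\<lambda>q. g q (X q) (Z q)) p
     - vf_deriv A Z (\<lambda>q. g q (X q) (Y q)) p
     + g p (lie_bracket A X Y p) (Z p) - g p (lie_bracket A X Z p) (Y p)
     - g p (lie_bracket A Y Z p) (X p)"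

lemma koszul_fun:
  "open U \<Longrightarrow> X \<in> fields_on A U \<Longrightarrow> Y \<in> fields_on A U \<Longrightarrow> Z \<in> fields_on A U \<Longrightarrow>
    koszul X Y Z \<in> funs_on A U"
  unfolding koszul_def[abs_def] by (intro fun_add fun_diff vf_deriv_fun g_fun lie_bracket_field)

text \<open>The derivatives of \<open>f\<close> cancel, except that multiplying \<open>Y\<close> leaves exactly the term that the
  Leibniz rule of a connection requires.\<close>

lemma koszul_rules:
  assumes U: "open U" "p \<in> U" and F: "X \<in> fields_on A U" "Y \<in> fields_on A U" "Z \<in> fields_on A U"
  shows koszul_add_left: "X' \<in> fields_on A U \<Longrightarrow>
      koszul (\<lambda>q. X q + X' q) Y Z p = koszul X Y Z p + koszul X' Y Z p"
    and koszul_add_middle: "Y' \<in> fields_on A U \<Longrightarrow>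
      koszul X (\<lambda>q. Y q + Y' q) Z p = koszul X Y Z p + koszul X Y' Z p"
    and koszul_add_right: "Z' \<in> fields_on A U \<Longrightarrow>
      koszul X Y (\<lambda>q. Z q + Z' q) p = koszul X Y Z p + koszul X Y Z' p"
    and koszul_scale_left: "f \<in> funs_on A U \<Longrightarrow>
      koszul (\<lambda>q. f q *\<^sub>R X q) Y Z p = f p * koszul X Y Z p"
    and koszul_scale_middle: "f \<in> funs_on A U \<Longrightarrow>
      koszul X (\<lambda>q. f q *\<^sub>R Y q) Z p = f p * koszul X Y Z p + 2 * vf_deriv A X f p * g p (Y p) (Z p)"
    and koszul_scale_right: "f \<in> funs_on A U \<Longrightarrow>
      koszul X Y (\<lambda>q. f q *\<^sub>R Z q) p = f p * koszul X Y Z p"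
proof -
  note rules = koszul_def g_simps lie_bracket_add_right[OF U] lie_bracket_add_left[OF U]
    lie_bracket_scale_right[OF U] lie_bracket_scale_left[OF U]
    vf_deriv_add[OF U] vf_deriv_mult[OF U] vf_deriv_field_add[OF U] vf_deriv_field_scale[OF U]
    g_fun[OF U(1)] F
  show "koszul (\<lambda>q. X q + X' q) Y Z p = koszul X Y Z p + koszul X' Y Z p" if "X' \<in> fields_on A U"
    using that by (simp add: rules)
  show "koszul X (\<lambda>q. Y q + Y' q) Z p = koszul X Y Z p + koszul X Y' Z p" if "Y' \<in> fields_on A U"
    using that by (simp add: rules)
  show "koszul X Y (\<lambda>q. Z q + Z' q) p = koszul X Y Z p + koszul X Y Z' p" if "Z' \<in> fields_on A U"
    using that by (simp add: rules)
  show "koszul (\<lambda>q. f q *\<^sub>R X q) Y Z p = f p * koszul X Y Z p" if "f \<in> funs_on A U"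
    using that by (simp add: rules g_sym[of p "X p"] algebra_simps)
  show "koszul X (\<lambda>q. f q *\<^sub>R Y q) Z p = f p * koszul X Y Z p + 2 * vf_deriv A X f p * g p (Y p) (Z p)"
    if "f \<in> funs_on A U"
    using that by (simp add: rules g_sym[of p "X p"] algebra_simps)
  show "koszul X Y (\<lambda>q. f q *\<^sub>R Z q) p = f p * koszul X Y Z p" if "f \<in> funs_on A U"
    using that by (simp add: rules g_sym[of p "Z p"] algebra_simps)
qed

definition metric_connection :: "(('m \<Rightarrow> 'e) \<Rightarrow> ('m \<Rightarrow> 'e) \<Rightarrow> 'm \<Rightarrow> 'e) \<Rightarrow> bool" where
  "metric_connection D \<longleftrightarrow> D \<in> affine_connections A \<and>
     (\<forall>X\<in>vector_fields A. \<forall>Y\<in>vector_fields A. \<forall>Z\<in>vector_fields A. \<forall>p.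
        vf_deriv A X (\<lambda>q. g q (Y q) (Z q)) p = g p (D X Y p) (Z p) + g p (Y p) (D X Z p))"

lemma connection_field:
  "D \<in> affine_connections A \<Longrightarrow> X \<in> vector_fields A \<Longrightarrow> Y \<in> vector_fields A \<Longrightarrow> D X Y \<in> vector_fields A"
  by (auto simp: affine_connections_def PiE_iff)

text \<open>Expanding the three derivatives of the metric in \<open>koszul\<close> by \<open>\<nabla>g = 0\<close> leaves
  \<open>2 g(\<nabla>\<^bsub>X\<^esub> Y, Z)\<close> and three torsion terms, of which skew symmetry makes two cancel.\<close>

lemma metric_connection_koszul:
  assumes D: "metric_connection D" and T: "has_skew_torsion A g D"
    and F: "X \<in> vector_fields A" "Y \<in> vector_fields A" "Z \<in> vector_fields A"
  shows "2 * g p (D X Y p) (Z p) = koszul X Y Z p + torsion_form A g D X Y Z p"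
proof -
  have met: "vf_deriv A X (\<lambda>q. g q (Y q) (Z q)) p = g p (D X Y p) (Z p) + g p (D X Z p) (Y p)"
    if "X \<in> vector_fields A" "Y \<in> vector_fields A" "Z \<in> vector_fields A" for X Y Z
    using D that g_sym[of p "Y p"] by (simp add: metric_connection_def)
  have skew: "torsion_form A g D X Y Z p = - torsion_form A g D X Z Y p"
    "torsion_form A g D X Z Y p = - torsion_form A g D Z X Y p"
    "torsion_form A g D Y Z X p = - torsion_form A g D Y X Z p"
    "torsion_form A g D X Y Z p = - torsion_form A g D Y X Z p"
    using T F unfolding has_skew_torsion_def is_three_form_def by blast+
  have tor: "torsion_form A g D X Y Z p =
      g p (D X Y p) (Z p) - g p (D Y X p) (Z p) - g p (lie_bracket A X Y p) (Z p)" for X Y Z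
    by (simp add: torsion_form_def torsion_def g_simps)
  have br: "g p (lie_bracket A X Y p) w = - g p (lie_bracket A Y X p) w" for X Y w
    by (subst lie_bracket_skew) (simp add: g_simps)
  show ?thesis
    using skew br[of Y X "Z p"] br[of Z X "Y p"] br[of Z Y "X p"]
    unfolding koszul_def met[OF F] met[OF F(2,1,3)] met[OF F(3,1,2)] tor by linarith
qed

text \<open>The Koszul formula recovers the connection from its torsion form.\<close>

lemma metric_connection_unique:
  assumes D: "metric_connection D" "has_skew_torsion A g D"
    and D': "metric_connection D'" "has_skew_torsion A g D'"
    and eq: "\<And>X Y Z p. X \<in> vector_fields A \<Longrightarrow> Y \<in> vector_fields A \<Longrightarrow> Z \<in> vector_fields A \<Longrightarrow>
      torsion_form A g D X Y Z p = torsion_form A g D' X Y Z p"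
  shows "D = D'"
proof -
  have aff: "D \<in> affine_connections A" "D' \<in> affine_connections A"
    using D D' by (simp_all add: metric_connection_def)
  have "D X Y p = D' X Y p" if "X \<in> vector_fields A" "Y \<in> vector_fields A" for X Y p
  proof (rule field_eqI)
    show "D X Y \<in> vector_fields A" "D' X Y \<in> vector_fields A"
      using connection_field[OF aff(1) that] connection_field[OF aff(2) that] .
    fix Z assume Z: "Z \<in> vector_fields A"
    show "g p (D X Y p) (Z p) = g p (D' X Y p) (Z p)"
      using metric_connection_koszul[OF D that Z, of p] metric_connection_koszul[OF D' that Z, of p]
        eq[OF that Z, of p] by linarith
  qed
  then have XY: "D X Y = D' X Y" if "X \<in> vector_fields A" "Y \<in> vector_fields A" for X Y
    using that by blast
  have PiE: "D \<in> vector_fields A \<rightarrow>\<^sub>E (vector_fields A \<rightarrow>\<^sub>E vector_fields A)"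
    "D' \<in> vector_fields A \<rightarrow>\<^sub>E (vector_fields A \<rightarrow>\<^sub>E vector_fields A)"
    using aff by (simp_all add: affine_connections_def)
  show ?thesis
    by (rule PiE_ext[OF PiE], rule PiE_ext[OF PiE_mem[OF PiE(1)] PiE_mem[OF PiE(2)]])
      (auto intro: XY)
qed

text \<open>Read backwards, the Koszul formula defines a connection: its right-hand side, corrected by
  \<open>T\<close>, is linear over the functions in \<open>Z\<close>, so \<open>riesz_field\<close> represents it by a field, and the
  axioms of a connection follow from \<open>koszul_rules\<close> by testing against fields.\<close>

lemma metric_connection_exists:
  assumes T: "local_three_form A T"
  shows "\<exists>D. metric_connection D \<and> (\<forall>X\<in>vector_fields A. \<forall>Y\<in>vector_fields A. \<forall>Z\<in>vector_fields A. \<forall>p.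
    torsion_form A g D X Y Z p = T X Y Z p)"
proof -
  let ?V = "vector_fields A"
  note UV = fields_on_UNIV funs_on_UNIV
  note T1 = local_three_formD[OF T open_UNIV, unfolded UV, simplified]
  note K1 = koszul_rules[OF open_UNIV UNIV_I, unfolded UV]
  have mono: "X \<in> fields_on A U" if "X \<in> ?V" for X U
    using that fields_on_mono[of X A UNIV U] by (simp add: UV)
  have "\<forall>X\<in>?V. \<forall>Y\<in>?V. \<exists>W\<in>?V. \<forall>Z\<in>?V. \<forall>p. g p (W p) (Z p) = (koszul X Y Z p + T X Y Z p) * (1 / 2)"
  proof (intro ballI)
    fix X Y assume XY: "X \<in> ?V" "Y \<in> ?V"
    note mXY = mono[OF XY(1)] mono[OF XY(2)]
    show "\<exists>W\<in>?V. \<forall>Z\<in>?V. \<forall>p. g p (W p) (Z p) = (koszul X Y Z p + T X Y Z p) * (1 / 2)"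
    proof (rule riesz_field, goal_cases)
      case (1 U Z)
      then show ?case
        by (intro fun_mult fun_const fun_add koszul_fun local_three_formD(1)[OF T] mXY)
    next
      case (2 U Z Z' p)
      show ?case
        using koszul_add_right[OF 2(1,2) mXY 2(3,4)] local_three_formD(4)[OF T 2(1) mXY 2(3,2,4)]
        by (simp add: field_simps)
    next
      case (3 U f Z p)
      show ?case
        using koszul_scale_right[OF 3(1,2) mXY 3(4,3)] local_three_formD(5)[OF T 3(1) mXY 3(4,2,3)]
        by (simp add: algebra_simps)
    qed
  qed
  note ex = this
  define W where "W X Y = (SOME W. W \<in> ?V \<and> (\<forall>Z\<in>?V. \<forall>p.
    g p (W p) (Z p) = (koszul X Y Z p + T X Y Z p) * (1 / 2)))" for X Y
  have W_spec: "W X Y \<in> ?V \<and> (\<forall>Z\<in>?V. \<forall>p.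
      g p (W X Y p) (Z p) = (koszul X Y Z p + T X Y Z p) * (1 / 2))" if "X \<in> ?V" "Y \<in> ?V" for X Y
    using someI_ex[OF bspec[OF bspec[OF ex that(1)] that(2), unfolded Bex_def]] unfolding W_def .
  have W: "W X Y \<in> ?V" if "X \<in> ?V" "Y \<in> ?V" for X Y
    using W_spec[OF that] by (rule conjunct1)
  have gW: "g p (W X Y p) (Z p) = (koszul X Y Z p + T X Y Z p) * (1 / 2)"
    if "X \<in> ?V" "Y \<in> ?V" "Z \<in> ?V" for X Y Z p
    by (rule spec[OF bspec[OF conjunct2[OF W_spec[OF that(1,2)]] that(3)]])
  have gW2: "2 * g p (W X Y p) (Z p) = koszul X Y Z p + T X Y Z p"
    if "X \<in> ?V" "Y \<in> ?V" "Z \<in> ?V" for X Y Z p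
    using gW[OF that, of p] by simp
  define D where "D = (\<lambda>X\<in>?V. \<lambda>Y\<in>?V. W X Y)"
  have DW: "D X Y = W X Y" if "X \<in> ?V" "Y \<in> ?V" for X Y using that by (simp add: D_def)
  have add: "(\<lambda>q. X q + Y q) \<in> ?V" if "X \<in> ?V" "Y \<in> ?V" for X Y
    using field_add[of UNIV X Y] that by (simp add: UV)
  have scale: "(\<lambda>q. f q *\<^sub>R X q) \<in> ?V" if "f \<in> smooth_functions A" "X \<in> ?V" for f X
    using field_scale[of UNIV f X] that by (simp add: UV)
  have derf: "vf_deriv A X f \<in> smooth_functions A" if "f \<in> smooth_functions A" "X \<in> ?V" for f X
    using vf_deriv_fun[of UNIV X f] that by (simp add: UV)
  have T_add: "T (\<lambda>q. X q + X' q) Y Z p = T X Y Z p + T X' Y Z p"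
    "T Y (\<lambda>q. X q + X' q) Z p = T Y X Z p + T Y X' Z p"
    if "X \<in> ?V" "X' \<in> ?V" "Y \<in> ?V" "Z \<in> ?V" for X X' Y Z p
  proof -
    have e: "T Y (\<lambda>q. X q + X' q) Z p = T Y X Z p + T Y X' Z p"
      using T1(4)[OF that(3,4,1,2), of p] T1(3)[OF that(3) add[OF that(1,2)] that(4), of p]
        T1(3)[OF that(3,1,4), of p] T1(3)[OF that(3,2,4), of p] by linarith
    then show "T Y (\<lambda>q. X q + X' q) Z p = T Y X Z p + T Y X' Z p" .
    show "T (\<lambda>q. X q + X' q) Y Z p = T X Y Z p + T X' Y Z p"
      using e T1(2)[OF add[OF that(1,2)] that(3,4), of p] T1(2)[OF that(1,3,4), of p]
        T1(2)[OF that(2,3,4), of p] by linarith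
  qed
  have T_scale: "T (\<lambda>q. f q *\<^sub>R X q) Y Z p = f p * T X Y Z p"
    "T Y (\<lambda>q. f q *\<^sub>R X q) Z p = f p * T Y X Z p"
    if "f \<in> smooth_functions A" "X \<in> ?V" "Y \<in> ?V" "Z \<in> ?V" for f X Y Z p
  proof -
    have e: "T Y (\<lambda>q. f q *\<^sub>R X q) Z p = f p * T Y X Z p"
      if "f \<in> smooth_functions A" "X \<in> ?V" "Y \<in> ?V" "Z \<in> ?V" for f X Y Z
      using T1(5)[OF that(3,4,2), of f p] T1(3)[OF that(3) scale[OF that(1,2)] that(4), of p]
        T1(3)[OF that(3,2,4), of p] that by simp
    then show "T Y (\<lambda>q. f q *\<^sub>R X q) Z p = f p * T Y X Z p" using that by blast
    show "T (\<lambda>q. f q *\<^sub>R X q) Y Z p = f p * T X Y Z p"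
      using e[OF that] T1(2)[OF scale[OF that(1,2)] that(3,4), of p] T1(2)[OF that(2,3,4), of p] by simp
  qed
  have br: "g p (lie_bracket A X Y p) w = - g p (lie_bracket A Y X p) w" for X Y p w
    by (subst lie_bracket_skew) (simp add: g_simps)
  have aff: "D \<in> affine_connections A"
    unfolding affine_connections_def
  proof (intro CollectI conjI ballI allI)
    show "D \<in> ?V \<rightarrow>\<^sub>E (?V \<rightarrow>\<^sub>E ?V)" by (auto simp: D_def W)
    fix X Y assume XY: "X \<in> ?V" "Y \<in> ?V"
    {
      fix Z p assume Z: "Z \<in> ?V"
      have "W (\<lambda>q. X q + Y q) Z p = (\<lambda>q. W X Z q + W Y Z q) p"
        by (rule field_eqI)
          (use XY Z in \<open>auto intro!: add W simp: gW g_simps K1 T_add add algebra_simps\<close>)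
      then show "D (\<lambda>q. X q + Y q) Z p = D X Z p + D Y Z p"
        using XY Z add by (simp add: DW)
      have "W X (\<lambda>q. Y q + Z q) p = (\<lambda>q. W X Y q + W X Z q) p"
        by (rule field_eqI)
          (use XY Z in \<open>auto intro!: add W simp: gW g_simps K1 T_add add algebra_simps\<close>)
      then show "D X (\<lambda>q. Y q + Z q) p = D X Y p + D X Z p"
        using XY Z add by (simp add: DW)
    }
    fix f p assume f: "f \<in> smooth_functions A"
    have "W (\<lambda>q. f q *\<^sub>R X q) Y p = (\<lambda>q. f q *\<^sub>R W X Y q) p"
      by (rule field_eqI)
        (use XY f in \<open>auto intro!: add scale W simp: gW g_simps K1 T_scale scale algebra_simps\<close>)
    then show "D (\<lambda>q. f q *\<^sub>R X q) Y p = f p *\<^sub>R D X Y p"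
      using XY f scale by (simp add: DW)
    have "W X (\<lambda>q. f q *\<^sub>R Y q) p = (\<lambda>q. vf_deriv A X f q *\<^sub>R Y q + f q *\<^sub>R W X Y q) p"
      by (rule field_eqI)
        (use XY f in \<open>auto intro!: add scale W derf simp: gW g_simps K1 T_scale scale algebra_simps\<close>)
    then show "D X (\<lambda>q. f q *\<^sub>R Y q) p = vf_deriv A X f p *\<^sub>R Y p + f p *\<^sub>R D X Y p"
      using XY f scale by (simp add: DW)
  qed
  have "metric_connection D"
    unfolding metric_connection_def
  proof (intro conjI aff ballI allI)
    fix X Y Z p assume F: "X \<in> ?V" "Y \<in> ?V" "Z \<in> ?V"
    have s: "(\<lambda>q. g q (Z q) (Y q)) = (\<lambda>q. g q (Y q) (Z q))" using g_sym by blast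
    show "vf_deriv A X (\<lambda>q. g q (Y q) (Z q)) p = g p (D X Y p) (Z p) + g p (Y p) (D X Z p)"
      using gW2[OF F, of p] gW2[OF F(1,3,2), of p] T1(3)[OF F, of p] br[of p Y Z "X p"]
      unfolding g_sym[of p "Y p" "W X Z p"] koszul_def s DW[OF F(1,2)] DW[OF F(1,3)] by linarith
  qed
  moreover have "torsion_form A g D X Y Z p = T X Y Z p"
    if F: "X \<in> ?V" "Y \<in> ?V" "Z \<in> ?V" for X Y Z p
  proof -
    have s: "(\<lambda>q. g q (Y q) (X q)) = (\<lambda>q. g q (X q) (Y q))" using g_sym by blast
    show ?thesis
      using gW2[OF F, of p] gW2[OF F(2,1,3), of p] T1(2)[OF F, of p] br[of p Y X "Z p"]
      unfolding torsion_form_def torsion_def g_simps DW[OF F(1,2)] DW[OF F(2,1)] koszul_def s by linarith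
  qed
  ultimately show ?thesis by blast
qed

end

section \<open>Normal metric f-structures\<close>

sublocale metric_f_manifold \<subseteq> riemannian_manifold A g
  by unfold_locales (rule metric)

context metric_f_manifold
begin

abbreviation Phi :: "('m \<Rightarrow> 'e) \<Rightarrow> 'm \<Rightarrow> 'e" where
  "Phi X \<equiv> \<lambda>q. \<phi> q (X q)"

definition phi_torsion :: "('m \<Rightarrow> 'e) \<Rightarrow> ('m \<Rightarrow> 'e) \<Rightarrow> ('m \<Rightarrow> 'e) \<Rightarrow> 'm \<Rightarrow> real" where
  "phi_torsion X Y Z p =
     (\<Sum>i\<in>{1..s}. wedge_one_two (\<eta> i) (d_one A (\<eta> i)) X Y Z p) + d_phi_F A \<phi> g X Y Z p"

lemma phi_linear: "linear (\<phi> p)"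
  using phi_field by (simp add: endo_fields_def)

lemma eta_linear: "i \<in> {1..s} \<Longrightarrow> linear (\<eta> i p)"
  using eta_form by (simp add: one_forms_def)

lemma Phi_field: "X \<in> vector_fields A \<Longrightarrow> Phi X \<in> vector_fields A"
  using endo_field[OF open_UNIV phi_field, of X] by (simp add: fields_on_UNIV)

lemma phi_xi: "i \<in> {1..s} \<Longrightarrow> \<phi> p (\<xi> i p) = 0"
  using ker_phi[of p] span_base[of "\<xi> i p" "(\<lambda>i. \<xi> i p) ` {1..s}"] by blast

text \<open>Compatibility of the metric with \<open>\<phi> (\<xi> i) = 0\<close>: the form \<open>\<eta> i\<close> is metrically dual to \<open>\<xi> i\<close>.\<close>

lemma g_xi:
  assumes i: "i \<in> {1..s}"
  shows "g p u (\<xi> i p) = \<eta> i p u"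
proof -
  have e: "\<eta> j p u * \<eta> j p (\<xi> i p) = (if j = i then \<eta> i p u else 0)" if "j \<in> {1..s}" for j
    using eta_xi[OF that i, of p] by simp
  have "(\<Sum>j\<in>{1..s}. \<eta> j p u * \<eta> j p (\<xi> i p)) = (\<Sum>j\<in>{1..s}. if j = i then \<eta> i p u else 0)"
    by (rule sum.cong[OF refl e])
  then show ?thesis
    using metric_compat[of p u "\<xi> i p"] i by (simp add: phi_xi g_simps)
qed

lemma g_phi_phi: "g p u (\<phi> p (\<phi> p v)) = - g p u v + (\<Sum>i\<in>{1..s}. \<eta> i p v * g p u (\<xi> i p))"
  by (simp add: phi_square g_simps g_sum_right)

lemma g_phi_skew: "g p (\<phi> p u) v = - g p u (\<phi> p v)"
proof -
  have "g p (\<phi> p u) (\<phi> p (\<phi> p v)) = g p u (\<phi> p v)"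
    using metric_compat[of p u "\<phi> p v"] by (simp add: eta_phi)
  then show ?thesis
    by (simp add: g_phi_phi g_xi eta_phi)
qed

lemma fundamental_three_form: "local_three_form A (d_two A (fundamental_form \<phi> g))"
proof (rule d_two_three_form)
  show "bilinear (fundamental_form \<phi> g q)" for q
    unfolding bilinear_def fundamental_form_def
    by (intro conjI allI linearI)
      (simp_all add: g_simps linear_add[OF phi_linear] linear_scale[OF phi_linear])
  show "fundamental_form \<phi> g q u v = - fundamental_form \<phi> g q v u" for q u v
    unfolding fundamental_form_def using g_phi_skew[of q v u] g_sym[of q u "\<phi> q v"] by linarith
  show "(\<lambda>q. fundamental_form \<phi> g q (X q) (Y q)) \<in> funs_on A U"
    if "open U" "X \<in> fields_on A U" "Y \<in> fields_on A U" for U X Y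
    unfolding fundamental_form_def by (rule g_fun[OF that(1,2) endo_field[OF that(1) phi_field that(3)]])
qed

lemma phi_torsion_three_form: "local_three_form A phi_torsion"
proof -
  have "local_three_form A (d_phi_F A \<phi> g)"
    using neg_pullback_three_form[OF fundamental_three_form phi_field]
    by (simp add: d_phi_F_def[abs_def])
  then show ?thesis
    unfolding phi_torsion_def[abs_def]
    by (intro three_form_add three_form_sum wedge_d_one_three_form eta_form) auto
qed

lemma d_one_zero:
  assumes "i \<in> {1..s}" "X \<in> vector_fields A"
  shows "d_one A (\<eta> i) X (\<lambda>q. 0) p = 0"
  using d_one_scale_right[OF open_UNIV UNIV_I eta_form[OF assms(1)] fun_const[of 0], of X X p] assms(2)
  by (simp add: fields_on_UNIV)

text \<open>Apply \<open>\<eta> i\<close> to the equation \<open>N = 0\<close>. As \<open>\<eta> i\<close> annihilates the image of \<open>\<phi>\<close>, only the bracket of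
  \<open>Phi X\<close> and \<open>Phi Y\<close> and the term with \<open>d\<eta>\<close> survive, and \<open>\<eta> i\<close> of that bracket is minus the
  left-hand side.\<close>

lemma normal_d_eta_phi:
  assumes N: "normal_f_structure A s \<phi> \<xi> \<eta>" and i: "i \<in> {1..s}"
    and X: "X \<in> vector_fields A" and Y: "Y \<in> vector_fields A"
  shows "d_one A (\<eta> i) (Phi X) (Phi Y) p = d_one A (\<eta> i) X Y p"
proof -
  note lin = eta_linear[OF i, of p]
  have e: "d_one A (\<eta> j) X Y p * \<eta> i p (\<xi> j p) = (if j = i then d_one A (\<eta> i) X Y p else 0)"
    if "j \<in> {1..s}" for j
    using eta_xi[OF i that, of p] by simp
  have "(\<Sum>j\<in>{1..s}. d_one A (\<eta> j) X Y p * \<eta> i p (\<xi> j p)) =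
      (\<Sum>j\<in>{1..s}. if j = i then d_one A (\<eta> i) X Y p else 0)"
    by (rule sum.cong[OF refl e])
  also have "\<dots> = d_one A (\<eta> i) X Y p" using i by simp
  finally have "\<eta> i p (nijenhuis_one A s \<phi> \<xi> \<eta> X Y p) =
      \<eta> i p (lie_bracket A (Phi X) (Phi Y) p) + d_one A (\<eta> i) X Y p"
    by (simp add: nijenhuis_one_def nijenhuis_phi_def linear_add[OF lin] linear_diff[OF lin]
        linear_sum[OF lin] linear_scale[OF lin] eta_phi[OF i])
  moreover have "nijenhuis_one A s \<phi> \<xi> \<eta> X Y p = 0"
    using N X Y by (simp add: normal_f_structure_def)
  ultimately show ?thesis
    by (simp add: d_one_def eta_phi[OF i] vf_deriv_const linear_0[OF lin])
qed

text \<open>The case \<open>Y = \<xi> j\<close> of the preceding lemma, where \<open>Phi Y = 0\<close>.\<close>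

lemma normal_d_eta_xi:
  assumes N: "normal_f_structure A s \<phi> \<xi> \<eta>" and i: "i \<in> {1..s}" and j: "j \<in> {1..s}"
    and X: "X \<in> vector_fields A"
  shows "d_one A (\<eta> i) X (\<xi> j) p = 0" "d_one A (\<eta> i) (\<xi> j) X p = 0"
proof -
  show "d_one A (\<eta> i) X (\<xi> j) p = 0"
    using normal_d_eta_phi[OF N i X xi_field[OF j], of p] d_one_zero[OF i Phi_field[OF X], of p]
    by (simp add: phi_xi[OF j])
  then show "d_one A (\<eta> i) (\<xi> j) X p = 0"
    using d_one_skew[OF eta_form[OF i], of "\<xi> j" X p] by simp
qed

text \<open>Only the summand \<open>i\<close> of the wedge products contributes, since the forms \<open>d\<eta>\<close> annihilate the
  characteristic fields, and \<open>d_phi_F\<close> vanishes because \<open>\<phi>\<close> annihilates them.\<close>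

lemma phi_torsion_xi:
  assumes N: "normal_f_structure A s \<phi> \<xi> \<eta>" and i: "i \<in> {1..s}"
    and X: "X \<in> vector_fields A" and Z: "Z \<in> vector_fields A"
  shows "phi_torsion X (\<xi> i) Z p = - d_one A (\<eta> i) X Z p"
proof -
  have w: "wedge_one_two (\<eta> j) (d_one A (\<eta> j)) X (\<xi> i) Z p =
      (if j = i then - d_one A (\<eta> i) X Z p else 0)" if j: "j \<in> {1..s}" for j
    using normal_d_eta_xi[OF N j i X, of p] normal_d_eta_xi[OF N j i Z, of p] eta_xi[OF j i, of p]
    by (simp add: wedge_one_two_def)
  have "(\<Sum>j\<in>{1..s}. wedge_one_two (\<eta> j) (d_one A (\<eta> j)) X (\<xi> i) Z p) =
      (\<Sum>j\<in>{1..s}. if j = i then - d_one A (\<eta> i) X Z p else 0)"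
    by (rule sum.cong[OF refl w])
  moreover have "d_phi_F A \<phi> g X (\<xi> i) Z p = 0"
  proof -
    have F: "Phi X \<in> fields_on A UNIV" "Phi Z \<in> fields_on A UNIV"
      unfolding fields_on_UNIV by (intro Phi_field X Z)+
    have "d_two A (fundamental_form \<phi> g) (Phi X) (\<lambda>q. 0) (Phi Z) p = 0"
      using local_three_formD(3)[OF fundamental_three_form open_UNIV F(1) field_zero F(2) UNIV_I, of p]
        three_form_zero_right[OF fundamental_three_form open_UNIV UNIV_I F, of p] by linarith
    then show ?thesis by (simp add: d_phi_F_def phi_xi[OF i])
  qed
  ultimately show ?thesis using i by (simp add: phi_torsion_def)
qed

end

section \<open>Connections with parallel characteristic fields\<close>

text \<open>The common ground of both directions of the theorem: everything that is required of the
  connection except that \<open>\<phi>\<close> is parallel.\<close>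

locale xi_parallel_connection = metric_f_manifold A n s \<phi> \<xi> \<eta> g
  for A :: "('m::{t2_space,second_countable_topology}, 'e::euclidean_space) chart set"
    and n s \<phi> \<xi> \<eta> g +
  fixes D :: "('m \<Rightarrow> 'e) \<Rightarrow> ('m \<Rightarrow> 'e) \<Rightarrow> 'm \<Rightarrow> 'e"
  assumes normal: "normal_f_structure A s \<phi> \<xi> \<eta>"
    and connection: "metric_connection D"
    and skew_torsion: "has_skew_torsion A g D"
    and xi_parallel: "i \<in> {1..s} \<Longrightarrow> X \<in> vector_fields A \<Longrightarrow> D X (\<xi> i) p = 0"
begin

abbreviation "V \<equiv> vector_fields A"
abbreviation "T \<equiv> torsion_form A g D"

text \<open>The covariant derivative \<open>(\<nabla>\<^bsub>X\<^esub> \<phi>) Y\<close>, and below the same tensor paired with \<open>Z\<close>.\<close>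

definition phi_deriv :: "('m \<Rightarrow> 'e) \<Rightarrow> ('m \<Rightarrow> 'e) \<Rightarrow> 'm \<Rightarrow> 'e" where
  "phi_deriv X Y p = D X (Phi Y) p - \<phi> p (D X Y p)"

definition phi_deriv_form :: "('m \<Rightarrow> 'e) \<Rightarrow> ('m \<Rightarrow> 'e) \<Rightarrow> ('m \<Rightarrow> 'e) \<Rightarrow> 'm \<Rightarrow> real" where
  "phi_deriv_form X Y Z p = g p (phi_deriv X Y p) (Z p)"

lemma affine: "D \<in> affine_connections A"
  using connection by (simp add: metric_connection_def)

lemma D_field: "X \<in> V \<Longrightarrow> Y \<in> V \<Longrightarrow> D X Y \<in> V"
  using connection_field[OF affine] .

lemma D_metric: "X \<in> V \<Longrightarrow> Y \<in> V \<Longrightarrow> Z \<in> V \<Longrightarrow>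
    vf_deriv A X (\<lambda>q. g q (Y q) (Z q)) p = g p (D X Y p) (Z p) + g p (D X Z p) (Y p)"
  using connection g_sym[of p "Y p"] by (simp add: metric_connection_def)

lemma torsion_skew:
  assumes "X \<in> V" "Y \<in> V" "Z \<in> V"
  shows "T X Y Z p = - T Y X Z p" "T X Y Z p = - T X Z Y p"
  using skew_torsion assms unfolding has_skew_torsion_def is_three_form_def by blast+

lemma torsion_expand:
  "T X Y Z p = g p (D X Y p) (Z p) - g p (D Y X p) (Z p) - g p (lie_bracket A X Y p) (Z p)"
  by (simp add: torsion_form_def torsion_def g_simps)

lemma g_bracket_skew: "g p (lie_bracket A X Y p) w = - g p (lie_bracket A Y X p) w"
  by (subst lie_bracket_skew) (simp add: g_simps)

lemma eta_parallel:
  assumes "i \<in> {1..s}" "X \<in> V" "Y \<in> V"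
  shows "vf_deriv A X (\<lambda>q. \<eta> i q (Y q)) p = \<eta> i p (D X Y p)"
  using D_metric[OF assms(2,3) xi_field[OF assms(1)], of p] xi_parallel[OF assms(1,2), of p]
  by (simp add: g_xi[OF assms(1)] g_simps)

lemma eta_torsion:
  assumes i: "i \<in> {1..s}" and XY: "X \<in> V" "Y \<in> V"
  shows "\<eta> i p (torsion A D X Y p) = d_one A (\<eta> i) X Y p"
  using eta_parallel[OF i XY, of p] eta_parallel[OF i XY(2,1), of p]
  by (simp add: torsion_def d_one_def linear_diff[OF eta_linear[OF i]])

lemma eta_phi_deriv:
  assumes i: "i \<in> {1..s}" and XY: "X \<in> V" "Y \<in> V"
  shows "\<eta> i p (phi_deriv X Y p) = 0"
  using eta_parallel[OF i XY(1) Phi_field[OF XY(2)], of p]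
  by (simp add: phi_deriv_def linear_diff[OF eta_linear[OF i]] eta_phi[OF i] vf_deriv_const)

lemma D_add: "X \<in> V \<Longrightarrow> Y \<in> V \<Longrightarrow> Z \<in> V \<Longrightarrow> D X (\<lambda>q. Y q + Z q) p = D X Y p + D X Z p"
  using affine by (simp add: affine_connections_def)

lemma D_scale: "f \<in> smooth_functions A \<Longrightarrow> X \<in> V \<Longrightarrow> Y \<in> V \<Longrightarrow>
    D X (\<lambda>q. f q *\<^sub>R Y q) p = vf_deriv A X f p *\<^sub>R Y p + f p *\<^sub>R D X Y p"
  using affine by (simp add: affine_connections_def)

lemma D_zero: "X \<in> V \<Longrightarrow> D X (\<lambda>q. 0) p = 0"
  using D_scale[of "\<lambda>q. 0" X X p] fun_const[of 0 UNIV] by (simp add: funs_on_UNIV vf_deriv_const)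

lemma D_sum_xi:
  assumes X: "X \<in> V" and Y: "Y \<in> V" and I: "I \<subseteq> {1..s}"
  shows "D X (\<lambda>q. \<Sum>i\<in>I. \<eta> i q (Y q) *\<^sub>R \<xi> i q) p = (\<Sum>i\<in>I. \<eta> i p (D X Y p) *\<^sub>R \<xi> i p)"
  using finite_subset[OF I finite_atLeastAtMost] I
proof (induction I)
  case empty
  then show ?case using D_zero[OF X] by simp
next
  case (insert i I)
  have i: "i \<in> {1..s}" using insert.prems by simp
  have f: "(\<lambda>q. \<eta> i q (Y q)) \<in> smooth_functions A"
    using one_form_fun[OF open_UNIV eta_form[OF i], of Y] Y by (simp add: fields_on_UNIV funs_on_UNIV)
  have sc: "(\<lambda>q. \<eta> j q (Y q) *\<^sub>R \<xi> j q) \<in> fields_on A UNIV" if "j \<in> {1..s}" for j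
    by (rule field_scale[OF open_UNIV one_form_fun[OF open_UNIV eta_form[OF that]]])
      (simp_all add: fields_on_UNIV Y xi_field[OF that])
  have "(\<lambda>q. \<Sum>j\<in>I. \<eta> j q (Y q) *\<^sub>R \<xi> j q) \<in> V"
    unfolding fields_on_UNIV[symmetric]
    by (rule field_sum[OF open_UNIV], rule sc) (use insert.prems in blast)
  then have "D X (\<lambda>q. \<eta> i q (Y q) *\<^sub>R \<xi> i q + (\<Sum>j\<in>I. \<eta> j q (Y q) *\<^sub>R \<xi> j q)) p =
      D X (\<lambda>q. \<eta> i q (Y q) *\<^sub>R \<xi> i q) p + D X (\<lambda>q. \<Sum>j\<in>I. \<eta> j q (Y q) *\<^sub>R \<xi> j q) p"
    using sc[OF i] by (intro D_add X) (auto simp: fields_on_UNIV)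
  then show ?case
    using insert D_scale[OF f X xi_field[OF i], of p] eta_parallel[OF i X Y, of p] xi_parallel[OF i X, of p]
    by simp
qed

text \<open>Differentiate \<open>\<phi>\<^sup>2 = -Id + \<Sum> \<eta> i \<otimes> \<xi> i\<close>: the right-hand side is parallel.\<close>

lemma phi_deriv_phi:
  assumes X: "X \<in> V" and Y: "Y \<in> V"
  shows "phi_deriv X (Phi Y) p = - \<phi> p (phi_deriv X Y p)"
proof -
  have m: "(\<lambda>q. (-1) *\<^sub>R Y q) \<in> V"
    using field_scale[OF open_UNIV fun_const[of "-1"], of Y] Y by (simp add: fields_on_UNIV)
  have s: "(\<lambda>q. \<Sum>i\<in>{1..s}. \<eta> i q (Y q) *\<^sub>R \<xi> i q) \<in> V"
    unfolding fields_on_UNIV[symmetric]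
    by (rule field_sum[OF open_UNIV], rule field_scale[OF open_UNIV one_form_fun[OF open_UNIV eta_form]])
      (simp_all add: fields_on_UNIV Y xi_field)
  have "D X (Phi (Phi Y)) p = D X (\<lambda>q. (-1) *\<^sub>R Y q + (\<Sum>i\<in>{1..s}. \<eta> i q (Y q) *\<^sub>R \<xi> i q)) p"
    by (simp add: phi_square)
  also have "\<dots> = - D X Y p + (\<Sum>i\<in>{1..s}. \<eta> i p (D X Y p) *\<^sub>R \<xi> i p)"
    using D_add[OF X m s, of p] D_scale[of "\<lambda>q. -1" X Y p] fun_const[of "-1" UNIV] X Y
      D_sum_xi[OF X Y subset_refl, of p]
    by (simp add: funs_on_UNIV vf_deriv_const)
  also have "\<dots> = \<phi> p (\<phi> p (D X Y p))"
    by (simp add: phi_square)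
  finally show ?thesis
    by (simp add: phi_deriv_def linear_diff[OF phi_linear])
qed

lemma phi_deriv_form_phi:
  assumes "X \<in> V" "Y \<in> V"
  shows "phi_deriv_form X (Phi Y) Z p = phi_deriv_form X Y (Phi Z) p"
  by (simp add: phi_deriv_form_def phi_deriv_phi[OF assms] g_simps g_phi_skew)

lemma phi_deriv_form_phi_phi:
  assumes "X \<in> V" "Y \<in> V"
  shows "phi_deriv_form X (Phi Y) (Phi Z) p = - phi_deriv_form X Y Z p"
  unfolding phi_deriv_form_phi[OF assms] by (simp add: phi_deriv_form_def g_phi_phi g_xi eta_phi_deriv[OF _ assms])

text \<open>\<open>\<phi>\<close> is skew for the parallel metric, hence so are its covariant derivatives.\<close>

lemma phi_deriv_form_skew:
  assumes X: "X \<in> V" and Y: "Y \<in> V" and Z: "Z \<in> V"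
  shows "phi_deriv_form X Y Z p = - phi_deriv_form X Z Y p"
proof -
  have "(\<lambda>q. g q (Phi Y q) (Z q)) \<in> funs_on A UNIV"
    by (rule g_fun) (use Phi_field Y Z in \<open>auto simp: fields_on_UNIV\<close>)
  then have "vf_deriv A X (\<lambda>q. g q (Phi Z q) (Y q)) p = - vf_deriv A X (\<lambda>q. g q (Phi Y q) (Z q)) p"
    by (subst vf_deriv_uminus[OF open_UNIV UNIV_I, symmetric])
      (simp_all add: g_phi_skew g_sym[of _ "Z _"])
  then show ?thesis
    unfolding D_metric[OF X Phi_field[OF Z] Y] D_metric[OF X Phi_field[OF Y] Z]
    by (simp add: phi_deriv_form_def phi_deriv_def g_simps g_phi_skew)
qed

text \<open>For any connection the exterior derivative is the alternation of the covariant derivative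
  plus a torsion term; here \<open>(\<nabla>\<^bsub>X\<^esub> F)(Y, Z)\<close> is \<open>- phi_deriv_form X Y Z\<close>.\<close>

lemma d_fundamental_form:
  assumes X: "X \<in> V" and Y: "Y \<in> V" and Z: "Z \<in> V"
  shows "d_two A (fundamental_form \<phi> g) X Y Z p =
    T X Y (Phi Z) p + T Y Z (Phi X) p + T Z X (Phi Y) p
    - (phi_deriv_form X Y Z p + phi_deriv_form Y Z X p + phi_deriv_form Z X Y p)"
proof -
  have F: "vf_deriv A X (\<lambda>q. fundamental_form \<phi> g q (Y q) (Z q)) p =
      g p (D X Y p) (\<phi> p (Z p)) - g p (D X Z p) (\<phi> p (Y p)) - phi_deriv_form X Y Z p"
    if "X \<in> V" "Y \<in> V" "Z \<in> V" for X Y Z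
    unfolding fundamental_form_def D_metric[OF that(1,2) Phi_field[OF that(3)]] phi_deriv_form_skew[OF that]
    by (simp add: phi_deriv_form_def phi_deriv_def g_simps g_phi_skew)
  show ?thesis
    unfolding d_two_def F[OF X Y Z] F[OF Y X Z] F[OF Z X Y]
    unfolding torsion_expand fundamental_form_def
    using phi_deriv_form_skew[OF Y X Z, of p] g_bracket_skew[of p Z X "\<phi> p (Y p)"] by simp
qed

text \<open>Write all brackets in \<open>N = 0\<close> by the connection and its torsion. Terms such as
  \<open>\<phi> (D (Phi X) Y)\<close> cancel in pairs, and the \<open>d\<eta>\<close> terms turn \<open>- \<phi>\<^sup>2 T(X, Y)\<close> into
  \<open>T(X, Y)\<close>.\<close>

lemma nijenhuis_torsion:
  assumes X: "X \<in> V" and Y: "Y \<in> V"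
  shows "T X Y Z p - T (Phi X) (Phi Y) Z p - T X (Phi Y) (Phi Z) p - T (Phi X) Y (Phi Z) p
    + phi_deriv_form (Phi X) Y Z p - phi_deriv_form (Phi Y) X Z p
    + phi_deriv_form X Y (Phi Z) p - phi_deriv_form Y X (Phi Z) p = 0"
proof -
  have br: "lie_bracket A X Y p = D X Y p - D Y X p - torsion A D X Y p" for X Y
    by (simp add: torsion_def)
  have "phi_deriv (Phi X) Y p - phi_deriv (Phi Y) X p - torsion A D (Phi X) (Phi Y) p
      + torsion A D X Y p - \<phi> p (phi_deriv X Y p) + \<phi> p (phi_deriv Y X p)
      + \<phi> p (torsion A D X (Phi Y) p) + \<phi> p (torsion A D (Phi X) Y p) =
      nijenhuis_one A s \<phi> \<xi> \<eta> X Y p"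
  proof -
    have "(\<Sum>i\<in>{1..s}. d_one A (\<eta> i) X Y p *\<^sub>R \<xi> i p) =
        torsion A D X Y p + \<phi> p (\<phi> p (torsion A D X Y p))"
      by (simp add: phi_square eta_torsion[OF _ X Y])
    then show ?thesis
      by (simp add: nijenhuis_one_def nijenhuis_phi_def br[of X Y] br[of "Phi X" "Phi Y"]
          br[of X "Phi Y"] br[of "Phi X" Y] phi_deriv_def linear_diff[OF phi_linear])
  qed
  also have "\<dots> = 0" using normal X Y by (simp add: normal_f_structure_def)
  finally have "g p (phi_deriv (Phi X) Y p - phi_deriv (Phi Y) X p - torsion A D (Phi X) (Phi Y) p
      + torsion A D X Y p - \<phi> p (phi_deriv X Y p) + \<phi> p (phi_deriv Y X p)
      + \<phi> p (torsion A D X (Phi Y) p) + \<phi> p (torsion A D (Phi X) Y p)) (Z p) = 0"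
    by (simp add: g_simps)
  then show ?thesis
    by (simp add: g_simps g_phi_skew phi_deriv_form_def torsion_form_def)
qed

lemma torsion_phi_phi:
  assumes X: "X \<in> V" and Y: "Y \<in> V"
  shows "T (Phi X) (Phi Y) (Phi (Phi Z)) p =
    - T (Phi X) (Phi Y) Z p + (\<Sum>i\<in>{1..s}. \<eta> i p (Z p) * d_one A (\<eta> i) X Y p)"
proof -
  have "T (Phi X) (Phi Y) (Phi (Phi Z)) p = - T (Phi X) (Phi Y) Z p +
      (\<Sum>i\<in>{1..s}. \<eta> i p (Z p) * \<eta> i p (torsion A D (Phi X) (Phi Y) p))"
    by (simp add: torsion_form_def g_phi_phi g_xi)
  also have "(\<Sum>i\<in>{1..s}. \<eta> i p (Z p) * \<eta> i p (torsion A D (Phi X) (Phi Y) p)) =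
      (\<Sum>i\<in>{1..s}. \<eta> i p (Z p) * d_one A (\<eta> i) X Y p)"
    by (rule sum.cong)
      (simp_all add: eta_torsion[OF _ Phi_field[OF X] Phi_field[OF Y]] normal_d_eta_phi[OF normal _ X Y])
  finally show ?thesis .
qed

text \<open>Evaluate \<open>d_fundamental_form\<close> on \<open>Phi X\<close>, \<open>Phi Y\<close>, \<open>Phi Z\<close>. By \<open>torsion_phi_phi\<close> the vertical
  parts of the torsion terms add up to the wedge products in \<open>phi_torsion\<close>.\<close>

lemma torsion_defect:
  assumes X: "X \<in> V" and Y: "Y \<in> V" and Z: "Z \<in> V"
  shows "T X Y Z p - phi_torsion X Y Z p =
    T X Y Z p - T (Phi X) (Phi Y) Z p - T X (Phi Y) (Phi Z) p - T (Phi X) Y (Phi Z) p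
    + phi_deriv_form (Phi X) Y Z p + phi_deriv_form (Phi Y) Z X p + phi_deriv_form (Phi Z) X Y p"
proof -
  note P = Phi_field[OF X] Phi_field[OF Y] Phi_field[OF Z]
  let ?S = "\<lambda>X Y Z. \<Sum>i\<in>{1..s}. \<eta> i p (Z p) * d_one A (\<eta> i) X Y p"
  have "wedge_one_two (\<eta> i) (d_one A (\<eta> i)) X Y Z p = \<eta> i p (Z p) * d_one A (\<eta> i) X Y p
      + \<eta> i p (X p) * d_one A (\<eta> i) Y Z p + \<eta> i p (Y p) * d_one A (\<eta> i) Z X p" if "i \<in> {1..s}" for i
    using d_one_skew[OF eta_form[OF that], of X Z p] by (simp add: wedge_one_two_def)
  then have w: "(\<Sum>i\<in>{1..s}. wedge_one_two (\<eta> i) (d_one A (\<eta> i)) X Y Z p) =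
      ?S X Y Z + ?S Y Z X + ?S Z X Y"
    by (simp add: sum.distrib)
  have cyc: "T (Phi Y) (Phi Z) X p = T X (Phi Y) (Phi Z) p" "T (Phi Z) (Phi X) Y p = T (Phi X) Y (Phi Z) p"
    using torsion_skew[OF P(2,3) X, of p] torsion_skew[OF P(2) X P(3), of p]
      torsion_skew[OF P(3,1) Y, of p] torsion_skew[OF P(1,3) Y, of p] by linarith+
  show ?thesis
    unfolding phi_torsion_def d_phi_F_def w d_fundamental_form[OF P]
      torsion_phi_phi[OF X Y] torsion_phi_phi[OF Y Z] torsion_phi_phi[OF Z X]
      phi_deriv_form_phi_phi[OF P(1) Y] phi_deriv_form_phi_phi[OF P(2) Z] phi_deriv_form_phi_phi[OF P(3) X] cyc
    by linarith
qed

text \<open>If \<open>\<phi>\<close> is parallel, \<open>nijenhuis_torsion\<close> says that the right-hand side of \<open>torsion_defect\<close>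
  vanishes.\<close>

lemma torsion_eq_phi_torsion:
  assumes phi: "\<And>X Y p. X \<in> V \<Longrightarrow> Y \<in> V \<Longrightarrow> D X (Phi Y) p = \<phi> p (D X Y p)"
    and F: "X \<in> V" "Y \<in> V" "Z \<in> V"
  shows "T X Y Z p = phi_torsion X Y Z p"
proof -
  have B0: "phi_deriv_form X Y Z p = 0" if "X \<in> V" "Y \<in> V" for X Y Z p
    using phi[OF that] by (simp add: phi_deriv_form_def phi_deriv_def g_simps)
  show ?thesis
    using nijenhuis_torsion[OF F(1,2), of Z p] torsion_defect[OF F, of p] F Phi_field by (simp add: B0)
qed

text \<open>Comparing \<open>nijenhuis_torsion\<close> with \<open>torsion_defect\<close> eliminates the torsion and leaves a
  relation \<open>R\<close> for \<open>\<nabla>\<phi>\<close> alone. On the image of \<open>\<phi>\<close> it says that of the three cyclic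
  permutations of \<open>\<nabla>\<phi>\<close> the sum of any two is the third, so all three vanish. Since
  \<open>(\<nabla>\<^bsub>X\<^esub> \<phi>)\<close> changes only its sign when both other arguments are replaced by their images under
  \<open>\<phi>\<close>, the vanishing spreads to all \<open>Y\<close> and \<open>Z\<close>, and another use of \<open>R\<close> frees \<open>X\<close>.\<close>

lemma phi_parallel:
  assumes tor: "\<And>X Y Z p. X \<in> V \<Longrightarrow> Y \<in> V \<Longrightarrow> Z \<in> V \<Longrightarrow> T X Y Z p = phi_torsion X Y Z p"
    and X: "X \<in> V" and Y: "Y \<in> V"
  shows "D X (Phi Y) p = \<phi> p (D X Y p)"
proof -
  have R: "phi_deriv_form X Y (Phi Z) p - phi_deriv_form Y X (Phi Z) p = phi_deriv_form (Phi Z) X Y p"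
    if "X \<in> V" "Y \<in> V" "Z \<in> V" for X Y Z
    using nijenhuis_torsion[OF that(1,2), of Z p] torsion_defect[OF that, of p] tor[OF that, of p]
      phi_deriv_form_skew[OF Phi_field[OF that(2)] that(1,3), of p] by linarith
  have B1: "phi_deriv_form (Phi X) (Phi Y) (Phi Z) p = 0" if F: "X \<in> V" "Y \<in> V" "Z \<in> V" for X Y Z
  proof -
    note P = Phi_field[OF F(1)] Phi_field[OF F(2)] Phi_field[OF F(3)]
    show ?thesis
      using R[OF P(1,2) F(3)] R[OF P(2,3) F(1)] R[OF P(3,1) F(2)]
        phi_deriv_form_skew[OF P(2,1,3), of p] phi_deriv_form_skew[OF P(3,2,1), of p]
        phi_deriv_form_skew[OF P(1,3,2), of p] by linarith
  qed
  have B2: "phi_deriv_form (Phi X) Y Z p = 0" if F: "X \<in> V" "Y \<in> V" "Z \<in> V" for X Y Z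
    using B1[OF F] phi_deriv_form_phi_phi[OF Phi_field[OF F(1)] F(2), of Z p] by simp
  have B3: "phi_deriv_form X Y Z p = 0" if F: "X \<in> V" "Y \<in> V" "Z \<in> V" for X Y Z
    using phi_deriv_form_phi_phi[OF F(1,2), of Z p] R[OF F(1) Phi_field[OF F(2)] F(3)]
      B2[OF F(2,1) Phi_field[OF F(3)]] B2[OF F(3,1) Phi_field[OF F(2)]] by simp
  show ?thesis
  proof (rule field_eqI[where W = "Phi (D X Y)"])
    show "D X (Phi Y) \<in> V" "Phi (D X Y) \<in> V" by (intro D_field Phi_field X Y)+
    fix Z assume "Z \<in> V"
    from B3[OF X Y this] show "g p (D X (Phi Y) p) (Z p) = g p (\<phi> p (D X Y p)) (Z p)"
      by (simp add: phi_deriv_form_def phi_deriv_def g_simps)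
  qed
qed

text \<open>With \<open>\<xi> i\<close> and \<open>g\<close> parallel, the Lie derivative of \<open>g\<close> along \<open>\<xi> i\<close> is
  \<open>T(\<xi> i, Y, Z) + T(\<xi> i, Z, Y)\<close>.\<close>

lemma xi_killing:
  assumes i: "i \<in> {1..s}"
  shows "killing A g (\<xi> i)"
  unfolding killing_def
proof (intro conjI xi_field[OF i] ballI allI)
  fix Y Z p assume Y: "Y \<in> V" and Z: "Z \<in> V"
  note x = xi_field[OF i]
  show "lie_deriv_metric A g (\<xi> i) Y Z p = 0"
    using torsion_skew(2)[OF x Y Z, of p] xi_parallel[OF i Y, of p] xi_parallel[OF i Z, of p]
    unfolding lie_deriv_metric_def D_metric[OF x Y Z] torsion_expand g_sym[of p "Y p" "lie_bracket A (\<xi> i) Z p"]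
    by (simp add: g_simps)
qed

lemma almost_metric_phi:
  assumes "\<And>X Y p. X \<in> V \<Longrightarrow> Y \<in> V \<Longrightarrow> D X (Phi Y) p = \<phi> p (D X Y p)"
  shows "almost_metric_phi_connection A s \<phi> \<xi> \<eta> g D"
  using assms affine xi_parallel eta_parallel D_metric g_sym
  unfolding almost_metric_phi_connection_def by simp

end

section \<open>Existence, uniqueness and Killing fields\<close>

context metric_f_manifold
begin

lemma almost_metric_phiD:
  assumes "normal_f_structure A s \<phi> \<xi> \<eta>"
    and "almost_metric_phi_connection A s \<phi> \<xi> \<eta> g D" "has_skew_torsion A g D"
  shows "xi_parallel_connection A n s \<phi> \<xi> \<eta> g D"
    and "X \<in> vector_fields A \<Longrightarrow> Y \<in> vector_fields A \<Longrightarrow> D X (Phi Y) p = \<phi> p (D X Y p)"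
proof -
  have "metric_connection D"
    unfolding metric_connection_def
  proof (intro conjI ballI allI)
    show "D \<in> affine_connections A"
      using assms(2) by (simp add: almost_metric_phi_connection_def)
    fix X Y Z p assume "X \<in> vector_fields A" "Y \<in> vector_fields A" "Z \<in> vector_fields A"
    then have "vf_deriv A X (\<lambda>q. g q (Y q) (Z q)) p - g p (D X Y p) (Z p) - g p (Y p) (D X Z p) = 0"
      using assms(2) unfolding almost_metric_phi_connection_def by blast
    then show "vf_deriv A X (\<lambda>q. g q (Y q) (Z q)) p = g p (D X Y p) (Z p) + g p (Y p) (D X Z p)" by simp
  qed
  then show "xi_parallel_connection A n s \<phi> \<xi> \<eta> g D"
    using assms by unfold_locales (auto simp: almost_metric_phi_connection_def)
  show "D X (Phi Y) p = \<phi> p (D X Y p)" if "X \<in> vector_fields A" "Y \<in> vector_fields A"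
    using assms(2) that by (simp add: almost_metric_phi_connection_def)
qed

text \<open>For \<open>Y = \<xi> i\<close> the Koszul expression splits into the Lie derivative of \<open>g\<close> along \<open>\<xi> i\<close> and
  \<open>d\<eta> i\<close>; the former vanishes and the torsion cancels the latter.\<close>

lemma killing_xi_parallel:
  assumes N: "normal_f_structure A s \<phi> \<xi> \<eta>" and K: "killing A g (\<xi> i)" and i: "i \<in> {1..s}"
    and D: "metric_connection D" "has_skew_torsion A g D"
    and tor: "\<And>X Y Z p. X \<in> vector_fields A \<Longrightarrow> Y \<in> vector_fields A \<Longrightarrow> Z \<in> vector_fields A \<Longrightarrow>
      torsion_form A g D X Y Z p = phi_torsion X Y Z p"
    and X: "X \<in> vector_fields A"
  shows "D X (\<xi> i) p = 0"
proof (rule field_eqI[where W = "\<lambda>q. 0"])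
  note x = xi_field[OF i]
  show "D X (\<xi> i) \<in> vector_fields A" "(\<lambda>q. 0) \<in> vector_fields A"
    using connection_field[OF _ X x] D field_zero[of UNIV]
    by (auto simp: metric_connection_def fields_on_UNIV)
  fix Z assume Z: "Z \<in> vector_fields A"
  have k: "lie_deriv_metric A g (\<xi> i) X Z p = 0"
    using K X Z by (simp add: killing_def)
  have s: "g q (\<xi> i q) u = \<eta> i q u" for q u
    using g_xi[OF i, of q u] g_sym by metis
  have "2 * g p (D X (\<xi> i) p) (Z p) = koszul X (\<xi> i) Z p - d_one A (\<eta> i) X Z p"
    using metric_connection_koszul[OF D X x Z, of p] tor[OF X x Z, of p]
      phi_torsion_xi[OF N i X Z, of p] by simp
  also have "koszul X (\<xi> i) Z p = lie_deriv_metric A g (\<xi> i) X Z p + d_one A (\<eta> i) X Z p"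
    using lie_bracket_skew[of X "\<xi> i" p] g_sym[of p "X p" "lie_bracket A (\<xi> i) Z p"]
    by (simp add: koszul_def lie_deriv_metric_def d_one_def s g_xi[OF i] g_simps)
  finally show "g p (D X (\<xi> i) p) (Z p) = g p 0 (Z p)" using k by (simp add: g_simps)
qed

end

theorem proposition4p1:
  fixes A :: "('m::{t2_space,second_countable_topology}, 'e::euclidean_space) chart set"
    and n s :: nat
    and \<phi> :: "'m \<Rightarrow> 'e \<Rightarrow> 'e"
    and \<xi> :: "nat \<Rightarrow> 'm \<Rightarrow> 'e"
    and \<eta> :: "nat \<Rightarrow> 'm \<Rightarrow> 'e \<Rightarrow> real"
    and g :: "'m \<Rightarrow> 'e \<Rightarrow> 'e \<Rightarrow> real"
  assumes "metric_f_manifold A n s \<phi> \<xi> \<eta> g"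
    and "normal_f_structure A s \<phi> \<xi> \<eta>"
  shows "((\<exists>!D. almost_metric_phi_connection A s \<phi> \<xi> \<eta> g D \<and> has_skew_torsion A g D)
            \<longleftrightarrow> (\<forall>i\<in>{1..s}. killing A g (\<xi> i))) \<and>
         ((\<forall>i\<in>{1..s}. killing A g (\<xi> i)) \<longrightarrow>
           (\<forall>D. almost_metric_phi_connection A s \<phi> \<xi> \<eta> g D \<and> has_skew_torsion A g D \<longrightarrow>
             (\<forall>X\<in>vector_fields A. \<forall>Y\<in>vector_fields A. \<forall>Z\<in>vector_fields A. \<forall>p.
                torsion_form A g D X Y Z p =
                  (\<Sum>i\<in>{1..s}. wedge_one_two (\<eta> i) (d_one A (\<eta> i)) X Y Z p)
                  + d_phi_F A \<phi> g X Y Z p)))"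
proof -
  interpret metric_f_manifold A n s \<phi> \<xi> \<eta> g by (rule assms(1))
  let ?P = "\<lambda>D. almost_metric_phi_connection A s \<phi> \<xi> \<eta> g D \<and> has_skew_torsion A g D"
  have par: "xi_parallel_connection A n s \<phi> \<xi> \<eta> g D" if "?P D" for D
    using almost_metric_phiD(1)[OF assms(2)] that by blast
  have tor: "torsion_form A g D X Y Z p = phi_torsion X Y Z p"
    if D: "?P D" and F: "X \<in> vector_fields A" "Y \<in> vector_fields A" "Z \<in> vector_fields A" for D X Y Z p
    by (rule xi_parallel_connection.torsion_eq_phi_torsion[OF par[OF D] _ F])
      (use almost_metric_phiD(2)[OF assms(2)] D in blast)
  have unique: "D = D'" if D: "?P D" and D': "?P D'" for D D'
  proof (rule metric_connection_unique)
    show "metric_connection D" "has_skew_torsion A g D" "metric_connection D'" "has_skew_torsion A g D'"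
      using par[OF D] par[OF D'] by (simp_all add: xi_parallel_connection.connection
          xi_parallel_connection.skew_torsion)
  qed (simp add: tor[OF D] tor[OF D'])
  have kill: "\<forall>i\<in>{1..s}. killing A g (\<xi> i)" if "?P D" for D
    using xi_parallel_connection.xi_killing[OF par[OF that]] by blast
  have exists: "\<exists>D. ?P D" if K: "\<forall>i\<in>{1..s}. killing A g (\<xi> i)"
  proof -
    obtain D where D: "metric_connection D"
      and T: "\<forall>X\<in>vector_fields A. \<forall>Y\<in>vector_fields A. \<forall>Z\<in>vector_fields A. \<forall>p.
        torsion_form A g D X Y Z p = phi_torsion X Y Z p"
      using metric_connection_exists[OF phi_torsion_three_form] by blast
    have T': "torsion_form A g D X Y Z p = phi_torsion X Y Z p"
      if "X \<in> vector_fields A" "Y \<in> vector_fields A" "Z \<in> vector_fields A" for X Y Z p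
      using T that by blast
    have S: "has_skew_torsion A g D"
      unfolding has_skew_torsion_def by (rule local_three_form_is_three_form[OF phi_torsion_three_form T'])
    interpret xi_parallel_connection A n s \<phi> \<xi> \<eta> g D
      by unfold_locales (use assms(2) D S killing_xi_parallel[OF assms(2) _ _ D S T'] K in auto)
    show ?thesis
      using almost_metric_phi[OF phi_parallel[OF T']] S by blast
  qed
  have "(\<exists>!D. ?P D) \<longleftrightarrow> (\<forall>i\<in>{1..s}. killing A g (\<xi> i))"
    using unique kill exists by blast
  then show ?thesis
    using tor unfolding phi_torsion_def by blast
qed

end
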